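(* Let $d\alpha$ be a standardized probability measure on $\mathbb{R}$, let $q>1$ be a real number and let $K:\mathbb{C}[x]\to L^q(\mathbb{R},d\alpha)$ be a linear operator. For integers $\ell,m\ge 0$ define $K_{\ell,m}=\int_{\mathbb{R}} K(H_\ell)(x)H_m(x)\,d\alpha(x)$, and assume that $K_{0,0}=1$, $K_{0,1}=K_{1,0}=0$ and $\mathrm{Re}\,K_{0,2}>-1$. Let $\mathcal{C}=M_\tau T_\omega S_\lambda\in\mathfrak{C}$ be the unique Centered Gaussian Operator such that $$\lim_{N\to\infty}\int_{\mathbb{R}^N}K_N(f_+)(\boldsymbol{x})\,g_+(\boldsymbol{x})\,d\alpha_N(\sqrt{N}\boldsymbol{x})=\int_{\mathbb{R}}\mathcal{C}(f)(x)\,g(x)\,d\gamma(x)\qquad( * )$$ for every $f,g\in\mathbb{C}[x]$. Suppose in addition that there exist a standardized probability measure $d\beta$ on $\mathbb{R}$ and a real number $p\in[1,q]$ such that $$\|Kf\|_{L^q(d\alpha)}\le\|f\|_{L^p(d\beta)}$$ for every $f\in\mathbb{C}[x]$. Then $\mathcal{C}$ extends to a bounded operator from $L^p(\mathbb{R},d\gamma)$ to $L^q(\mathbb{R},d\gamma)$ of unit norm. Moreover, $\tau=0$ (or equivalently $\mathcal{C}(1)=1$), and the limit $( * )$ is also valid for all $f\in\mathbb{C}[x]$ and all continuous functions $g$ on $\mathbb{R}$ satisfying an estimate of the form $|g(x)|\le A(1+|x|^A)$ for some $A>0$.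
   Context: A probability measure on $\mathbb{R}$ is called standardized if it has zero mean, unit variance and finite moments of all orders. $d\gamma(x)=(2\pi)^{-1/2}e^{-x^2/2}dx$ is the normal distribution. $\{H_\ell\}_{\ell\ge0}$ are the monic Hermite polynomials, orthogonal with respect to $d\gamma$ ($H_0=1$, $H_1=x$, $H_{\ell+1}=xH_\ell-\ell H_{\ell-1}$). $\mathbb{C}[x]$ and $\mathbb{C}[x_1,\dots,x_N]$ are rings of polynomials with complex coefficients. For a probability measure $d\alpha$ on $\mathbb{R}$, $d\alpha_N(\boldsymbol{x})=d\alpha(x_1)\times\cdots\times d\alpha(x_N)$ is the $N$-fold product measure on $\mathbb{R}^N$, and $d\alpha_N(\sqrt N\boldsymbol{x})$ is its rescaling, i.e. $\int h(\boldsymbol{x})\,d\alpha_N(\sqrt N\boldsymbol{x})=\int h(\boldsymbol{x}/\sqrt N)\,d\alpha_N(\boldsymbol{x})$. For a function $f$ of one real variable, $f_+(\boldsymbol{x})=f(x_1+\dots+x_N)$. The operators $K_N$: for a linear operator $K:\mathbb{C}[x]\to L^q(\mathbb{R},d\alpha)$ and an integer $N>0$, $K_N:\mathbb{C}[x_1,\dots,x_N]\to L^q(\mathbb{R}^N,d\alpha_N(\sqrt N\boldsymbol{x}))$ is the linear operator $K_N=S_{N,\sqrt N}K_{N,N}K_{N,N-1}\cdots K_{N,1}S_{N,1/\sqrt N}$, where $K_{N,n}$ is $K$ applied in the $n$th variable and $S_{N,\lambda}f(x_1,\dots,x_N)=f(\lambda x_1,\dots,\lambda x_N)$. Explicitly,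 with $p_j(x)=x^j$, $K_N$ is the linear map with $$K_N\big(x_1^{j_1}\cdots x_N^{j_N}\big)(\boldsymbol{x})=N^{-(j_1+\dots+j_N)/2}\,K(p_{j_1})(\sqrt N x_1)\cdots K(p_{j_N})(\sqrt N x_N).$$ Centered Gaussian Operators: for $\omega,\lambda,\tau\in\mathbb{C}$ with $\mathrm{Re}\,\tau>-1$, $T_\omega:\mathbb{C}[x]\to\mathbb{C}[x]$ is the linear operator with $T_\omega H_\ell=\omega^\ell H_\ell$ for all $\ell\ge 0$ (with $0^0=1$); $(S_\lambda f)(x)=f(\lambda x)$; and $(M_\tau f)(x)=\sqrt{1+\tau}\,e^{-\tau x^2/2}f(x)$, with the principal branch of the square root. The family of Centered Gaussian Operators, regarded as operators on $\mathbb{C}[x]$, is $$\mathfrak{C}=\{M_\tau T_\omega S_\lambda:\ \lambda,\omega,\tau\in\mathbb{C},\ \mathrm{Re}\,\tau>-1\}.$$ *)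

theory Defs
  imports
    "HOL-Probability.Probability"
    "HOL-Library.Poly_Mapping"
    "HOL-Computational_Algebra.Polynomial"
begin

definition standardized :: "real measure \<Rightarrow> bool" where
  "standardized M \<longleftrightarrow> real_distribution M \<and>
     (\<forall>k. integrable M (\<lambda>x. x ^ k)) \<and>
     prob_space.expectation M (\<lambda>x. x) = 0 \<and>
     prob_space.variance M (\<lambda>x. x) = 1"

abbreviation gauss :: "real measure" where
  "gauss \<equiv> density lborel (\<lambda>x. ennreal (std_normal_density x))"

abbreviation poly_fun :: "complex poly \<Rightarrow> real \<Rightarrow> complex" where
  "poly_fun f \<equiv> (\<lambda>x. poly f (complex_of_real x))"

(* Elements of an L^p space are represented by functions; an equation between elements is an
   almost-everywhere equation between representatives. *)

definition Lp_space :: "real \<Rightarrow> 'a measure \<Rightarrow> ('a \<Rightarrow> complex) set" where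
  "Lp_space p M = {f \<in> borel_measurable M. integrable M (\<lambda>x. norm (f x) powr p)}"

definition Lp_norm :: "real \<Rightarrow> 'a measure \<Rightarrow> ('a \<Rightarrow> complex) \<Rightarrow> real" where
  "Lp_norm p M f = (\<integral>x. norm (f x) powr p \<partial>M) powr (1 / p)"

definition poly_Lp_operator ::
    "real \<Rightarrow> 'a measure \<Rightarrow> (complex poly \<Rightarrow> 'a \<Rightarrow> complex) \<Rightarrow> bool" where
  "poly_Lp_operator q M K \<longleftrightarrow>
     (\<forall>f. K f \<in> Lp_space q M) \<and>
     (\<forall>f g. AE x in M. K (f + g) x = K f x + K g x) \<and>
     (\<forall>c f. AE x in M. K (smult c f) x = c * K f x)"

(* The second conjunct says that E is well defined on almost-everywhere classes. *)

definition Lp_operator ::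
    "real \<Rightarrow> 'a measure \<Rightarrow> real \<Rightarrow> 'b measure \<Rightarrow> (('a \<Rightarrow> complex) \<Rightarrow> 'b \<Rightarrow> complex) \<Rightarrow> bool" where
  "Lp_operator p M q N E \<longleftrightarrow>
     (\<forall>f\<in>Lp_space p M. E f \<in> Lp_space q N) \<and>
     (\<forall>f\<in>Lp_space p M. \<forall>g\<in>Lp_space p M.
        (AE x in M. f x = g x) \<longrightarrow> (AE x in N. E f x = E g x)) \<and>
     (\<forall>f\<in>Lp_space p M. \<forall>g\<in>Lp_space p M. AE x in N. E (\<lambda>y. f y + g y) x = E f x + E g x) \<and>
     (\<forall>c. \<forall>f\<in>Lp_space p M. AE x in N. E (\<lambda>y. c * f y) x = c * E f x)"

definition bounded_Lp_operator ::
    "real \<Rightarrow> 'a measure \<Rightarrow> real \<Rightarrow> 'b measure \<Rightarrow> (('a \<Rightarrow> complex) \<Rightarrow> 'b \<Rightarrow> complex) \<Rightarrow> bool" where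
  "bounded_Lp_operator p M q N E \<longleftrightarrow> Lp_operator p M q N E \<and>
     (\<exists>B. \<forall>f\<in>Lp_space p M. Lp_norm q N (E f) \<le> B * Lp_norm p M f)"

definition Lp_opnorm ::
    "real \<Rightarrow> 'a measure \<Rightarrow> real \<Rightarrow> 'b measure \<Rightarrow> (('a \<Rightarrow> complex) \<Rightarrow> 'b \<Rightarrow> complex) \<Rightarrow> real" where
  "Lp_opnorm p M q N E = (SUP f\<in>{f \<in> Lp_space p M. Lp_norm p M f \<le> 1}. Lp_norm q N (E f))"

fun hermite :: "nat \<Rightarrow> complex poly" where
  "hermite 0 = 1"
| "hermite (Suc 0) = [:0, 1:]"
| "hermite (Suc (Suc n)) = [:0, 1:] * hermite (Suc n) - of_nat (Suc n) * hermite n"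

definition hermite_coeff :: "real measure \<Rightarrow> (complex poly \<Rightarrow> real \<Rightarrow> complex) \<Rightarrow> nat \<Rightarrow> nat \<Rightarrow> complex"
  where "hermite_coeff M K l m = (\<integral>x. K (hermite l) x * poly_fun (hermite m) x \<partial>M)"

(* A polynomial in the variables x_0, x_1, ... is a finitely supported map from monomials to
   coefficients; a monomial is the finitely supported map of its exponents. The variables
   x_1, ..., x_N are indexed by {..<N}. *)

type_synonym mpoly_complex = "(nat \<Rightarrow>\<^sub>0 nat) \<Rightarrow>\<^sub>0 complex"

definition mvar :: "nat \<Rightarrow> mpoly_complex" where
  "mvar n = Poly_Mapping.single (Poly_Mapping.single n 1) 1"

definition mconst :: "complex \<Rightarrow> mpoly_complex" where
  "mconst c = Poly_Mapping.single 0 c"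

definition poly_plus :: "nat \<Rightarrow> complex poly \<Rightarrow> mpoly_complex" where
  "poly_plus N f = poly (map_poly mconst f) (\<Sum>n<N. mvar n)"

definition fun_plus :: "nat \<Rightarrow> (real \<Rightarrow> complex) \<Rightarrow> (nat \<Rightarrow> real) \<Rightarrow> complex" where
  "fun_plus N g = (\<lambda>x. g (\<Sum>n<N. x n))"

definition K_tensor ::
    "(complex poly \<Rightarrow> real \<Rightarrow> complex) \<Rightarrow> nat \<Rightarrow> mpoly_complex \<Rightarrow> (nat \<Rightarrow> real) \<Rightarrow> complex" where
  "K_tensor K N P = (\<lambda>x. \<Sum>j\<in>Poly_Mapping.keys P. Poly_Mapping.lookup P j *
      complex_of_real (real N powr (- real (\<Sum>n<N. Poly_Mapping.lookup j n) / 2)) *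
      (\<Prod>n<N. K (monom 1 (Poly_Mapping.lookup j n)) (sqrt (real N) * x n)))"

(* d alpha_N (sqrt N x): the law of x / sqrt N when x has law alpha_N. *)

definition scaled_product :: "real measure \<Rightarrow> nat \<Rightarrow> (nat \<Rightarrow> real) measure" where
  "scaled_product M N = distr (PiM {..<N} (\<lambda>_. M)) (PiM {..<N} (\<lambda>_. borel))
     (\<lambda>x. \<lambda>n\<in>{..<N}. x n / sqrt (real N))"

definition T_op :: "complex \<Rightarrow> complex poly \<Rightarrow> complex poly" where
  "T_op \<omega> = (THE T. Vector_Spaces.linear smult smult T \<and>
                    (\<forall>l. T (hermite l) = smult (\<omega> ^ l) (hermite l)))"

definition S_op :: "complex \<Rightarrow> complex poly \<Rightarrow> complex poly" where
  "S_op lam f = pcompose f [:0, lam:]"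

definition M_op :: "complex \<Rightarrow> (real \<Rightarrow> complex) \<Rightarrow> real \<Rightarrow> complex" where
  "M_op \<tau> h = (\<lambda>x. csqrt (1 + \<tau>) * exp (- \<tau> * (complex_of_real x)\<^sup>2 / 2) * h x)"

definition gaussian_op :: "complex \<Rightarrow> complex \<Rightarrow> complex \<Rightarrow> complex poly \<Rightarrow> real \<Rightarrow> complex" where
  "gaussian_op \<tau> \<omega> lam f = M_op \<tau> (poly_fun (T_op \<omega> (S_op lam f)))"

definition clt_limit ::
    "real measure \<Rightarrow> (complex poly \<Rightarrow> real \<Rightarrow> complex) \<Rightarrow> (complex poly \<Rightarrow> real \<Rightarrow> complex) \<Rightarrow>
     complex poly \<Rightarrow> (real \<Rightarrow> complex) \<Rightarrow> bool" where
  "clt_limit M K C f g \<longleftrightarrow>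
     (\<lambda>N. \<integral>x. K_tensor K N (poly_plus N f) x * fun_plus N g x \<partial>(scaled_product M N))
       \<longlonglongrightarrow> (\<integral>x. C f x * g x \<partial>gauss)"

(* Existence and uniqueness behind the definite description in T_op. *)

lemma hermite_degree_lead: "degree (hermite n) = n \<and> lead_coeff (hermite n) = 1"
proof (induction n rule: hermite.induct)
  case (3 n)
  have a: "degree ([:0, 1:] * hermite (Suc n)) = Suc (Suc n)"
    using 3 by (subst degree_mult_eq) auto
  have b: "degree (of_nat (Suc n) * hermite n) \<le> n"
    using 3 by (metis degree_mult_le degree_of_nat add_0)
  have "coeff (hermite (Suc (Suc n))) (Suc (Suc n)) = 1"
  proof -
    have "coeff (hermite (Suc n)) (Suc n) = 1" using 3 by metis
    then show ?thesis
      using b coeff_eq_0[of "of_nat (Suc n) * hermite n" "Suc (Suc n)"] by simp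
  qed
  moreover have "degree (hermite (Suc (Suc n))) \<le> Suc (Suc n)"
    using degree_diff_le[of "[:0, 1:] * hermite (Suc n)" "Suc (Suc n)" "of_nat (Suc n) * hermite n"] a b
    by simp
  ultimately show ?case
    by (metis le_antisym le_degree zero_neq_one)
qed auto

fun T_mono :: "complex \<Rightarrow> nat \<Rightarrow> complex poly" where
  "T_mono w n = smult (w ^ n) (hermite n) - (\<Sum>i<n. smult (coeff (hermite n) i) (T_mono w i))"

declare T_mono.simps [simp del]

lemma vector_space_smult: "vector_space (smult :: complex \<Rightarrow> complex poly \<Rightarrow> complex poly)"
  by unfold_locales (auto simp: smult_add_right smult_add_left)

lemma module_smult: "module (smult :: complex \<Rightarrow> complex poly \<Rightarrow> complex poly)"
  by unfold_locales (auto simp: smult_add_right smult_add_left)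

lemma linear_smult_iff:
  "Vector_Spaces.linear smult smult (T :: complex poly \<Rightarrow> complex poly) \<longleftrightarrow>
     (\<forall>f g. T (f + g) = T f + T g) \<and> (\<forall>c f. T (smult c f) = smult c (T f))"
  using vector_space_smult
  by (simp add: Vector_Spaces.linear_def module_hom_def module_hom_axioms_def vector_space_def
      module_def)

lemma T_op_exists:
  "\<exists>T. Vector_Spaces.linear smult smult T \<and> (\<forall>l. T (hermite l) = smult (w ^ l) (hermite l))"
proof -
  define T where "T f = (\<Sum>i\<le>degree f. smult (coeff f i) (T_mono w i))" for f
  have T: "T f = (\<Sum>i\<le>n. smult (coeff f i) (T_mono w i))" if "degree f \<le> n" for f n
    unfolding T_def using that
    by (intro sum.mono_neutral_left) (auto simp: coeff_eq_0)
  have add: "T (f + g) = T f + T g" for f g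
  proof -
    let ?n = "max (degree f) (degree g)"
    have "degree (f + g) \<le> ?n" by (rule degree_add_le_max)
    then show ?thesis
      using T[of f ?n] T[of g ?n] T[of "f + g" ?n]
      by (simp add: smult_add_left sum.distrib)
  qed
  have sm: "T (smult c f) = smult c (T f)" for c f
    using T[of f "degree f"] T[of "smult c f" "degree f"] degree_smult_le[of c f]
    by (simp add: module.scale_sum_right[OF module_smult])
  have "T (hermite l) = smult (w ^ l) (hermite l)" for l
  proof -
    have lc: "coeff (hermite l) l = 1" using hermite_degree_lead[of l] by metis
    have "T (hermite l) = (\<Sum>i\<le>l. smult (coeff (hermite l) i) (T_mono w i))"
      using hermite_degree_lead[of l] by (simp add: T)
    also have "\<dots> = (\<Sum>i<l. smult (coeff (hermite l) i) (T_mono w i)) + T_mono w l"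
      using lc by (simp add: lessThan_Suc_atMost[symmetric])
    finally show ?thesis by (simp add: T_mono.simps[of w l])
  qed
  with add sm show ?thesis by (auto simp: linear_smult_iff intro!: exI[of _ T])
qed

lemma linear_hermite_unique:
  fixes T U :: "complex poly \<Rightarrow> complex poly"
  assumes "Vector_Spaces.linear smult smult T" "Vector_Spaces.linear smult smult U"
    and eq: "\<And>l. T (hermite l) = U (hermite l)"
  shows "T = U"
proof
  have T: "T (f + g) = T f + T g" "T (smult c f) = smult c (T f)"
    and U: "U (f + g) = U f + U g" "U (smult c f) = smult c (U f)" for f g c
    using assms by (auto simp: linear_smult_iff)
  have zero: "T 0 = 0" "U 0 = 0" using T(2)[of 0 0] U(2)[of 0 0] by auto
  fix f show "T f = U f"
  proof (induction "degree f" arbitrary: f rule: less_induct)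
    case less
    let ?h = "smult (lead_coeff f) (hermite (degree f))"
    have h: "T ?h = U ?h" by (simp add: T U eq)
    show ?case
    proof (cases "f = ?h")
      case True
      then show ?thesis using h by metis
    next
      case False
      have d: "degree ?h \<le> degree f" using hermite_degree_lead[of "degree f"] by simp
      have "coeff (f - ?h) (degree f) = 0"
      proof -
        have "coeff (hermite (degree f)) (degree f) = 1"
          using hermite_degree_lead[of "degree f"] by metis
        then show ?thesis by simp
      qed
      moreover have "degree (f - ?h) \<le> degree f" using d by (intro degree_diff_le) auto
      ultimately have lt: "degree (f - ?h) < degree f"
        using False by (metis eq_iff_diff_eq_0 le_neq_implies_less leading_coeff_0_iff)
      have "T (f - ?h) = U (f - ?h)" using less[OF lt] .
      then show ?thesis using h T(1)[of "f - ?h" ?h] U(1)[of "f - ?h" ?h] by simp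
    qed
  qed
qed

lemma T_op_linear: "Vector_Spaces.linear smult smult (T_op w)"
  and T_op_hermite: "T_op w (hermite l) = smult (w ^ l) (hermite l)"
proof -
  let ?P = "\<lambda>T. Vector_Spaces.linear smult smult T \<and>
                 (\<forall>l. T (hermite l) = smult (w ^ l) (hermite l))"
  have "\<exists>!T. ?P T" using T_op_exists linear_hermite_unique by metis
  from theI'[OF this] show "Vector_Spaces.linear smult smult (T_op w)"
    and "T_op w (hermite l) = smult (w ^ l) (hermite l)"
    unfolding T_op_def by blast+
qed

end

theory Submission
  imports Defs
begin

text \<open>
  The contraction property of \<open>K\<close> is stable under tensor powers. Because \<open>p \<le> q\<close>, Minkowski's integral
  inequality lets the operators \<open>K\<close> act one variable at a time without loss of norm
  (\<open>tensor_power_contraction\<close>), so \<open>K\<^sub>N\<close> is a contraction from \<open>L\<^sup>p\<close> of the rescaled \<open>\<beta>\<^sup>N\<close> to \<open>L\<^sup>q\<close> of the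
  rescaled \<open>\<alpha>\<^sup>N\<close>. On functions \<open>f\<^sub>+\<close> these norms only see the law of a normalized sum of independent
  variables, and by the central limit theorem, valid for continuous functions of polynomial growth since
  all moments of the sums stay bounded (\<open>clt_poly_growth\<close>), they converge to norms with respect to the
  normal law \<open>\<gamma>\<close>. Hence every pairing obeys
  \<open>\<bar>\<integral> K\<^sub>N (f\<^sub>+) g\<^sub>+\<bar> \<le> \<parallel>f\<^sub>+\<parallel>\<^sub>p \<parallel>g\<^sub>+\<parallel>\<^sub>q\<^sub>'\<close> with \<open>1/q + 1/q' = 1\<close>, and the right-hand side converges to
  \<open>\<parallel>f\<parallel>\<^sub>p \<parallel>g\<parallel>\<^sub>q\<^sub>'\<close> in \<open>\<gamma>\<close>.

  This estimate yields everything except \<open>\<tau> = 0\<close>. Polynomials are dense in \<open>L\<^sup>q\<^sup>'(\<gamma>)\<close>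
  (\<open>poly_dense_in_Lp_gauss\<close>), so the limit passes from polynomial \<open>g\<close> to all continuous \<open>g\<close> of polynomial
  growth (\<open>clt_limit_poly_growth\<close>). Among these is the extremal function
  \<open>\<bar>C f\<bar>\<^sup>q\<^sup>-\<^sup>2\<close> times the conjugate of \<open>C f\<close>, for which the estimate becomes \<open>\<parallel>C f\<parallel>\<^sub>q \<le> \<parallel>f\<parallel>\<^sub>p\<close>
  (\<open>limit_operator_contraction\<close>). By density of polynomials in \<open>L\<^sup>p(\<gamma>)\<close> and completeness of \<open>L\<^sup>q(\<gamma>)\<close>, the
  operator extends with norm at most one (\<open>contraction_on_polys_extends\<close>), and the constant function \<open>1\<close>
  attains the norm.

  That \<open>\<tau> = 0\<close> comes first, since it makes \<open>C f\<close> a polynomial. The function \<open>K 1\<close> has mean \<open>1\<close> and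
  \<open>L\<^sup>q\<close> norm at most \<open>\<parallel>1\<parallel>\<^sub>p = 1\<close>, which is the equality case of Hoelder's inequality, so \<open>K 1 = 1\<close> almost
  everywhere and \<open>K\<^sub>N 1 = 1\<close>. The limit for \<open>f = 1\<close> is therefore the ordinary central limit theorem, and
  so \<open>\<integral> C 1 d\<gamma> = \<integral> x\<^sup>2 C 1 d\<gamma> = 1\<close>. Integration by parts says that the first integral is \<open>1 + \<tau>\<close> times the
  second, whence \<open>\<tau> = 0\<close>.
\<close>

section \<open>Norms and inequalities of Lebesgue spaces\<close>

text \<open>
  Homogeneity arguments divide by norms that may vanish; replacing a norm \<open>a\<close> by \<open>a + e\<close> avoids the
  case distinction, and this lemma removes \<open>e\<close> at the end.
\<close>

lemma le_limit_at_right_zero: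
  fixes h :: "real \<Rightarrow> real"
  assumes "(h \<longlongrightarrow> y) (at_right 0)" and "\<And>e. e > 0 \<Longrightarrow> x \<le> h e"
  shows "x \<le> y"
  using assms by (intro tendsto_lowerbound[OF assms(1)]) (auto simp: eventually_at_filter)

lemma Lp_norm_nonneg [simp]: "0 \<le> Lp_norm p M f"
  by (simp add: Lp_norm_def)

lemma Lp_norm_powr: "p > 0 \<Longrightarrow> Lp_norm p M f powr p = (\<integral>x. norm (f x) powr p \<partial>M)"
  by (simp add: Lp_norm_def powr_powr)

lemma Lp_norm_le_iff:
  assumes "p > 0" "0 \<le> a"
  shows "Lp_norm p M f \<le> a \<longleftrightarrow> (\<integral>x. norm (f x) powr p \<partial>M) \<le> a powr p"
proof -
  have "Lp_norm p M f \<le> a \<longleftrightarrow> Lp_norm p M f powr p \<le> a powr p"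
    using assms by (metis Lp_norm_nonneg linorder_not_le powr_less_mono2 powr_mono2 less_imp_le)
  then show ?thesis using assms by (simp add: Lp_norm_powr)
qed

lemma Lp_norm_scale:
  assumes "p > 0"
  shows "Lp_norm p M (\<lambda>x. c * f x) = norm c * Lp_norm p M f"
  using assms by (simp add: Lp_norm_def norm_mult powr_mult powr_powr)

lemma Lp_norm_minus_commute: "Lp_norm p M (\<lambda>x. f x - g x) = Lp_norm p M (\<lambda>x. g x - f x)"
  by (simp add: Lp_norm_def norm_minus_commute)

lemma Lp_norm_cong_AE:
  assumes "f \<in> borel_measurable M" "g \<in> borel_measurable M" "AE x in M. f x = g x"
  shows "Lp_norm p M f = Lp_norm p M g"
proof -
  have "(\<integral>x. norm (f x) powr p \<partial>M) = (\<integral>x. norm (g x) powr p \<partial>M)"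
    using assms by (intro integral_cong_AE) auto
  then show ?thesis by (simp add: Lp_norm_def)
qed

lemma Lp_norm_eq_0_AE:
  assumes "p > 0" "f \<in> Lp_space p M" "Lp_norm p M f = 0"
  shows "AE x in M. f x = 0"
proof -
  have "(\<integral>x. norm (f x) powr p \<partial>M) = 0" using assms Lp_norm_powr[of p M f] by simp
  then show ?thesis
    using assms(2) by (subst (asm) integral_nonneg_eq_0_iff_AE) (auto simp: Lp_space_def)
qed

lemma Lp_space_measurable [dest, measurable_dest]: "f \<in> Lp_space p M \<Longrightarrow> f \<in> borel_measurable M"
  by (simp add: Lp_space_def)

text \<open>
  Convexity of \<open>x \<mapsto> x\<^sup>p\<close> on the closed half-line; the endpoint \<open>0\<close> is where norms of functions vanish.
\<close>

lemma powr_convex_combination: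
  fixes a b s t p :: real
  assumes "0 \<le> a" "0 \<le> b" "0 \<le> s" "0 \<le> t" "s + t = 1" "p \<ge> 1"
  shows "(s * a + t * b) powr p \<le> s * a powr p + t * b powr p"
proof -
  have one: "(t * b) powr p \<le> t * b powr p" if "0 \<le> t" "t \<le> 1" "0 \<le> b" for t b :: real
  proof (cases "t = 0")
    case False
    then have "t powr p \<le> t powr 1" using that assms by (intro powr_mono') auto
    then show ?thesis using that False by (simp add: powr_mult mult_right_mono)
  qed (use assms in auto)
  have s: "s = 1 - t" using assms by simp
  consider "a = 0" | "b = 0" | "a > 0" "b > 0" using assms by linarith
  then show ?thesis
  proof cases
    case 3
    then show ?thesis
      using convex_onD[OF powr_convex[OF \<open>p \<ge> 1\<close>], of t a b] assms(3-5)
      by (simp add: s)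
  qed (use assms one[of t b] one[of s a] in auto)
qed

lemma Lp_space_scale: "f \<in> Lp_space p M \<Longrightarrow> (\<lambda>x. c * f x) \<in> Lp_space p M"
  by (auto simp: Lp_space_def norm_mult powr_mult)

text \<open>
  After scaling both functions to norm less than one, integrate Young's inequality pointwise.
\<close>

lemma Holder_inequality:
  fixes f g :: "'a \<Rightarrow> complex"
  assumes "p > 1" "q > 1" "1 / p + 1 / q = 1"
    and f: "f \<in> Lp_space p M" and g: "g \<in> Lp_space q M"
  shows Holder_integrable: "integrable M (\<lambda>x. f x * g x)"
    and Holder_integral_norm: "(\<integral>x. norm (f x * g x) \<partial>M) \<le> Lp_norm p M f * Lp_norm q M g"
    and Holder_norm_integral: "norm (\<integral>x. f x * g x \<partial>M) \<le> Lp_norm p M f * Lp_norm q M g"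
proof -
  have [measurable]: "f \<in> borel_measurable M" "g \<in> borel_measurable M"
    and fi: "integrable M (\<lambda>x. norm (f x) powr p)" and gi: "integrable M (\<lambda>x. norm (g x) powr q)"
    using f g by (auto simp: Lp_space_def)
  have young: "norm (f x * g x) \<le> norm (f x) powr p / p + norm (g x) powr q / q" for x
    using Youngs_inequality[OF assms(1-3), of "norm (f x)" "norm (g x)"] by (simp add: norm_mult)
  show int: "integrable M (\<lambda>x. f x * g x)"
  proof (rule Bochner_Integration.integrable_bound)
    show "integrable M (\<lambda>x. norm (f x) powr p / p + norm (g x) powr q / q)"
      using fi gi by auto
    show "AE x in M. norm (f x * g x) \<le> norm (norm (f x) powr p / p + norm (g x) powr q / q)"
      using young by (auto intro!: AE_I2 order_trans[OF _ abs_ge_self])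
  qed measurable
  let ?a = "Lp_norm p M f" and ?b = "Lp_norm q M g"
  have eps: "(\<integral>x. norm (f x * g x) \<partial>M) \<le> (?a + e) * (?b + e)" if "e > 0" for e
  proof -
    define s t where "s = ?a + e" and "t = ?b + e"
    have st: "s > 0" "t > 0" using that by (auto simp: s_def t_def add_nonneg_pos)
    have pw: "norm (f x * g x) \<le> s * t * (norm (f x) powr p / s powr p / p + norm (g x) powr q / t powr q / q)" for x
      using Youngs_inequality[OF assms(1-3), of "norm (f x) / s" "norm (g x) / t"] st
      by (simp add: norm_mult powr_divide field_simps)
    have "(\<integral>x. norm (f x * g x) \<partial>M) \<le>
        (\<integral>x. s * t * (norm (f x) powr p / s powr p / p + norm (g x) powr q / t powr q / q) \<partial>M)"
      using int fi gi pw by (intro integral_mono) auto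
    also have "\<dots> = s * t * (?a powr p / s powr p / p + ?b powr q / t powr q / q)"
      using fi gi assms by (simp add: Lp_norm_powr)
    also have "\<dots> \<le> s * t * (1 / p + 1 / q)"
    proof -
      have "?a powr p / s powr p \<le> 1" "?b powr q / t powr q \<le> 1"
        using st that assms by (auto simp: s_def t_def intro!: powr_mono2)
      then show ?thesis using assms st
        by (intro mult_left_mono add_mono divide_right_mono) auto
    qed
    finally show ?thesis using assms by (simp add: s_def t_def)
  qed
  show nrm: "(\<integral>x. norm (f x * g x) \<partial>M) \<le> ?a * ?b"
    by (rule le_limit_at_right_zero[OF _ eps]) (auto intro!: tendsto_eq_intros)
  show "norm (\<integral>x. f x * g x \<partial>M) \<le> ?a * ?b"
    using integral_norm_bound[of M "\<lambda>x. f x * g x"] nrm by linarith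
qed

text \<open>
  Write \<open>f + g\<close> as a convex combination of \<open>f\<close> and \<open>g\<close> scaled by (slightly more than) their norms, and
  use convexity of the \<open>p\<close>-th power.
\<close>

lemma Minkowski_inequality:
  fixes f g :: "'a \<Rightarrow> complex"
  assumes "p \<ge> 1" and f: "f \<in> Lp_space p M" and g: "g \<in> Lp_space p M"
  shows Lp_space_add: "(\<lambda>x. f x + g x) \<in> Lp_space p M"
    and Lp_norm_triangle: "Lp_norm p M (\<lambda>x. f x + g x) \<le> Lp_norm p M f + Lp_norm p M g"
proof -
  have [measurable]: "f \<in> borel_measurable M" "g \<in> borel_measurable M"
    and fi: "integrable M (\<lambda>x. norm (f x) powr p)" and gi: "integrable M (\<lambda>x. norm (g x) powr p)"
    using f g by (auto simp: Lp_space_def)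
  let ?a = "Lp_norm p M f" and ?b = "Lp_norm p M g"
  have pw: "norm (f x + g x) powr p \<le> (s + t) powr p *
      (s / (s + t) * (norm (f x) powr p / s powr p) + t / (s + t) * (norm (g x) powr p / t powr p))"
    if st: "s > 0" "t > 0" for s t x
  proof -
    have "norm (f x + g x) powr p \<le> (norm (f x) + norm (g x)) powr p"
      using assms by (intro powr_mono2) (auto intro: norm_triangle_ineq)
    also have "norm (f x) + norm (g x) = (s + t) * (s / (s + t) * (norm (f x) / s) + t / (s + t) * (norm (g x) / t))"
      using st by (simp add: distrib_left)
    also have "\<dots> powr p = (s + t) powr p * (s / (s + t) * (norm (f x) / s) + t / (s + t) * (norm (g x) / t)) powr p"
      using st by (subst powr_mult) auto
    also have "\<dots> \<le> (s + t) powr p * (s / (s + t) * (norm (f x) / s) powr p + t / (s + t) * (norm (g x) / t) powr p)"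
      using st assms
      by (intro mult_left_mono powr_convex_combination) (auto simp: add_divide_distrib[symmetric])
    finally show ?thesis using st by (simp add: powr_divide)
  qed
  have int: "integrable M (\<lambda>x. norm (f x + g x) powr p)"
  proof (rule Bochner_Integration.integrable_bound)
    let ?w = "\<lambda>x. (1 + 1) powr p * (1 / (1 + 1) * (norm (f x) powr p / 1 powr p) + 1 / (1 + 1) * (norm (g x) powr p / 1 powr p))"
    show "integrable M ?w" using fi gi by auto
    show "AE x in M. norm (norm (f x + g x) powr p) \<le> norm (?w x)"
      using pw[of 1 1] by (auto intro!: AE_I2 order_trans[OF _ abs_ge_self])
  qed measurable
  then show "(\<lambda>x. f x + g x) \<in> Lp_space p M" by (simp add: Lp_space_def)
  have eps: "Lp_norm p M (\<lambda>x. f x + g x) \<le> (?a + e) + (?b + e)" if "e > 0" for e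
  proof -
    define s t where "s = ?a + e" and "t = ?b + e"
    have st: "s > 0" "t > 0" using that by (auto simp: s_def t_def add_nonneg_pos)
    have "(\<integral>x. norm (f x + g x) powr p \<partial>M) \<le> (\<integral>x. (s + t) powr p *
      (s / (s + t) * (norm (f x) powr p / s powr p) + t / (s + t) * (norm (g x) powr p / t powr p)) \<partial>M)"
      using int fi gi pw[OF st] by (intro integral_mono) auto
    also have "\<dots> = (s + t) powr p * (s / (s + t) * (?a powr p / s powr p) + t / (s + t) * (?b powr p / t powr p))"
      using fi gi assms by (simp add: Lp_norm_powr)
    also have "\<dots> \<le> (s + t) powr p * (s / (s + t) * 1 + t / (s + t) * 1)"
    proof -
      have "?a powr p / s powr p \<le> 1" "?b powr p / t powr p \<le> 1"
        using st that assms by (auto simp: s_def t_def intro!: powr_mono2)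
      then show ?thesis using st
        by (intro mult_left_mono add_mono) auto
    qed
    also have "s / (s + t) * 1 + t / (s + t) * 1 = 1" using st by (simp add: add_divide_distrib[symmetric])
    finally show ?thesis using assms st
      by (subst Lp_norm_le_iff) (auto simp: s_def t_def)
  qed
  show "Lp_norm p M (\<lambda>x. f x + g x) \<le> ?a + ?b"
    by (rule le_limit_at_right_zero[OF _ eps]) (auto intro!: tendsto_eq_intros)
qed

lemma Lp_space_diff:
  assumes "p \<ge> 1" "f \<in> Lp_space p M" "g \<in> Lp_space p M"
  shows "(\<lambda>x. f x - g x) \<in> Lp_space p M"
  using Lp_space_add[OF assms(1,2) Lp_space_scale[OF assms(3), of "-1"]] by simp

lemma Lp_norm_triangle_diff:
  assumes "p \<ge> 1" "f \<in> Lp_space p M" "g \<in> Lp_space p M" "h \<in> Lp_space p M"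
  shows "Lp_norm p M (\<lambda>x. f x - h x) \<le> Lp_norm p M (\<lambda>x. f x - g x) + Lp_norm p M (\<lambda>x. g x - h x)"
  using Lp_norm_triangle[OF assms(1) Lp_space_diff[OF assms(1,2,3)] Lp_space_diff[OF assms(1,3,4)]]
  by simp

lemma Lp_space_zero: "(\<lambda>x. 0) \<in> Lp_space p M"
  by (simp add: Lp_space_def)

lemma Lp_space_sum:
  assumes "p \<ge> 1" "\<And>j. j \<in> J \<Longrightarrow> f j \<in> Lp_space p M"
  shows "(\<lambda>x. \<Sum>j\<in>J. f j x) \<in> Lp_space p M"
  using assms(2) by (induction J rule: infinite_finite_induct) (auto simp: Lp_space_zero Lp_space_add[OF assms(1)])

section \<open>Tangent lines and the Minkowski integral inequality\<close>

text \<open>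
  Bernoulli's inequality with its equality case. Taking logarithms reduces it to \<open>ln z > 1 - 1 / z\<close>,
  followed by \<open>1 + t \<le> exp t\<close>.
\<close>

lemma powr_tangent_strict:
  fixes r z :: real
  assumes "r > 1" "z \<ge> 0" "z \<noteq> 1"
  shows "1 + r * (z - 1) < z powr r"
proof (cases "z = 0")
  case True
  then show ?thesis using assms by simp
next
  case False
  then have z: "z > 0" using assms by simp
  have "ln (1 / z) < 1 / z - 1"
    using ln_le_minus_one[of "1 / z"] ln_eq_minus_one[of "1 / z"] z assms(3) by (simp add: less_le) (metis div_by_1 divide_eq_1_iff)
  then have l: "1 - 1 / z < ln z" using z by (simp add: ln_div)
  \<comment> \<open>pulling out a factor \<open>z\<close> leaves an expression to which \<open>1 + t \<le> exp t\<close> applies\<close>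
  have "1 + r * (z - 1) = z * (1 + (r - 1) * (1 - 1 / z))" using z by (simp add: field_simps)
  also have "\<dots> \<le> z * exp ((r - 1) * (1 - 1 / z))" using z by (intro mult_left_mono) auto
  also have "\<dots> < z * exp ((r - 1) * ln z)" using z l assms by simp
  also have "\<dots> = z powr r" using z by (simp add: powr_def left_diff_distrib exp_diff)
  finally show ?thesis .
qed

text \<open>
  The tangent at \<open>c\<close> lies below the graph; for \<open>c = 0\<close> the left-hand side is \<open>0\<close> by the convention
  \<open>0 powr a = 0\<close>. Integrated against a weight, this is the form of Jensen's inequality used below.
\<close>

lemma powr_tangent:
  fixes r c x :: real
  assumes "r \<ge> 1" "x \<ge> 0" "c \<ge> 0"
  shows "c powr r + r * c powr (r - 1) * (x - c) \<le> x powr r"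
proof (cases "c = 0")
  case False
  then have c: "c > 0" using assms by simp
  have "1 + r * (x / c - 1) \<le> (x / c) powr r"
  proof (cases "r = 1 \<or> x / c = 1")
    case True
    then show ?thesis using assms c by auto
  next
    case False
    then show ?thesis using powr_tangent_strict[of r "x / c"] assms c by simp
  qed
  then have "c powr r * (1 + r * (x / c - 1)) \<le> c powr r * (x / c) powr r"
    by (intro mult_left_mono) auto
  moreover have "c powr r * (x / c) powr r = x powr r" using assms c by (simp add: powr_divide)
  moreover have "c powr r * (1 + r * (x / c - 1)) = c powr r + r * c powr (r - 1) * (x - c)"
    using c by (simp add: powr_diff field_simps)
  ultimately show ?thesis by simp
qed (use assms in auto)

lemma ennreal_integral_le_nn_integral:
  fixes f :: "'a \<Rightarrow> real"
  assumes "integrable M f"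
  shows "ennreal (\<integral>x. f x \<partial>M) \<le> (\<integral>\<^sup>+x. ennreal (f x) \<partial>M)"
proof -
  have "(\<integral>x. f x \<partial>M) \<le> (\<integral>x. max 0 (f x) \<partial>M)"
    using assms by (intro integral_mono) auto
  then have "ennreal (\<integral>x. f x \<partial>M) \<le> ennreal (\<integral>x. max 0 (f x) \<partial>M)" by (rule ennreal_leI)
  also have "\<dots> = (\<integral>\<^sup>+x. ennreal (max 0 (f x)) \<partial>M)"
    using assms by (intro nn_integral_eq_integral[symmetric]) auto
  also have "\<dots> = (\<integral>\<^sup>+x. ennreal (f x) \<partial>M)" by (intro nn_integral_cong) (auto simp: max_def ennreal_neg)
  finally show ?thesis .
qed

text \<open>
  The norm of an integral is at most the integral of the norms: \<open>b y\<close> bounds the \<open>L\<^sup>r\<close> norm of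
  \<open>u _ y\<close>. Jensen's inequality for the weight \<open>w = b + e\<close>, of total mass \<open>W\<close>, gives
  \<open>(\<integral> u)\<^sup>r \<le> W\<^sup>r\<^sup>-\<^sup>1 \<integral> u\<^sup>r w\<^sup>1\<^sup>-\<^sup>r\<close> for each \<open>t\<close>; integrating in \<open>t\<close> first replaces \<open>u\<^sup>r\<close> by \<open>w\<^sup>r\<close> and leaves
  \<open>W\<^sup>r\<close>.
\<close>

lemma Minkowski_integral_inequality:
  fixes u :: "'a \<Rightarrow> 'b \<Rightarrow> real" and b :: "'b \<Rightarrow> real"
  assumes "prob_space M" "prob_space N" and r: "r \<ge> 1"
    and u [measurable]: "case_prod u \<in> borel_measurable (M \<Otimes>\<^sub>M N)" and u0: "\<And>t y. u t y \<ge> 0"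
    and b: "integrable N b" and b0: "\<And>y. b y \<ge> 0"
    and ub: "\<And>y. y \<in> space N \<Longrightarrow> (\<integral>\<^sup>+t. ennreal (u t y powr r) \<partial>M) \<le> ennreal (b y powr r)"
  shows "(\<integral>\<^sup>+t. ennreal ((\<integral>y. u t y \<partial>N) powr r) \<partial>M) \<le> ennreal ((\<integral>y. b y \<partial>N) powr r)"
proof -
  interpret M: prob_space M by fact
  interpret N: prob_space N by fact
  interpret pair_sigma_finite M N by unfold_locales
  have [measurable]: "b \<in> borel_measurable N" using b by auto
  have B0: "(\<integral>y. b y \<partial>N) \<ge> 0" using b0 by simp
  have eps: "(\<integral>\<^sup>+t. ennreal ((\<integral>y. u t y \<partial>N) powr r) \<partial>M) \<le> ennreal (((\<integral>y. b y \<partial>N) + e) powr r)"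
    if e: "e > 0" for e
  proof -
    define w where "w y = b y + e" for y
    have w: "w y > 0" for y using b0[of y] e by (simp add: w_def add_nonneg_pos)
    have wi: "integrable N w" unfolding w_def using b by simp
    have [measurable]: "w \<in> borel_measurable N" using wi by auto
    define W where "W = (\<integral>y. w y \<partial>N)"
    have W_eq: "W = (\<integral>y. b y \<partial>N) + e" using b by (simp add: W_def w_def N.prob_space)
    have W: "W > 0" using B0 e by (simp add: W_eq add_nonneg_pos)
    have jensen: "ennreal ((\<integral>y. u t y \<partial>N) powr r) \<le>
        ennreal (W powr (r - 1)) * (\<integral>\<^sup>+y. ennreal (u t y powr r * w y powr (1 - r)) \<partial>N)" for t
    proof (cases "integrable N (u t)")
      case False
      then show ?thesis by (simp add: not_integrable_integral_eq)
    next
      case True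
      define U c where "U = (\<integral>y. u t y \<partial>N)" and "c = U / W"
      have U0: "U \<ge> 0" unfolding U_def using u0 by simp
      then have c0: "c \<ge> 0" using W by (simp add: c_def)
      \<comment> \<open>integrate the tangent line at the mean \<open>c\<close> of \<open>u / w\<close> against the weight \<open>w\<close>\<close>
      have pw: "c powr r * w y + r * c powr (r - 1) * (u t y - c * w y) \<le> u t y powr r * w y powr (1 - r)" for y
      proof -
        have "c powr r + r * c powr (r - 1) * (u t y / w y - c) \<le> (u t y / w y) powr r"
          using u0[of t y] w[of y] by (intro powr_tangent r c0) (simp add: less_imp_le)
        then have "w y * (c powr r + r * c powr (r - 1) * (u t y / w y - c)) \<le> w y * (u t y / w y) powr r"
          using w[of y] by (intro mult_left_mono) (auto simp: less_imp_le)
        moreover have "w y * (u t y / w y) powr r = u t y powr r * w y powr (1 - r)"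
          using w[of y] u0[of t y] by (simp add: powr_divide powr_diff)
        moreover have "w y * (c powr r + r * c powr (r - 1) * (u t y / w y - c)) =
            c powr r * w y + r * c powr (r - 1) * (u t y - c * w y)"
          using w[of y] by (simp add: field_simps)
        ultimately show ?thesis by simp
      qed
      have int: "integrable N (\<lambda>y. c powr r * w y + r * c powr (r - 1) * (u t y - c * w y))"
        using True wi by auto
      have "(\<integral>y. c powr r * w y + r * c powr (r - 1) * (u t y - c * w y) \<partial>N) = c powr r * W + r * c powr (r - 1) * (U - c * W)"
        using True wi by (simp add: U_def W_def)
      also have "\<dots> = c powr r * W" using W by (simp add: c_def)
      finally have cW: "ennreal (c powr r * W) \<le> (\<integral>\<^sup>+y. ennreal (u t y powr r * w y powr (1 - r)) \<partial>N)"
        using order_trans[OF ennreal_integral_le_nn_integral[OF int] nn_integral_mono[OF ennreal_leI[OF pw]]]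
        by simp
      have "U powr r = W powr (r - 1) * (c powr r * W)"
        using W U0 by (simp add: c_def powr_divide powr_diff)
      then have "ennreal (U powr r) = ennreal (W powr (r - 1)) * ennreal (c powr r * W)"
        by (simp add: ennreal_mult')
      also have "\<dots> \<le> ennreal (W powr (r - 1)) * (\<integral>\<^sup>+y. ennreal (u t y powr r * w y powr (1 - r)) \<partial>N)"
        using cW by (rule mult_left_mono) simp
      finally show ?thesis by (simp add: U_def)
    qed
    have "(\<integral>\<^sup>+t. ennreal ((\<integral>y. u t y \<partial>N) powr r) \<partial>M) \<le>
        (\<integral>\<^sup>+t. ennreal (W powr (r - 1)) * (\<integral>\<^sup>+y. ennreal (u t y powr r * w y powr (1 - r)) \<partial>N) \<partial>M)"
      using jensen by (intro nn_integral_mono)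
    also have "\<dots> = ennreal (W powr (r - 1)) * (\<integral>\<^sup>+t. (\<integral>\<^sup>+y. ennreal (u t y powr r * w y powr (1 - r)) \<partial>N) \<partial>M)"
      by (rule nn_integral_cmult) measurable
    also have "(\<integral>\<^sup>+t. (\<integral>\<^sup>+y. ennreal (u t y powr r * w y powr (1 - r)) \<partial>N) \<partial>M) =
        (\<integral>\<^sup>+y. (\<integral>\<^sup>+t. ennreal (u t y powr r * w y powr (1 - r)) \<partial>M) \<partial>N)"
      by (rule Fubini'[symmetric]) measurable
    also have "\<dots> \<le> (\<integral>\<^sup>+y. ennreal (w y) \<partial>N)"
    proof (rule nn_integral_mono)
      fix y assume y: "y \<in> space N"
      have "(\<integral>\<^sup>+t. ennreal (u t y powr r * w y powr (1 - r)) \<partial>M) =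
          (\<integral>\<^sup>+t. ennreal (u t y powr r) * ennreal (w y powr (1 - r)) \<partial>M)"
        by (simp add: ennreal_mult')
      also have "\<dots> = (\<integral>\<^sup>+t. ennreal (u t y powr r) \<partial>M) * ennreal (w y powr (1 - r))"
        using y by (intro nn_integral_multc) measurable
      also have "\<dots> \<le> ennreal (b y powr r) * ennreal (w y powr (1 - r))" using ub[OF y] by (rule mult_right_mono) simp
      also have "\<dots> \<le> ennreal (w y powr r) * ennreal (w y powr (1 - r))"
        using b0[of y] e r by (intro mult_right_mono ennreal_leI powr_mono2) (auto simp: w_def)
      also have "\<dots> = ennreal (w y)" using w[of y] by (simp add: ennreal_mult'[symmetric] powr_add[symmetric])
      finally show "(\<integral>\<^sup>+t. ennreal (u t y powr r * w y powr (1 - r)) \<partial>M) \<le> ennreal (w y)" .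
    qed
    also have "(\<integral>\<^sup>+y. ennreal (w y) \<partial>N) = ennreal W"
      unfolding W_def using wi w by (intro nn_integral_eq_integral) (auto simp: less_imp_le)
    also have "ennreal (W powr (r - 1)) * ennreal W = ennreal (W powr r)"
      using W by (simp add: ennreal_mult'[symmetric] powr_diff)
    finally show ?thesis by (simp add: W_eq mult_left_mono)
  qed
  let ?L = "\<integral>\<^sup>+t. ennreal ((\<integral>y. u t y \<partial>N) powr r) \<partial>M"
  have "?L < top" using eps[of 1] by (simp add: le_less_trans)
  then obtain l where l: "?L = ennreal l" "l \<ge> 0" by (metis ennreal_enn2real enn2real_nonneg)
  have le: "l \<le> ((\<integral>y. b y \<partial>N) + e) powr r" if "e > 0" for e
    using eps[OF that] by (simp add: l)
  have "((\<lambda>e. ((\<integral>y. b y \<partial>N) + e) powr r) \<longlongrightarrow> ((\<integral>y. b y \<partial>N) + 0) powr r) (at_right 0)"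
    using B0 r by (intro tendsto_powr' tendsto_intros) (auto simp: eventually_at_filter)
  then have "l \<le> ((\<integral>y. b y \<partial>N) + 0) powr r" using le by (rule le_limit_at_right_zero)
  then show ?thesis by (simp add: l ennreal_leI)
qed

section \<open>Limits in Lebesgue spaces\<close>

text \<open>
  Fatou's lemma for \<open>L\<^sup>q\<close> norms.
\<close>

lemma Lp_norm_le_of_AE_limit:
  fixes v :: "nat \<Rightarrow> 'a \<Rightarrow> complex"
  assumes q: "q > 0" and v: "\<And>n. v n \<in> Lp_space q M" and w [measurable]: "w \<in> borel_measurable M"
    and lim: "AE x in M. (\<lambda>n. v n x) \<longlonglongrightarrow> w x"
    and bd: "\<forall>\<^sub>F n in sequentially. Lp_norm q M (v n) \<le> a"
  shows "w \<in> Lp_space q M" and "Lp_norm q M w \<le> a"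
proof -
  have [measurable]: "v n \<in> borel_measurable M" for n using v[of n] by auto
  obtain n where "Lp_norm q M (v n) \<le> a" using eventually_happens[OF bd] by auto
  then have a: "a \<ge> 0" using Lp_norm_nonneg[of q M "v n"] by linarith
  have "(\<integral>\<^sup>+x. ennreal (norm (w x) powr q) \<partial>M) = (\<integral>\<^sup>+x. liminf (\<lambda>n. ennreal (norm (v n x) powr q)) \<partial>M)"
  proof (rule nn_integral_cong_AE, rule AE_mp[OF lim], intro AE_I2 impI)
    fix x assume "(\<lambda>n. v n x) \<longlonglongrightarrow> w x"
    then have "(\<lambda>n. ennreal (norm (v n x) powr q)) \<longlonglongrightarrow> ennreal (norm (w x) powr q)"
      using q by (intro tendsto_ennrealI tendsto_powr' tendsto_norm tendsto_const) auto
    then show "ennreal (norm (w x) powr q) = liminf (\<lambda>n. ennreal (norm (v n x) powr q))"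
      by (intro lim_imp_Liminf[symmetric]) auto
  qed
  also have "\<dots> \<le> liminf (\<lambda>n. \<integral>\<^sup>+x. ennreal (norm (v n x) powr q) \<partial>M)"
    by (rule nn_integral_liminf) measurable
  also have "\<dots> \<le> liminf (\<lambda>n. ennreal (a powr q))"
  proof (rule Liminf_mono, rule eventually_mono[OF bd])
    fix n assume "Lp_norm q M (v n) \<le> a"
    then have "(\<integral>x. norm (v n x) powr q \<partial>M) \<le> a powr q" using q a by (subst (asm) Lp_norm_le_iff) auto
    then show "(\<integral>\<^sup>+x. ennreal (norm (v n x) powr q) \<partial>M) \<le> ennreal (a powr q)"
      using v[of n] by (subst nn_integral_eq_integral) (auto simp: Lp_space_def intro: ennreal_leI)
  qed
  also have "\<dots> = ennreal (a powr q)" by (rule Liminf_const) simp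
  finally have nn: "(\<integral>\<^sup>+x. ennreal (norm (w x) powr q) \<partial>M) \<le> ennreal (a powr q)" .
  then have int: "integrable M (\<lambda>x. norm (w x) powr q)"
    by (intro integrableI_bounded) (auto simp: le_less_trans)
  then show "w \<in> Lp_space q M" by (simp add: Lp_space_def)
  have "ennreal (\<integral>x. norm (w x) powr q \<partial>M) \<le> ennreal (a powr q)"
    using nn int by (subst (asm) nn_integral_eq_integral) auto
  then have "(\<integral>x. norm (w x) powr q \<partial>M) \<le> a powr q" by (subst (asm) ennreal_le_iff) auto
  then show "Lp_norm q M w \<le> a" using q a by (subst Lp_norm_le_iff) auto
qed

text \<open>
  Jensen's inequality, from the tangent line at the (slightly enlarged) norm. It turns smallness in
  \<open>L\<^sup>q\<close> into smallness in \<open>L\<^sup>1\<close>, where series of norms can be summed under the integral.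
\<close>

lemma (in prob_space) integral_norm_le_Lp_norm:
  fixes f :: "'a \<Rightarrow> complex"
  assumes q: "q \<ge> 1" and f: "f \<in> Lp_space q M"
  shows "integrable M (\<lambda>x. norm (f x))" and "(\<integral>x. norm (f x) \<partial>M) \<le> Lp_norm q M f"
proof -
  have [measurable]: "f \<in> borel_measurable M" and fq: "integrable M (\<lambda>x. norm (f x) powr q)"
    using f by (auto simp: Lp_space_def)
  show f1: "integrable M (\<lambda>x. norm (f x))"
  proof (rule Bochner_Integration.integrable_bound)
    show "integrable M (\<lambda>x. 1 + norm (f x) powr q)" using fq by simp
    have "norm (f x) \<le> 1 + norm (f x) powr q" for x
    proof (cases "norm (f x) \<le> 1")
      case False
      then have "norm (f x) powr 1 \<le> norm (f x) powr q" using q by (intro powr_mono) auto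
      then show ?thesis by simp
    qed (simp add: add_increasing2)
    then show "AE x in M. norm (norm (f x)) \<le> norm (1 + norm (f x) powr q)" by (intro AE_I2) simp
  qed measurable
  have eps: "(\<integral>x. norm (f x) \<partial>M) \<le> Lp_norm q M f + e" if "e > 0" for e
  proof -
    define c where "c = Lp_norm q M f + e"
    have c: "c > 0" using that by (simp add: c_def add_nonneg_pos)
    have "(\<integral>x. c powr q + q * c powr (q - 1) * (norm (f x) - c) \<partial>M) \<le> (\<integral>x. norm (f x) powr q \<partial>M)"
      using f1 fq c q by (intro integral_mono powr_tangent) auto
    also have "\<dots> = Lp_norm q M f powr q" using q by (simp add: Lp_norm_powr)
    also have "\<dots> \<le> c powr q" using q that by (intro powr_mono2) (auto simp: c_def)
    finally have "q * c powr (q - 1) * ((\<integral>x. norm (f x) \<partial>M) - c) \<le> 0"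
      using f1 by (simp add: prob_space)
    then show ?thesis using q c by (simp add: c_def mult_le_0_iff)
  qed
  show "(\<integral>x. norm (f x) \<partial>M) \<le> Lp_norm q M f"
    by (rule le_limit_at_right_zero[OF _ eps]) (auto intro!: tendsto_eq_intros)
qed

text \<open>
  The first half of the Riesz-Fischer theorem: absolutely convergent telescoping sums in \<open>L\<^sup>1\<close> converge
  almost everywhere. Fatou's lemma supplies the other half where it is needed.
\<close>

lemma (in prob_space) AE_convergent_of_Lp_norm_summable:
  fixes v :: "nat \<Rightarrow> 'a \<Rightarrow> complex"
  assumes q: "q \<ge> 1" and v: "\<And>n. v n \<in> Lp_space q M"
    and small: "\<And>n. Lp_norm q M (\<lambda>x. v (Suc n) x - v n x) \<le> d n" and d: "summable d"
  shows "AE x in M. (\<lambda>n. v n x) \<longlonglongrightarrow> lim (\<lambda>n. v n x)"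
proof -
  have [measurable]: "v n \<in> borel_measurable M" for n using v[of n] by auto
  note diff = Lp_space_diff[OF q v v]
  have d0: "d n \<ge> 0" for n using order_trans[OF Lp_norm_nonneg small] .
  have "(\<integral>\<^sup>+x. suminf (\<lambda>n. ennreal (norm (v (Suc n) x - v n x))) \<partial>M) =
      suminf (\<lambda>n. \<integral>\<^sup>+x. ennreal (norm (v (Suc n) x - v n x)) \<partial>M)"
    by (rule nn_integral_suminf) measurable
  also have "\<dots> \<le> suminf (\<lambda>n. ennreal (d n))"
  proof (intro suminf_le summableI)
    fix n
    have "(\<integral>\<^sup>+x. ennreal (norm (v (Suc n) x - v n x)) \<partial>M) = ennreal (\<integral>x. norm (v (Suc n) x - v n x) \<partial>M)"
      using integral_norm_le_Lp_norm(1)[OF q diff] by (intro nn_integral_eq_integral) auto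
    also have "\<dots> \<le> ennreal (d n)"
      using integral_norm_le_Lp_norm(2)[OF q diff] small[of n] by (intro ennreal_leI) (rule order_trans)
    finally show "(\<integral>\<^sup>+x. ennreal (norm (v (Suc n) x - v n x)) \<partial>M) \<le> ennreal (d n)" .
  qed
  also have "\<dots> = ennreal (suminf d)" using d0 d by (intro suminf_ennreal2) auto
  finally have "(\<integral>\<^sup>+x. suminf (\<lambda>n. ennreal (norm (v (Suc n) x - v n x))) \<partial>M) \<noteq> \<infinity>"
    by (auto simp: top_unique)
  then have "AE x in M. suminf (\<lambda>n. ennreal (norm (v (Suc n) x - v n x))) \<noteq> \<infinity>"
    by (intro nn_integral_PInf_AE) measurable
  then show ?thesis
  proof (rule AE_mp, intro AE_I2 impI)
    fix x assume "suminf (\<lambda>n. ennreal (norm (v (Suc n) x - v n x))) \<noteq> \<infinity>"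
    then have "summable (\<lambda>n. norm (v (Suc n) x - v n x))"
      by (intro summable_suminf_not_top) auto
    then have "summable (\<lambda>n. v (Suc n) x - v n x)" by (rule summable_norm_cancel)
    then have "convergent (\<lambda>n. \<Sum>i<n. v (Suc i) x - v i x)" by (simp add: summable_iff_convergent)
    then have "convergent (\<lambda>n. (v n x - v 0 x) + v 0 x)"
      unfolding sum_lessThan_telescope[of "\<lambda>i. v i x"] by (rule convergent_add[OF _ convergent_const])
    then show "(\<lambda>n. v n x) \<longlonglongrightarrow> lim (\<lambda>n. v n x)" by (simp add: convergent_LIMSEQ_iff)
  qed
qed

lemma AE_eq_of_Lp_norm_diff_small:
  fixes v w :: "'a \<Rightarrow> complex"
  assumes q: "q \<ge> 1" and v: "v \<in> Lp_space q M" and w: "w \<in> Lp_space q M"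
    and small: "\<And>e. e > 0 \<Longrightarrow> Lp_norm q M (\<lambda>x. v x - w x) \<le> D * e"
  shows "AE x in M. v x = w x"
proof -
  have "Lp_norm q M (\<lambda>x. v x - w x) \<le> 0"
    by (rule le_limit_at_right_zero[OF _ small]) (auto intro!: tendsto_eq_intros)
  then have "Lp_norm q M (\<lambda>x. v x - w x) = 0" using Lp_norm_nonneg[of q M "\<lambda>x. v x - w x"] by linarith
  then have "AE x in M. v x - w x = 0" using q by (intro Lp_norm_eq_0_AE[OF _ Lp_space_diff[OF q v w]]) auto
  then show ?thesis by simp
qed

text \<open>
  The equality case of Hoelder's inequality against the constant \<open>1\<close>. Strictness of the tangent line
  inequality forces \<open>\<bar>f\<bar> = 1\<close>, and a function of modulus one whose mean is \<open>1\<close> has real part \<open>1\<close>.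
\<close>

lemma (in prob_space) AE_eq_1_of_Lp_norm_le_1:
  fixes f :: "'a \<Rightarrow> complex"
  assumes q: "q > 1" and f: "f \<in> Lp_space q M" and mean: "(\<integral>x. f x \<partial>M) = 1" and norm: "Lp_norm q M f \<le> 1"
  shows "AE x in M. f x = 1"
proof -
  have [measurable]: "f \<in> borel_measurable M" and fq: "integrable M (\<lambda>x. norm (f x) powr q)"
    using f by (auto simp: Lp_space_def)
  have tang: "1 + q * (norm (f x) - 1) \<le> norm (f x) powr q" for x
    using powr_tangent[of q "norm (f x)" 1] q by simp
  have n1: "integrable M (\<lambda>x. norm (f x))" by (rule integral_norm_le_Lp_norm(1)[OF _ f]) (use q in simp)
  then have f1: "integrable M f" by (simp add: integrable_norm_iff)
  have mean_norm: "1 \<le> (\<integral>x. norm (f x) \<partial>M)" using integral_norm_bound[of M f] mean by simp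
  have le1: "(\<integral>x. norm (f x) powr q \<partial>M) \<le> 1" using norm q by (subst (asm) Lp_norm_le_iff) auto
  \<comment> \<open>nonnegative, with nonpositive integral\<close>
  let ?d = "\<lambda>x. norm (f x) powr q - (1 + q * (norm (f x) - 1))"
  have "(\<integral>x. ?d x \<partial>M) = (\<integral>x. norm (f x) powr q \<partial>M) - (1 + q * ((\<integral>x. norm (f x) \<partial>M) - 1))"
    using fq n1 by (simp add: prob_space)
  also have "\<dots> \<le> 0" using le1 mean_norm q by (smt (verit) mult_nonneg_nonneg)
  finally have "(\<integral>x. ?d x \<partial>M) = 0" using tang by (intro antisym integral_nonneg_AE) auto
  then have "AE x in M. ?d x = 0"
    using fq n1 tang by (subst (asm) integral_nonneg_eq_0_iff_AE) auto
  then have abs1: "AE x in M. norm (f x) = 1"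
  proof (rule AE_mp, intro AE_I2 impI)
    fix x assume "?d x = 0"
    then show "norm (f x) = 1" using powr_tangent_strict[OF q, of "norm (f x)"] by force
  qed
  then have "(\<integral>x. norm (f x) \<partial>M) = (\<integral>x. 1 \<partial>M)" by (intro integral_cong_AE) auto
  moreover have "(\<integral>x. Re (f x) \<partial>M) = 1" using mean f1 by simp
  ultimately have "(\<integral>x. norm (f x) - Re (f x) \<partial>M) = 0" using f1 n1 by (simp add: prob_space)
  then have "AE x in M. norm (f x) - Re (f x) = 0"
    using f1 n1 by (subst (asm) integral_nonneg_eq_0_iff_AE) (auto simp: complex_Re_le_cmod)
  with abs1 show ?thesis
  proof (rule AE_mp[OF AE_conjI], intro AE_I2 impI)
    fix x assume *: "norm (f x) = 1 \<and> norm (f x) - Re (f x) = 0"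
    then have "Re (f x) = 1" by simp
    moreover from this * have "Im (f x) = 0" by (auto simp: cmod_def)
    ultimately show "f x = 1" by (simp add: complex_eq_iff)
  qed
qed

section \<open>Functions of polynomial growth\<close>

lemma
  assumes "standardized M"
  shows standardized_real_distribution: "real_distribution M"
    and standardized_integrable_power: "integrable M (\<lambda>x. x ^ k)"
    and standardized_mean: "(\<integral>x. x \<partial>M) = 0"
    and standardized_second_moment: "(\<integral>x. x\<^sup>2 \<partial>M) = 1"
proof -
  note * = assms[unfolded standardized_def]
  show "real_distribution M" "integrable M (\<lambda>x. x ^ k)" "(\<integral>x. x \<partial>M) = 0" using * by auto
  then show "(\<integral>x. x\<^sup>2 \<partial>M) = 1" using * by (elim conjE) simp
qed

text \<open>
  Growth is measured against powers of \<open>1 + \<bar>x\<bar>\<close> because this family is totally ordered and closed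
  under products and real powers, up to rounding the exponent.
\<close>

definition poly_growth :: "(real \<Rightarrow> 'a :: real_normed_vector) \<Rightarrow> bool" where
  "poly_growth g \<longleftrightarrow> (\<exists>A m. \<forall>x. norm (g x) \<le> A * (1 + \<bar>x\<bar>) ^ m)"

lemma poly_growthI: "(\<And>x. norm (g x) \<le> A * (1 + \<bar>x\<bar>) ^ m) \<Longrightarrow> poly_growth g"
  by (auto simp: poly_growth_def)

lemma poly_growthE:
  assumes "poly_growth g"
  obtains A m where "A \<ge> 0" "\<And>x. norm (g x) \<le> A * (1 + \<bar>x\<bar>) ^ m"
proof -
  obtain A m where A: "\<And>x. norm (g x) \<le> A * (1 + \<bar>x\<bar>) ^ m"
    using assms by (auto simp: poly_growth_def)
  have "A \<ge> 0" using order_trans[OF norm_ge_zero A[of 0]] by simp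
  then show thesis using A that by blast
qed

lemma poly_growth_const [simp]: "poly_growth (\<lambda>x. c)"
  by (rule poly_growthI[of _ "norm c" 0]) simp

lemma poly_growth_add:
  assumes "poly_growth f" "poly_growth g"
  shows "poly_growth (\<lambda>x. f x + g x)"
proof -
  obtain A m where A: "A \<ge> 0" "\<And>x. norm (f x) \<le> A * (1 + \<bar>x\<bar>) ^ m"
    using assms(1) by (elim poly_growthE) blast
  obtain B n where B: "B \<ge> 0" "\<And>x. norm (g x) \<le> B * (1 + \<bar>x\<bar>) ^ n"
    using assms(2) by (elim poly_growthE) blast
  show ?thesis
  proof (rule poly_growthI)
    fix x :: real
    have "norm (f x + g x) \<le> norm (f x) + norm (g x)" by (rule norm_triangle_ineq)
    also have "\<dots> \<le> A * (1 + \<bar>x\<bar>) ^ m + B * (1 + \<bar>x\<bar>) ^ n" using A(2)[of x] B(2)[of x] by simp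
    also have "\<dots> \<le> A * (1 + \<bar>x\<bar>) ^ max m n + B * (1 + \<bar>x\<bar>) ^ max m n"
      using A(1) B(1) by (intro add_mono mult_left_mono power_increasing) auto
    finally show "norm (f x + g x) \<le> (A + B) * (1 + \<bar>x\<bar>) ^ max m n" by (simp add: distrib_right)
  qed
qed

lemma poly_growth_mult:
  fixes f g :: "real \<Rightarrow> 'a :: real_normed_algebra"
  assumes "poly_growth f" "poly_growth g"
  shows "poly_growth (\<lambda>x. f x * g x)"
proof -
  obtain A m where A: "A \<ge> 0" "\<And>x. norm (f x) \<le> A * (1 + \<bar>x\<bar>) ^ m"
    using assms(1) by (elim poly_growthE) blast
  obtain B n where B: "B \<ge> 0" "\<And>x. norm (g x) \<le> B * (1 + \<bar>x\<bar>) ^ n"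
    using assms(2) by (elim poly_growthE) blast
  show ?thesis
  proof (rule poly_growthI)
    fix x :: real
    have "norm (f x * g x) \<le> norm (f x) * norm (g x)" by (rule norm_mult_ineq)
    also have "\<dots> \<le> (A * (1 + \<bar>x\<bar>) ^ m) * (B * (1 + \<bar>x\<bar>) ^ n)"
      using A B by (intro mult_mono) auto
    finally show "norm (f x * g x) \<le> (A * B) * (1 + \<bar>x\<bar>) ^ (m + n)" by (simp add: power_add mult_ac)
  qed
qed

lemma poly_growth_mono:
  assumes "poly_growth f" "\<And>x. norm (g x) \<le> norm (f x)"
  shows "poly_growth g"
proof -
  obtain A m where "A \<ge> 0" "\<And>x. norm (f x) \<le> A * (1 + \<bar>x\<bar>) ^ m"
    using assms(1) by (elim poly_growthE) blast
  then show ?thesis using assms(2) by (intro poly_growthI[of _ A m]) (meson order_trans)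
qed

lemma poly_growth_diff:
  assumes "poly_growth f" "poly_growth g"
  shows "poly_growth (\<lambda>x. f x - g x)"
proof -
  have "poly_growth (\<lambda>x. - g x)" using assms(2) by (rule poly_growth_mono) simp
  from poly_growth_add[OF assms(1) this] show ?thesis by simp
qed

lemma poly_growth_powr:
  fixes p :: real
  assumes "poly_growth f" "p \<ge> 0"
  shows "poly_growth (\<lambda>x. norm (f x) powr p)"
proof -
  obtain A m where A: "A \<ge> 0" "\<And>x. norm (f x) \<le> A * (1 + \<bar>x\<bar>) ^ m"
    using assms(1) by (elim poly_growthE) blast
  show ?thesis
  proof (rule poly_growthI)
    fix x :: real
    have "norm (f x) powr p \<le> (A * (1 + \<bar>x\<bar>) ^ m) powr p" using A assms by (intro powr_mono2) auto
    also have "\<dots> = A powr p * (1 + \<bar>x\<bar>) powr (m * p)"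
      using A by (simp add: powr_mult powr_powr flip: powr_realpow)
    also have "\<dots> \<le> A powr p * (1 + \<bar>x\<bar>) powr (nat \<lceil>m * p\<rceil>)"
      by (intro mult_left_mono powr_mono) (auto simp: real_nat_ceiling_ge)
    also have "\<dots> = A powr p * (1 + \<bar>x\<bar>) ^ nat \<lceil>m * p\<rceil>" by (subst powr_realpow) auto
    finally show "norm (norm (f x) powr p) \<le> A powr p * (1 + \<bar>x\<bar>) ^ nat \<lceil>m * p\<rceil>" by simp
  qed
qed

lemma poly_growth_of_powr_bound:
  fixes g :: "real \<Rightarrow> 'a :: real_normed_vector"
  assumes "A > 0" "\<And>x. norm (g x) \<le> A * (1 + \<bar>x\<bar> powr A)"
  shows "poly_growth g"
proof -
  have "poly_growth (\<lambda>x :: real. x)" by (rule poly_growthI[of _ 1 1]) simp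
  from poly_growth_powr[OF this, of A] have "poly_growth (\<lambda>x :: real. A * (1 + \<bar>x\<bar> powr A))"
    using assms by (intro poly_growth_mult poly_growth_add) auto
  then show ?thesis
    by (rule poly_growth_mono) (use assms in \<open>auto intro: order_trans[OF _ abs_ge_self]\<close>)
qed

lemma poly_growth_poly_fun: "poly_growth (poly_fun f)"
proof (induction f)
  case (pCons a f)
  have "poly_growth (\<lambda>x. complex_of_real x)" by (rule poly_growthI[of _ 1 1]) simp
  with pCons show ?case by (simp add: poly_growth_add poly_growth_mult)
qed simp

lemma continuous_poly_fun: "continuous_on UNIV (poly_fun f)"
  by (intro continuous_intros)

lemma continuous_measurable_borel:
  fixes g :: "real \<Rightarrow> 'a :: topological_space"
  assumes "sets M = sets borel" "continuous_on UNIV g"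
  shows "g \<in> borel_measurable M"
  using borel_measurable_continuous_onI[OF assms(2)] assms(1) measurable_cong_sets by blast

lemma continuous_on_norm_powr:
  fixes p :: real
  assumes "continuous_on S f" "p > 0"
  shows "continuous_on S (\<lambda>x. norm (f x) powr p)"
  using assms by (intro continuous_on_powr' continuous_on_norm continuous_on_const) auto

lemma one_plus_abs_power_le: "(1 + \<bar>x\<bar>) ^ (2 * m) \<le> 4 ^ m * (1 + x ^ (2 * m))" for x :: real
proof -
  have "(1 + \<bar>x\<bar>) ^ (2 * m) \<le> (2 * max 1 \<bar>x\<bar>) ^ (2 * m)" by (intro power_mono) auto
  also have "\<dots> = 4 ^ m * max 1 \<bar>x\<bar> ^ (2 * m)" by (simp add: power_mult_distrib power_mult)
  also have "max 1 \<bar>x\<bar> ^ (2 * m) \<le> 1 + x ^ (2 * m)"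
    by (cases "\<bar>x\<bar> \<le> 1") (auto simp: max_def power_even_abs)
  finally show ?thesis by simp
qed

lemma (in real_distribution) integrable_poly_growth:
  fixes g :: "real \<Rightarrow> 'a :: {banach, second_countable_topology}"
  assumes mom: "\<And>k. integrable M (\<lambda>x. x ^ k)"
    and g: "continuous_on UNIV g" "poly_growth g"
  shows "integrable M g"
proof -
  obtain A m where A: "A \<ge> 0" "\<And>x. norm (g x) \<le> A * (1 + \<bar>x\<bar>) ^ m"
    using g(2) by (elim poly_growthE) blast
  have "norm (g x) \<le> A * (4 ^ m * (1 + x ^ (2 * m)))" for x
  proof -
    have "norm (g x) \<le> A * (1 + \<bar>x\<bar>) ^ m" by (rule A)
    also have "\<dots> \<le> A * (1 + \<bar>x\<bar>) ^ (2 * m)" using A(1) by (intro mult_left_mono power_increasing) auto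
    also have "\<dots> \<le> A * (4 ^ m * (1 + x ^ (2 * m)))"
      using A(1) one_plus_abs_power_le by (intro mult_left_mono)
    finally show ?thesis .
  qed
  then have le: "AE x in M. norm (g x) \<le> norm (A * (4 ^ m * (1 + x ^ (2 * m))))"
    by (intro AE_I2) (metis abs_ge_self order_trans real_norm_def)
  have "integrable M (\<lambda>x. A * (4 ^ m * (1 + x ^ (2 * m))))"
    by (rule integrable_mult_right, rule integrable_mult_right, rule Bochner_Integration.integrable_add[OF integrable_const mom])
  then show ?thesis
    by (rule Bochner_Integration.integrable_bound[OF _ continuous_measurable_borel[OF events_eq_borel g(1)] le])
qed

lemmas integrable_poly_growth_gauss =
  real_distribution.integrable_poly_growth[OF real_dist_normal_dist integrable_std_normal_distribution_moment]

lemmas integrable_poly_growth_standardized =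
  real_distribution.integrable_poly_growth[OF standardized_real_distribution standardized_integrable_power]

lemma poly_growth_Lp_gauss:
  assumes "continuous_on UNIV g" "poly_growth g" "r > 0"
  shows "g \<in> Lp_space r gauss"
  unfolding Lp_space_def using assms
  by (auto intro!: integrable_poly_growth_gauss continuous_on_norm_powr poly_growth_powr
      continuous_measurable_borel[OF refl assms(1)])

lemma poly_fun_Lp_gauss: "p > 0 \<Longrightarrow> poly_fun f \<in> Lp_space p gauss"
  by (intro poly_growth_Lp_gauss continuous_poly_fun poly_growth_poly_fun)

section \<open>The central limit theorem for functions of polynomial growth\<close>

text \<open>
  The \<open>k\<close>-th moment \<open>a k n\<close> of the sum of \<open>n\<close> terms grows at most like \<open>n\<^sup>k\<^sup>/\<^sup>2\<close>. Expanding the \<open>k\<close>-th power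
  of the sum with one more term, the increment \<open>a k (n + 1) - a k n\<close> contains no contribution linear in
  the new term, as that has mean zero; so it involves only moments of order at most \<open>k - 2\<close>, and summing
  \<open>n\<close> increments costs one factor \<open>n\<close>.
\<close>

lemma (in prob_space) moments_of_iid_sum:
  fixes X :: "nat \<Rightarrow> 'a \<Rightarrow> real"
  assumes indep: "indep_vars (\<lambda>_. borel) X UNIV"
    and int: "\<And>n k. integrable M (\<lambda>\<omega>. X n \<omega> ^ k)"
    and mom: "\<And>n k. expectation (\<lambda>\<omega>. X n \<omega> ^ k) = \<mu> k" and mean: "\<mu> 1 = 0"
  shows "integrable M (\<lambda>\<omega>. (\<Sum>i<n. X i \<omega>) ^ k)"
    and "\<exists>C. \<forall>n. \<bar>expectation (\<lambda>\<omega>. (\<Sum>i<n. X i \<omega>) ^ k)\<bar> \<le> C * sqrt n ^ k"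
proof -
  define S where "S n \<omega> = (\<Sum>i<n. X i \<omega>)" for n \<omega>
  have S_Suc: "S (Suc n) \<omega> = X n \<omega> + S n \<omega>" for n \<omega> by (simp add: S_def)
  have ind: "indep_var borel (\<lambda>\<omega>. X n \<omega> ^ j) borel (\<lambda>\<omega>. S n \<omega> ^ l)" for n j l
  proof -
    have "indep_vars (\<lambda>_. borel) X (insert n {..<n})" using indep by (rule indep_vars_subset) auto
    from indep_vars_sum[OF _ _ this] have "indep_var borel (X n) borel (S n)"
      by (simp add: S_def[abs_def])
    from indep_var_compose[OF this, of "\<lambda>x. x ^ j" borel "\<lambda>x. x ^ l" borel]
    show ?thesis by (simp add: comp_def)
  qed
  have intS: "integrable M (\<lambda>\<omega>. S n \<omega> ^ k)" for n k
  proof (induction n arbitrary: k)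
    case (Suc n)
    have "integrable M (\<lambda>\<omega>. X n \<omega> ^ j * S n \<omega> ^ l)" for j l
      by (rule indep_var_integrable[OF ind int Suc])
    then show ?case by (simp add: S_Suc binomial_ring mult.assoc)
  qed (simp add: S_def)
  then show "integrable M (\<lambda>\<omega>. (\<Sum>i<n. X i \<omega>) ^ k)" by (simp add: S_def)
  define a where "a k n = expectation (\<lambda>\<omega>. S n \<omega> ^ k)" for k n
  have rec: "a k (Suc n) = (\<Sum>j\<le>k. (k choose j) * (\<mu> j * a (k - j) n))" for k n
  proof -
    have "integrable M (\<lambda>\<omega>. X n \<omega> ^ j * S n \<omega> ^ l)" for j l
      by (rule indep_var_integrable[OF ind int intS])
    moreover have "expectation (\<lambda>\<omega>. X n \<omega> ^ j * S n \<omega> ^ l) = \<mu> j * a l n" for j l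
      unfolding a_def mom[of n j, symmetric] by (rule indep_var_lebesgue_integral[OF ind int intS])
    ultimately show ?thesis
      by (simp add: a_def[of k] S_Suc binomial_ring mult.assoc)
  qed
  have \<mu>0: "\<mu> 0 = 1" using mom[of 0 0] by (simp add: prob_space)
  have diff: "a k (Suc n) - a k n = (\<Sum>j\<in>{2..k}. (k choose j) * (\<mu> j * a (k - j) n))" if "k \<ge> 1" for k n
  proof -
    have "{..k} = {0, 1} \<union> {2..k}" using that by auto
    then have "a k (Suc n) = (\<Sum>j\<in>{0,1} \<union> {2..k}. (k choose j) * (\<mu> j * a (k - j) n))"
      using rec by simp
    also have "\<dots> = (\<Sum>j\<in>{0,1}. (k choose j) * (\<mu> j * a (k - j) n)) + (\<Sum>j\<in>{2..k}. (k choose j) * (\<mu> j * a (k - j) n))"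
      by (rule sum.union_disjoint) auto
    finally show ?thesis by (simp add: \<mu>0 mean[simplified])
  qed
  have "\<exists>C\<ge>0. \<forall>n. \<bar>a k n\<bar> \<le> C * sqrt n ^ k" for k
  proof (induction k rule: less_induct)
    case (less k)
    show ?case
    proof (cases "k = 0")
      case True
      then show ?thesis by (auto simp: a_def prob_space intro!: exI[of _ 1])
    next
      case False
      have "\<forall>j\<in>{..<k}. \<exists>C\<ge>0. \<forall>n. \<bar>a j n\<bar> \<le> C * sqrt n ^ j" using less by blast
      then obtain c where c: "\<And>j. j < k \<Longrightarrow> c j \<ge> 0" "\<And>j n. j < k \<Longrightarrow> \<bar>a j n\<bar> \<le> c j * sqrt n ^ j"
        unfolding bchoice_iff by auto
      define D where "D = (\<Sum>j\<in>{2..k}. (k choose j) * (\<bar>\<mu> j\<bar> * c (k - j)))"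
      have D: "D \<ge> 0" unfolding D_def using c(1) by (intro sum_nonneg mult_nonneg_nonneg) auto
      \<comment> \<open>truncated subtraction in \<open>k - 2\<close> is harmless: for \<open>k = 1\<close> the sum defining \<open>D\<close> is empty\<close>
      have step: "\<bar>a k (Suc n) - a k n\<bar> \<le> D * sqrt (Suc n) ^ (k - 2)" for n
      proof -
        have "\<bar>a k (Suc n) - a k n\<bar> \<le> (\<Sum>j\<in>{2..k}. \<bar>(k choose j) * (\<mu> j * a (k - j) n)\<bar>)"
          using False by (subst diff) (auto intro: sum_abs)
        also have "\<dots> \<le> (\<Sum>j\<in>{2..k}. (k choose j) * (\<bar>\<mu> j\<bar> * c (k - j)) * sqrt (Suc n) ^ (k - 2))"
        proof (rule sum_mono)
          fix j assume j: "j \<in> {2..k}"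
          have "\<bar>a (k - j) n\<bar> \<le> c (k - j) * sqrt n ^ (k - j)" using c(2)[of "k - j" n] j by simp
          also have "\<dots> \<le> c (k - j) * sqrt (Suc n) ^ (k - j)"
            using j c(1)[of "k - j"] by (intro mult_left_mono power_mono) auto
          also have "\<dots> \<le> c (k - j) * sqrt (Suc n) ^ (k - 2)"
            using j c(1)[of "k - j"] by (intro mult_left_mono power_increasing) auto
          finally have "(k choose j) * (\<bar>\<mu> j\<bar> * \<bar>a (k - j) n\<bar>) \<le>
              (k choose j) * (\<bar>\<mu> j\<bar> * (c (k - j) * sqrt (Suc n) ^ (k - 2)))"
            by (intro mult_left_mono) auto
          then show "\<bar>(k choose j) * (\<mu> j * a (k - j) n)\<bar> \<le>
              (k choose j) * (\<bar>\<mu> j\<bar> * c (k - j)) * sqrt (Suc n) ^ (k - 2)"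
            by (simp add: abs_mult mult_ac)
        qed
        finally show ?thesis by (simp only: D_def sum_distrib_right)
      qed
      have "\<bar>a k n\<bar> \<le> n * (D * sqrt n ^ (k - 2))" for n
      proof (induction n)
        case 0
        then show ?case using False by (simp add: a_def S_def power_0_left)
      next
        case (Suc n)
        have "sqrt n ^ (k - 2) \<le> sqrt (Suc n) ^ (k - 2)" by (intro power_mono) auto
        then have "n * (D * sqrt n ^ (k - 2)) \<le> n * (D * sqrt (Suc n) ^ (k - 2))"
          using D by (intro mult_left_mono) auto
        with Suc step[of n] have "\<bar>a k (Suc n)\<bar> \<le> n * (D * sqrt (Suc n) ^ (k - 2)) + D * sqrt (Suc n) ^ (k - 2)"
          by linarith
        then show ?case by (simp add: distrib_right)
      qed
      moreover have "n * (D * sqrt n ^ (k - 2)) = D * sqrt n ^ k" for n :: nat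
      proof (cases "k = 1")
        case True
        then have "D = 0" by (simp add: D_def)
        then show ?thesis by simp
      next
        case k: False
        then have "k = 2 + (k - 2)" using False by simp
        then have "sqrt n ^ k = (sqrt n)\<^sup>2 * sqrt n ^ (k - 2)" by (metis power_add)
        then show ?thesis by simp
      qed
      ultimately show ?thesis using D by (intro exI[of _ D]) simp
    qed
  qed
  then show "\<exists>C. \<forall>n. \<bar>expectation (\<lambda>\<omega>. (\<Sum>i<n. X i \<omega>) ^ k)\<bar> \<le> C * sqrt n ^ k"
    by (auto simp: a_def S_def)
qed

definition normalized_sum_law :: "real measure \<Rightarrow> nat \<Rightarrow> real measure" where
  "normalized_sum_law M N = distr (PiM {..<N} (\<lambda>_. M)) borel (\<lambda>x. (\<Sum>n<N. x n) / sqrt N)"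

context
  fixes \<alpha> :: "real measure"
  assumes std: "standardized \<alpha>"
begin

interpretation real_distribution \<alpha> by (rule standardized_real_distribution[OF std])

interpretation P: product_prob_space "\<lambda>_. \<alpha>" "UNIV :: nat set" by unfold_locales

lemma coordinates_iid:
  shows "prob_space.indep_vars (PiM UNIV (\<lambda>_. \<alpha>)) (\<lambda>_. borel) (\<lambda>i \<omega>. \<omega> i) (UNIV :: nat set)"
    and "distr (PiM UNIV (\<lambda>_. \<alpha>)) borel (\<lambda>\<omega>. \<omega> (i :: nat)) = \<alpha>"
proof -
  show d: "distr (PiM UNIV (\<lambda>_. \<alpha>)) borel (\<lambda>\<omega>. \<omega> i) = \<alpha>" for i :: nat
    using P.PiM_component[of i] by (metis (no_types, lifting) UNIV_I distr_cong events_eq_borel)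
  have m: "P.P.random_variable borel (\<lambda>\<omega>. \<omega> i)" for i :: nat
    by (metis UNIV_I events_eq_borel measurable_cong_sets measurable_component_singleton)
  have s: "sets (PiM UNIV (\<lambda>_. borel)) = sets (PiM UNIV (\<lambda>_ :: nat. \<alpha>))"
    by (intro sets_PiM_cong) auto
  have "distr (PiM UNIV (\<lambda>_. \<alpha>)) (PiM UNIV (\<lambda>_. borel)) (\<lambda>x. \<lambda>i\<in>UNIV. x i) = PiM (UNIV :: nat set) (\<lambda>_. \<alpha>)"
    using distr_id2[OF s] by (simp add: restrict_def)
  then show "P.P.indep_vars (\<lambda>_. borel) (\<lambda>i \<omega>. \<omega> i) (UNIV :: nat set)"
    by (subst P.P.indep_vars_iff_distr_eq_PiM') (use m d in auto)
qed

text \<open>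
  All the sums are realized on one probability space, the infinite product, which is the setting of the
  central limit theorem for a sequence of random variables.
\<close>

lemma normalized_sum_law_eq:
  "normalized_sum_law \<alpha> N = distr (PiM UNIV (\<lambda>_. \<alpha>)) borel (\<lambda>\<omega>. (\<Sum>n<N. \<omega> n) / sqrt N)"
proof -
  have "normalized_sum_law \<alpha> N = distr (distr (PiM UNIV (\<lambda>_. \<alpha>)) (PiM {..<N} (\<lambda>_. \<alpha>)) (\<lambda>x. restrict x {..<N}))
      borel (\<lambda>x. (\<Sum>n<N. x n) / sqrt N)"
    unfolding normalized_sum_law_def by (subst P.distr_PiM_restrict_finite) auto
  also have "\<dots> = distr (PiM UNIV (\<lambda>_. \<alpha>)) borel (\<lambda>\<omega>. (\<Sum>n<N. \<omega> n) / sqrt N)"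
    by (subst distr_distr) (auto simp: comp_def)
  finally show ?thesis .
qed

lemma real_distribution_normalized_sum_law: "real_distribution (normalized_sum_law \<alpha> N)"
  unfolding normalized_sum_law_eq by (rule P.P.real_distribution_distr) measurable

lemma normalized_sum_law_moments:
  shows "integrable (normalized_sum_law \<alpha> N) (\<lambda>x. x ^ k)"
    and "\<exists>C. \<forall>N. \<bar>\<integral>x. x ^ k \<partial>normalized_sum_law \<alpha> N\<bar> \<le> C"
proof -
  have int: "integrable (PiM UNIV (\<lambda>_. \<alpha>)) (\<lambda>\<omega>. \<omega> n ^ k)"
    and ex: "(\<integral>\<omega>. \<omega> n ^ k \<partial>PiM UNIV (\<lambda>_. \<alpha>)) = (\<integral>x. x ^ k \<partial>\<alpha>)" for n k :: nat
  proof -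
    have d: "\<alpha> = distr (PiM UNIV (\<lambda>_. \<alpha>)) borel (\<lambda>\<omega>. \<omega> n)" by (rule coordinates_iid(2)[symmetric])
    show "integrable (PiM UNIV (\<lambda>_. \<alpha>)) (\<lambda>\<omega>. \<omega> n ^ k)"
      using standardized_integrable_power[OF std, of k] by (subst (asm) d, subst (asm) integrable_distr_eq) auto
    show "(\<integral>\<omega>. \<omega> n ^ k \<partial>PiM UNIV (\<lambda>_. \<alpha>)) = (\<integral>x. x ^ k \<partial>\<alpha>)"
      by (subst (2) d, subst integral_distr) auto
  qed
  have mean: "(\<integral>x. x ^ 1 \<partial>\<alpha>) = 0" using standardized_mean[OF std] by simp
  note mom = P.P.moments_of_iid_sum[OF coordinates_iid(1) int ex mean]
  show "integrable (normalized_sum_law \<alpha> N) (\<lambda>x. x ^ k)"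
    unfolding normalized_sum_law_eq using mom(1)
    by (subst integrable_distr_eq) (auto simp: power_divide)
  obtain C where C: "\<And>N. \<bar>\<integral>\<omega>. (\<Sum>i<N. \<omega> i) ^ k \<partial>PiM UNIV (\<lambda>_. \<alpha>)\<bar> \<le> C * sqrt (real N) ^ k"
    using mom(2)[of k] by blast
  have "\<bar>\<integral>x. x ^ k \<partial>normalized_sum_law \<alpha> N\<bar> \<le> \<bar>C\<bar> + 1" for N
  proof -
    have eq: "(\<integral>x. x ^ k \<partial>normalized_sum_law \<alpha> N) = (\<integral>\<omega>. (\<Sum>i<N. \<omega> i) ^ k \<partial>PiM UNIV (\<lambda>_. \<alpha>)) / sqrt N ^ k"
      unfolding normalized_sum_law_eq by (subst integral_distr) (auto simp: power_divide)
    show ?thesis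
    proof (cases "N = 0")
      case True
      then show ?thesis unfolding eq by (cases "k = 0") (auto simp: P.P.prob_space power_0_left)
    next
      case False
      then have "\<bar>\<integral>x. x ^ k \<partial>normalized_sum_law \<alpha> N\<bar> \<le> C"
        using C[of N] by (simp add: eq abs_mult power_abs divide_le_eq)
      then show ?thesis by linarith
    qed
  qed
  then show "\<exists>C. \<forall>N. \<bar>\<integral>x. x ^ k \<partial>normalized_sum_law \<alpha> N\<bar> \<le> C" by blast
qed

lemma normalized_sum_law_weak_conv: "weak_conv_m (normalized_sum_law \<alpha>) std_normal_distribution"
proof -
  have int: "integrable (PiM UNIV (\<lambda>_. \<alpha>)) (\<lambda>\<omega>. h (\<omega> n))"
    and ex: "(\<integral>\<omega>. h (\<omega> n) \<partial>PiM UNIV (\<lambda>_. \<alpha>)) = (\<integral>x. h x \<partial>\<alpha>)"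
    if "integrable \<alpha> h" for n :: nat and h :: "real \<Rightarrow> real"
  proof -
    have d: "\<alpha> = distr (PiM UNIV (\<lambda>_. \<alpha>)) borel (\<lambda>\<omega>. \<omega> n)" by (rule coordinates_iid(2)[symmetric])
    have [measurable]: "h \<in> borel_measurable borel"
      using borel_measurable_integrable[OF that] by simp
    show "integrable (PiM UNIV (\<lambda>_. \<alpha>)) (\<lambda>\<omega>. h (\<omega> n))"
      using that by (subst (asm) d, subst (asm) integrable_distr_eq) auto
    show "(\<integral>\<omega>. h (\<omega> n) \<partial>PiM UNIV (\<lambda>_. \<alpha>)) = (\<integral>x. h x \<partial>\<alpha>)"
      by (subst (2) d, subst integral_distr) auto
  qed
  have i1: "integrable \<alpha> (\<lambda>x. x)" and i2: "integrable \<alpha> (\<lambda>x. x\<^sup>2)"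
    using standardized_integrable_power[OF std, of 1] standardized_integrable_power[OF std, of 2] by auto
  have "weak_conv_m (\<lambda>n. distr (PiM UNIV (\<lambda>_. \<alpha>)) borel (\<lambda>\<omega>. (\<Sum>i<n. \<omega> i) / sqrt (real n * 1\<^sup>2))) std_normal_distribution"
    by (rule P.P.central_limit_theorem_zero_mean[OF coordinates_iid(1), of 1 \<alpha>])
       (use coordinates_iid(2) ex[OF i1] ex[OF i2] int[OF i2] standardized_mean[OF std]
          standardized_second_moment[OF std] in auto)
  then show ?thesis by (simp add: normalized_sum_law_eq[abs_def])
qed

text \<open>
  Weak convergence only tests bounded functions. Truncating \<open>h\<close> at height \<open>R\<close> changes its integral by at
  most \<open>(\<integral> h\<^sup>2) / R\<close>, and the second moments of \<open>h\<close> are bounded uniformly in \<open>N\<close> by the moment bounds, so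
  the truncation error is uniformly small.
\<close>

theorem clt_poly_growth:
  fixes h :: "real \<Rightarrow> real"
  assumes cont: "continuous_on UNIV h" and growth: "poly_growth h"
  shows "(\<lambda>N. \<integral>x. h x \<partial>normalized_sum_law \<alpha> N) \<longlonglongrightarrow> (\<integral>x. h x \<partial>gauss)"
proof -
  have cont2: "continuous_on UNIV (\<lambda>x. (h x)\<^sup>2)" using cont by (intro continuous_intros)
  have growth2: "poly_growth (\<lambda>x. (h x)\<^sup>2)"
    using poly_growth_mult[OF growth growth] by (simp add: power2_eq_square)
  obtain A m where A: "A \<ge> 0" "\<And>x. norm (h x) \<le> A * (1 + \<bar>x\<bar>) ^ m"
    using growth by (elim poly_growthE) blast
  have hsq: "(h x)\<^sup>2 \<le> A\<^sup>2 * (4 ^ m * (1 + x ^ (2 * m)))" for x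
  proof -
    have "(h x)\<^sup>2 \<le> (A * (1 + \<bar>x\<bar>) ^ m)\<^sup>2" using A(2)[of x] by (intro abs_le_square_iff[THEN iffD1]) auto
    also have "\<dots> = A\<^sup>2 * (1 + \<bar>x\<bar>) ^ (2 * m)" by (simp add: power_mult_distrib power_mult mult.commute)
    also have "\<dots> \<le> A\<^sup>2 * (4 ^ m * (1 + x ^ (2 * m)))" using one_plus_abs_power_le by (intro mult_left_mono) auto
    finally show ?thesis .
  qed
  note law_int = real_distribution.integrable_poly_growth[OF real_distribution_normalized_sum_law normalized_sum_law_moments(1)]
  obtain C0 where C0: "\<And>N. \<bar>\<integral>x. x ^ (2 * m) \<partial>normalized_sum_law \<alpha> N\<bar> \<le> C0"
    using normalized_sum_law_moments(2)[of "2 * m"] by blast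
  define C where "C = max (A\<^sup>2 * (4 ^ m * (1 + C0))) (\<integral>x. (h x)\<^sup>2 \<partial>gauss) + 1"
  have Cg: "(\<integral>x. (h x)\<^sup>2 \<partial>gauss) \<le> C" by (simp add: C_def)
  have "C > 0"
    using integral_nonneg_AE[of "\<lambda>x. (h x)\<^sup>2" gauss] unfolding C_def by (simp add: add_nonneg_pos max.coboundedI2)
  have Cl: "(\<integral>x. (h x)\<^sup>2 \<partial>normalized_sum_law \<alpha> N) \<le> C" for N
  proof -
    interpret L: real_distribution "normalized_sum_law \<alpha> N" by (rule real_distribution_normalized_sum_law)
    have "(\<integral>x. (h x)\<^sup>2 \<partial>normalized_sum_law \<alpha> N) \<le> (\<integral>x. A\<^sup>2 * (4 ^ m * (1 + x ^ (2 * m))) \<partial>normalized_sum_law \<alpha> N)"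
      using law_int[OF cont2 growth2] normalized_sum_law_moments(1) hsq by (intro integral_mono) auto
    also have "\<dots> = A\<^sup>2 * (4 ^ m * (1 + (\<integral>x. x ^ (2 * m) \<partial>normalized_sum_law \<alpha> N)))"
      using normalized_sum_law_moments(1) by (simp add: L.prob_space[simplified])
    also have "\<dots> \<le> A\<^sup>2 * (4 ^ m * (1 + C0))" using C0[of N] by (intro mult_left_mono) auto
    finally show ?thesis by (simp add: C_def)
  qed
  define clip where "clip R x = max (-R) (min R (h x))" for R x
  have clip_close: "\<bar>(\<integral>x. h x \<partial>M) - (\<integral>x. clip R x \<partial>M)\<bar> \<le> C / R"
    if "R > 0" and M: "real_distribution M" "\<And>k. integrable M (\<lambda>x. x ^ k)" "(\<integral>x. (h x)\<^sup>2 \<partial>M) \<le> C" for R M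
  proof -
    note int = real_distribution.integrable_poly_growth[OF M(1,2)]
    have pw: "\<bar>h x - clip R x\<bar> \<le> (h x)\<^sup>2 / R" for x
    proof (cases "\<bar>h x\<bar> \<le> R")
      case False
      then have "R * \<bar>h x\<bar> \<le> (h x)\<^sup>2"
        by (simp add: abs_mult_self_eq power2_eq_square) (metis abs_ge_zero abs_mult_self_eq linear mult_right_mono)
      moreover have "\<bar>h x - clip R x\<bar> \<le> \<bar>h x\<bar>" using that(1) by (auto simp: clip_def)
      ultimately show ?thesis using that(1) by (simp add: le_divide_eq mult.commute) (smt (verit) mult_left_mono)
    qed (use that in \<open>auto simp: clip_def\<close>)
    have ci: "integrable M (clip R)"
      by (rule int) (use that(1) in \<open>auto simp: clip_def intro!: continuous_intros cont poly_growthI[of _ R 0]\<close>)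
    have "\<bar>(\<integral>x. h x \<partial>M) - (\<integral>x. clip R x \<partial>M)\<bar> = \<bar>\<integral>x. h x - clip R x \<partial>M\<bar>"
      using int[OF cont growth] ci by simp
    also have "\<dots> \<le> (\<integral>x. (h x)\<^sup>2 / R \<partial>M)"
      using int[OF cont growth] ci int[OF cont2 growth2] pw
      by (intro order_trans[OF integral_abs_bound integral_mono]) auto
    also have "\<dots> \<le> C / R" using M(3) that(1) by (simp add: divide_right_mono)
    finally show ?thesis .
  qed
  show ?thesis
  proof (rule LIMSEQ_I)
    fix r :: real assume r: "r > 0"
    define R where "R = 4 * C / r"
    have R: "R > 0" "C / R = r / 4" using r \<open>C > 0\<close> by (auto simp: R_def)
    have "(\<lambda>N. \<integral>x. clip R x \<partial>normalized_sum_law \<alpha> N) \<longlonglongrightarrow> (\<integral>x. clip R x \<partial>gauss)"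
    proof (rule weak_conv_imp_integral_bdd_continuous_conv)
      show "isCont (clip R) x" for x
        using cont unfolding clip_def[abs_def] by (intro continuous_intros) (simp add: continuous_on_eq_continuous_at)
      show "norm (clip R x) \<le> R" for x using R by (auto simp: clip_def)
    qed (use real_distribution_normalized_sum_law real_dist_normal_dist normalized_sum_law_weak_conv in auto)
    from LIMSEQ_D[OF this, of "r / 2"] r obtain N0 where
      N0: "\<And>N. N \<ge> N0 \<Longrightarrow> norm ((\<integral>x. clip R x \<partial>normalized_sum_law \<alpha> N) - (\<integral>x. clip R x \<partial>gauss)) < r / 2" by auto
    show "\<exists>N0. \<forall>N\<ge>N0. norm ((\<integral>x. h x \<partial>normalized_sum_law \<alpha> N) - (\<integral>x. h x \<partial>gauss)) < r"
    proof (intro exI[of _ N0] allI impI)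
      fix N assume "N \<ge> N0"
      from N0[OF this] clip_close[OF R(1) real_distribution_normalized_sum_law normalized_sum_law_moments(1) Cl, of N]
        clip_close[OF R(1) real_dist_normal_dist integrable_std_normal_distribution_moment Cg] R(2)
      show "norm ((\<integral>x. h x \<partial>normalized_sum_law \<alpha> N) - (\<integral>x. h x \<partial>gauss)) < r" unfolding real_norm_def by linarith
    qed
  qed
qed

end

section \<open>Density of polynomials with respect to the normal law\<close>

interpretation gauss: real_distribution gauss by (rule real_dist_normal_dist)

lemma integrable_exp_abs_gauss: "integrable gauss (\<lambda>x. exp (c * \<bar>x\<bar>))"
proof -
  have e: "integrable gauss (\<lambda>x. exp (c * x))" for c :: real
  proof -
    \<comment> \<open>completing the square: the density of the normal law with mean \<open>c\<close>\<close>
    have "std_normal_density x * exp (c * x) = exp (c\<^sup>2 / 2) * normal_density c 1 x" for x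
      by (simp add: normal_density_def exp_add[symmetric] power2_diff field_simps)
    then show ?thesis
      by (subst integrable_density) (auto simp: normal_density_nonneg)
  qed
  show ?thesis
  proof (rule Bochner_Integration.integrable_bound)
    show "integrable gauss (\<lambda>x. exp (c * x) + exp ((- c) * x))"
      using e[of c] e[of "- c"] by (rule Bochner_Integration.integrable_add)
    have "exp (c * \<bar>x\<bar>) \<le> exp (c * x) + exp ((- c) * x)" for x
      by (cases "x \<ge> 0") simp_all
    then show "AE x in gauss. norm (exp (c * \<bar>x\<bar>)) \<le> norm (exp (c * x) + exp ((- c) * x))"
      by (intro AE_I2) (metis abs_ge_self abs_exp_cancel order_trans real_norm_def)
  qed measurable
qed

text \<open>
  The closure of the polynomials in \<open>L\<^sup>p\<close> of the normal law. It is enlarged step by step: exponentials,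
  powers of cosines, bounded continuous functions, indicators, and finally all of \<open>L\<^sup>p\<close>.
\<close>

definition Lp_poly_closure :: "real \<Rightarrow> (real \<Rightarrow> complex) set" where
  "Lp_poly_closure p = {h \<in> Lp_space p gauss. \<forall>e>0. \<exists>f. Lp_norm p gauss (\<lambda>x. h x - poly_fun f x) < e}"

context
  fixes p :: real
  assumes p: "p \<ge> 1"
begin

lemma Lp_poly_closure_poly: "poly_fun f \<in> Lp_poly_closure p"
  using p by (auto simp: Lp_poly_closure_def poly_fun_Lp_gauss Lp_norm_def intro!: exI[of _ f])

lemma Lp_poly_closure_closed:
  assumes "h \<in> Lp_space p gauss"
    and "\<And>e. e > 0 \<Longrightarrow> \<exists>g\<in>Lp_poly_closure p. Lp_norm p gauss (\<lambda>x. h x - g x) < e"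
  shows "h \<in> Lp_poly_closure p"
proof -
  have "\<exists>f. Lp_norm p gauss (\<lambda>x. h x - poly_fun f x) < e" if "e > 0" for e
  proof -
    have e2: "e / 2 > 0" using that by simp
    from assms(2)[OF this] obtain g where
      g: "g \<in> Lp_poly_closure p" "Lp_norm p gauss (\<lambda>x. h x - g x) < e / 2" by blast
    then obtain f where f: "Lp_norm p gauss (\<lambda>x. g x - poly_fun f x) < e / 2" and gL: "g \<in> Lp_space p gauss"
      using e2 unfolding Lp_poly_closure_def by blast
    have "poly_fun f \<in> Lp_space p gauss" using p by (simp add: poly_fun_Lp_gauss)
    from Lp_norm_triangle_diff[OF p assms(1) gL this] g(2) f show ?thesis by (intro exI[of _ f]) linarith
  qed
  with assms(1) show ?thesis by (simp add: Lp_poly_closure_def)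
qed

lemma Lp_poly_closure_add:
  assumes "g \<in> Lp_poly_closure p" "h \<in> Lp_poly_closure p"
  shows "(\<lambda>x. g x + h x) \<in> Lp_poly_closure p"
proof -
  have L: "g \<in> Lp_space p gauss" "h \<in> Lp_space p gauss" using assms by (auto simp: Lp_poly_closure_def)
  have "\<exists>f. Lp_norm p gauss (\<lambda>x. g x + h x - poly_fun f x) < e" if "e > 0" for e
  proof -
    have "e / 2 > 0" using that by simp
    then obtain f1 f2 where f: "Lp_norm p gauss (\<lambda>x. g x - poly_fun f1 x) < e / 2"
        "Lp_norm p gauss (\<lambda>x. h x - poly_fun f2 x) < e / 2"
      using assms unfolding Lp_poly_closure_def by blast
    have "poly_fun f1 \<in> Lp_space p gauss" "poly_fun f2 \<in> Lp_space p gauss"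
      using p by (auto simp: poly_fun_Lp_gauss)
    from Lp_norm_triangle[OF p Lp_space_diff[OF p L(1) this(1)] Lp_space_diff[OF p L(2) this(2)]] f
    show ?thesis by (intro exI[of _ "f1 + f2"]) (simp add: algebra_simps)
  qed
  with Lp_space_add[OF p L] show ?thesis by (simp add: Lp_poly_closure_def)
qed

lemma Lp_poly_closure_scale:
  assumes "h \<in> Lp_poly_closure p"
  shows "(\<lambda>x. c * h x) \<in> Lp_poly_closure p"
proof (cases "c = 0")
  case True
  then show ?thesis using Lp_poly_closure_poly[of 0] by simp
next
  case False
  have "\<exists>f. Lp_norm p gauss (\<lambda>x. c * h x - poly_fun f x) < e" if "e > 0" for e
  proof -
    have "e / norm c > 0" using that False by simp
    then obtain f where f: "Lp_norm p gauss (\<lambda>x. h x - poly_fun f x) < e / norm c"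
      using assms unfolding Lp_poly_closure_def by blast
    have "Lp_norm p gauss (\<lambda>x. c * h x - poly_fun (smult c f) x) = norm c * Lp_norm p gauss (\<lambda>x. h x - poly_fun f x)"
      using p by (subst Lp_norm_scale[symmetric]) (auto simp: right_diff_distrib)
    also have "\<dots> < e" using f False by (simp add: pos_less_divide_eq mult.commute)
    finally show ?thesis by blast
  qed
  with assms show ?thesis by (auto simp: Lp_poly_closure_def Lp_space_scale)
qed

lemma Lp_poly_closure_sum:
  "(\<And>i. i \<in> I \<Longrightarrow> h i \<in> Lp_poly_closure p) \<Longrightarrow> (\<lambda>x. \<Sum>i\<in>I. h i x) \<in> Lp_poly_closure p"
  by (induction I rule: infinite_finite_induct)
     (use Lp_poly_closure_poly[of 0] in \<open>auto simp: Lp_poly_closure_add\<close>)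

text \<open>
  Dominated convergence keeps limits inside the closure; all enlargements but the linear ones go through
  this lemma.
\<close>

lemma Lp_poly_closure_dominated:
  fixes h :: "real \<Rightarrow> complex" and w :: "real \<Rightarrow> real"
  assumes hn: "\<And>n :: nat. hn n \<in> Lp_poly_closure p"
    and lim: "\<And>x. (\<lambda>n. hn n x) \<longlonglongrightarrow> h x"
    and dom: "\<And>n x. norm (hn n x) \<le> w x" and w: "integrable gauss (\<lambda>x. w x powr p)"
  shows "h \<in> Lp_poly_closure p"
proof (rule Lp_poly_closure_closed)
  have hn_meas [measurable]: "hn n \<in> borel_measurable borel" for n
    using hn[of n] by (auto simp: Lp_poly_closure_def Lp_space_def)
  have h_meas [measurable]: "h \<in> borel_measurable borel" by (rule borel_measurable_LIMSEQ_metric[OF hn_meas lim])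
  have h_dom: "norm (h x) \<le> w x" for x
    using tendsto_norm[OF lim[of x]] dom by (intro LIMSEQ_le_const2) auto
  have w0: "w x \<ge> 0" for x using order_trans[OF norm_ge_zero h_dom] .
  show "h \<in> Lp_space p gauss"
    unfolding Lp_space_def
  proof (intro CollectI conjI)
    show "integrable gauss (\<lambda>x. norm (h x) powr p)"
      by (rule Bochner_Integration.integrable_bound[OF w]) (use p h_dom w0 in \<open>auto intro!: AE_I2 powr_mono2\<close>)
  qed simp
  fix e :: real assume e: "e > 0"
  have "(\<lambda>n. \<integral>x. norm (h x - hn n x) powr p \<partial>gauss) \<longlonglongrightarrow> (\<integral>x. 0 \<partial>gauss)"
  proof (rule integral_dominated_convergence)
    show "integrable gauss (\<lambda>x. 2 powr p * w x powr p)" using w by simp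
    show "AE x in gauss. (\<lambda>n. norm (h x - hn n x) powr p) \<longlonglongrightarrow> 0"
    proof (intro AE_I2)
      fix x
      have "(\<lambda>n. norm (h x - hn n x)) \<longlonglongrightarrow> norm (h x - h x)" by (intro tendsto_intros lim)
      then have "(\<lambda>n. norm (h x - hn n x) powr p) \<longlonglongrightarrow> 0 powr p"
        using p by (intro tendsto_powr') auto
      then show "(\<lambda>n. norm (h x - hn n x) powr p) \<longlonglongrightarrow> 0" by simp
    qed
    show "AE x in gauss. norm (norm (h x - hn n x) powr p) \<le> 2 powr p * w x powr p" for n
    proof (intro AE_I2)
      fix x
      have "norm (h x - hn n x) \<le> 2 * w x" using norm_triangle_ineq4[of "h x" "hn n x"] h_dom[of x] dom[of n x] by simp
      then have "norm (h x - hn n x) powr p \<le> (2 * w x) powr p" using p by (intro powr_mono2) auto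
      then show "norm (norm (h x - hn n x) powr p) \<le> 2 powr p * w x powr p" using w0[of x] by (simp add: powr_mult)
    qed
  qed measurable
  then have "(\<lambda>n. \<integral>x. norm (h x - hn n x) powr p \<partial>gauss) \<longlonglongrightarrow> 0" by simp
  from order_tendstoD(2)[OF this, of "(e / 2) powr p"] e obtain n where
    n: "(\<integral>x. norm (h x - hn n x) powr p \<partial>gauss) < (e / 2) powr p"
    by (auto simp: eventually_sequentially)
  then have "Lp_norm p gauss (\<lambda>x. h x - hn n x) \<le> e / 2"
    using p e by (subst Lp_norm_le_iff) auto
  then show "\<exists>g\<in>Lp_poly_closure p. Lp_norm p gauss (\<lambda>x. h x - g x) < e"
    using hn[of n] e by (intro bexI[of _ "hn n"]) auto
qed

lemma Lp_poly_closure_bounded_limit: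
  fixes h :: "real \<Rightarrow> complex"
  assumes "\<And>n :: nat. hn n \<in> Lp_poly_closure p" "\<And>x. (\<lambda>n. hn n x) \<longlonglongrightarrow> h x" "\<And>n x. norm (hn n x) \<le> B"
  shows "h \<in> Lp_poly_closure p"
  by (rule Lp_poly_closure_dominated[OF assms]) simp

text \<open>
  The Taylor polynomials of the exponential are dominated by \<open>exp \<bar>t x\<bar>\<close>, all of whose powers are
  integrable for the normal law. This is where the density of polynomials uses the exponential integrability of the normal law.
\<close>

lemma Lp_poly_closure_cis: "(\<lambda>x. exp (\<i> * complex_of_real (t * x))) \<in> Lp_poly_closure p"
proof (rule Lp_poly_closure_dominated)
  let ?s = "\<lambda>n. \<Sum>k<n. monom ((\<i> * complex_of_real t) ^ k / fact k) k"
  have s: "poly_fun (?s n) x = (\<Sum>k<n. (\<i> * complex_of_real (t * x)) ^ k /\<^sub>R fact k)" for n x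
    by (simp add: poly_sum poly_monom power_mult_distrib scaleR_conv_of_real field_simps)
  show "poly_fun (?s n) \<in> Lp_poly_closure p" for n by (rule Lp_poly_closure_poly)
  show "(\<lambda>n. poly_fun (?s n) x) \<longlonglongrightarrow> exp (\<i> * complex_of_real (t * x))" for x
    unfolding s using exp_converges[of "\<i> * complex_of_real (t * x)"] by (simp add: sums_def)
  show "norm (poly_fun (?s n) x) \<le> exp (\<bar>t\<bar> * \<bar>x\<bar>)" for n x
  proof -
    have "norm (poly_fun (?s n) x) \<le> (\<Sum>k<n. norm ((\<i> * complex_of_real (t * x)) ^ k /\<^sub>R fact k))"
      unfolding s by (rule norm_sum)
    also have "\<dots> = (\<Sum>k<n. (\<bar>t\<bar> * \<bar>x\<bar>) ^ k /\<^sub>R fact k)"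
      by (simp add: norm_mult norm_power abs_mult)
    also have "\<dots> \<le> suminf (\<lambda>k. (\<bar>t\<bar> * \<bar>x\<bar>) ^ k /\<^sub>R fact k)"
      by (intro sum_le_suminf summable_exp_generic) auto
    also have "\<dots> = exp (\<bar>t\<bar> * \<bar>x\<bar>)" by (simp add: exp_def)
    finally show ?thesis .
  qed
  show "integrable gauss (\<lambda>x. exp (\<bar>t\<bar> * \<bar>x\<bar>) powr p)"
    using integrable_exp_abs_gauss[of "p * \<bar>t\<bar>"] by (simp add: exp_powr_real mult_ac)
qed

lemma Lp_poly_closure_cos_power: "(\<lambda>x. complex_of_real (cos (a * x + b) ^ k)) \<in> Lp_poly_closure p"
proof -
  have eq: "complex_of_real (cos u ^ k) =
      (\<Sum>j\<le>k. (of_nat (k choose j) / 2 ^ k) * exp (\<i> * complex_of_real ((2 * real j - real k) * u)))" for u :: real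
  proof -
    have "complex_of_real (cos u) = (exp (\<i> * u) + exp (- (\<i> * u))) / 2"
      by (simp add: cos_exp_eq flip: cos_of_real)
    then have "complex_of_real (cos u ^ k) = (exp (\<i> * u) + exp (- (\<i> * u))) ^ k / 2 ^ k"
      by (simp only: of_real_power power_divide)
    also have "\<dots> = (\<Sum>j\<le>k. (of_nat (k choose j) / 2 ^ k) * (exp (\<i> * u) ^ j * exp (- (\<i> * u)) ^ (k - j)))"
      by (simp add: binomial_ring sum_divide_distrib mult_ac)
    also have "\<dots> = (\<Sum>j\<le>k. (of_nat (k choose j) / 2 ^ k) * exp (\<i> * complex_of_real ((2 * real j - real k) * u)))"
    proof (intro sum.cong refl arg_cong2[of _ _ _ _ "(*)"])
      fix j assume "j \<in> {..k}"
      then have "of_nat j * (\<i> * u) + of_nat (k - j) * - (\<i> * u) = \<i> * complex_of_real ((2 * real j - real k) * u)"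
        by (simp add: of_nat_diff algebra_simps)
      then show "exp (\<i> * u) ^ j * exp (- (\<i> * u)) ^ (k - j) = exp (\<i> * complex_of_real ((2 * real j - real k) * u))"
        by (metis exp_of_nat_mult exp_add)
    qed
    finally show ?thesis .
  qed
  have "(\<lambda>x. (of_nat (k choose j) / 2 ^ k * exp (\<i> * complex_of_real ((2 * real j - real k) * b))) *
      exp (\<i> * complex_of_real (((2 * real j - real k) * a) * x))) \<in> Lp_poly_closure p" for j
    by (intro Lp_poly_closure_scale Lp_poly_closure_cis)
  moreover have "(of_nat (k choose j) / 2 ^ k * exp (\<i> * complex_of_real ((2 * real j - real k) * b))) *
      exp (\<i> * complex_of_real (((2 * real j - real k) * a) * x)) =
      of_nat (k choose j) / 2 ^ k * exp (\<i> * complex_of_real ((2 * real j - real k) * (a * x + b)))" for j x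
    by (simp add: exp_add[symmetric] algebra_simps)
  ultimately have "(\<lambda>x. of_nat (k choose j) / 2 ^ k * exp (\<i> * complex_of_real ((2 * real j - real k) * (a * x + b))))
      \<in> Lp_poly_closure p" for j by (simp only:)
  then show ?thesis
    unfolding eq by (intro Lp_poly_closure_sum)
qed

text \<open>
  On \<open>[-L, L]\<close> approximate \<open>f\<close> by a polynomial in \<open>cos (pi (x + L) / (2 L))\<close>, which is a homeomorphism
  from this interval onto \<open>[-1, 1]\<close>. Outside the interval the approximation stays bounded by the same
  constant, because the cosine never leaves \<open>[-1, 1]\<close>; so the approximations converge boundedly.
\<close>

lemma Lp_poly_closure_bounded_continuous:
  fixes f :: "real \<Rightarrow> real"
  assumes cont: "continuous_on UNIV f" and bd: "\<And>x. \<bar>f x\<bar> \<le> B"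
  shows "(\<lambda>x. complex_of_real (f x)) \<in> Lp_poly_closure p"
proof -
  have "\<exists>h. (\<lambda>x. complex_of_real (h x)) \<in> Lp_poly_closure p \<and> (\<forall>x. \<bar>h x\<bar> \<le> B + 1) \<and>
      (\<forall>x. \<bar>x\<bar> \<le> real (Suc n) \<longrightarrow> \<bar>f x - h x\<bar> < 1 / Suc n)" for n
  proof -
    define L where "L = real (Suc n)"
    have L: "L > 0" by (simp add: L_def)
    \<comment> \<open>\<open>F\<close> is \<open>f\<close> on \<open>[-L, L]\<close>, expressed in the variable \<open>u = cos (pi (x + L) / (2 L))\<close>\<close>
    define F where "F u = f (2 * L * arccos u / pi - L)" for u
    have "continuous_on {-1..1} F"
      unfolding F_def by (intro continuous_on_compose2[OF cont] continuous_intros) auto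
    from Stone_Weierstrass_real_polynomial_function[OF compact_Icc this, of "1 / L"] L
    obtain P where "real_polynomial_function P" and P: "\<And>u. u \<in> {-1..1} \<Longrightarrow> \<bar>F u - P u\<bar> < 1 / L"
      by auto
    then obtain a k where a: "P = (\<lambda>u. \<Sum>i\<le>k. a i * u ^ i)"
      by (auto simp: real_polynomial_function_iff_sum)
    define h where "h x = P (cos (pi / (2 * L) * x + pi / 2))" for x
    have "(\<lambda>x. complex_of_real (h x)) \<in> Lp_poly_closure p"
      unfolding h_def a of_real_sum of_real_mult
      by (intro Lp_poly_closure_sum Lp_poly_closure_scale Lp_poly_closure_cos_power)
    moreover have "\<bar>h x\<bar> \<le> B + 1" for x
    proof -
      have "\<bar>F (cos (pi / (2 * L) * x + pi / 2)) - h x\<bar> < 1 / L"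
        unfolding h_def by (intro P) auto
      moreover have "1 / L \<le> 1" by (simp add: L_def)
      moreover have "\<bar>F (cos (pi / (2 * L) * x + pi / 2))\<bar> \<le> B" unfolding F_def by (rule bd)
      ultimately show ?thesis by linarith
    qed
    moreover have "\<bar>f x - h x\<bar> < 1 / L" if x: "\<bar>x\<bar> \<le> L" for x
    proof -
      have ang: "pi / (2 * L) * x + pi / 2 = pi * ((x + L) / (2 * L))" using L by (simp add: field_simps)
      have "0 \<le> (x + L) / (2 * L)" "(x + L) / (2 * L) \<le> 1" using L x by (auto simp: field_simps)
      then have "0 \<le> pi / (2 * L) * x + pi / 2" "pi / (2 * L) * x + pi / 2 \<le> pi"
        unfolding ang using mult_left_le[of "(x + L) / (2 * L)" pi] by (auto simp del: times_divide_eq_right)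
      then have "F (cos (pi / (2 * L) * x + pi / 2)) = f (2 * L * (pi / (2 * L) * x + pi / 2) / pi - L)"
        by (simp add: F_def arccos_cos)
      also have "2 * L * (pi / (2 * L) * x + pi / 2) / pi - L = x" using L by (simp add: field_simps)
      finally have "F (cos (pi / (2 * L) * x + pi / 2)) = f x" .
      then show ?thesis using P[of "cos (pi / (2 * L) * x + pi / 2)"] by (simp add: h_def)
    qed
    ultimately show ?thesis unfolding L_def by blast
  qed
  then have "\<forall>n. \<exists>h. (\<lambda>x. complex_of_real (h x)) \<in> Lp_poly_closure p \<and> (\<forall>x. \<bar>h x\<bar> \<le> B + 1) \<and>
      (\<forall>x. \<bar>x\<bar> \<le> real (Suc n) \<longrightarrow> \<bar>f x - h x\<bar> < 1 / Suc n)" by (rule allI)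
  from choice[OF this] obtain h where h: "\<And>n. (\<lambda>x. complex_of_real (h n x)) \<in> Lp_poly_closure p" "\<And>n x. \<bar>h n x\<bar> \<le> B + 1"
    "\<And>n x. \<bar>x\<bar> \<le> real (Suc n) \<Longrightarrow> \<bar>f x - h n x\<bar> < 1 / Suc n"
    by blast
  show ?thesis
  proof (rule Lp_poly_closure_bounded_limit[of "\<lambda>n x. complex_of_real (h n x)" _ "B + 1", OF h(1)])
    fix x :: real
    obtain n0 :: nat where n0: "\<bar>x\<bar> \<le> real n0" using real_arch_simple[of "\<bar>x\<bar>"] by auto
    have "(\<lambda>n. h n x - f x) \<longlonglongrightarrow> 0"
    proof (rule Lim_null_comparison)
      show "\<forall>\<^sub>F n in sequentially. norm (h n x - f x) \<le> 1 / Suc n"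
      proof (rule eventually_sequentiallyI[of n0])
        fix n assume "n \<ge> n0"
        then have "\<bar>x\<bar> \<le> real (Suc n)" using n0 by simp
        from h(3)[OF this] show "norm (h n x - f x) \<le> 1 / Suc n" by (simp add: abs_minus_commute)
      qed
    qed (rule LIMSEQ_Suc[OF lim_1_over_n])
    then show "(\<lambda>n. complex_of_real (h n x)) \<longlonglongrightarrow> complex_of_real (f x)"
      by (intro tendsto_of_real) (simp add: LIM_zero_iff)
  qed (use h(2) in simp)
qed

text \<open>
  A Dynkin system argument from the half-lines, whose indicators are bounded limits of piecewise linear
  functions.
\<close>

lemma Lp_poly_closure_indicator:
  assumes "A \<in> sets borel"
  shows "(\<lambda>x. indicator A x) \<in> Lp_poly_closure p"
proof -
  have "Int_stable (range (\<lambda>a :: real. {..a}))"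
    by (auto simp: Int_stable_def)
  moreover have "range (\<lambda>a :: real. {..a}) \<subseteq> Pow UNIV" by simp
  moreover have "A \<in> sigma_sets UNIV (range (\<lambda>a :: real. {..a}))"
    using assms by (simp add: borel_eq_atMost)
  ultimately show ?thesis
  proof (induction rule: sigma_sets_induct_disjoint)
    case (basic A)
    then obtain a where a: "A = {..a}" by auto
    let ?f = "\<lambda>n x. max 0 (min 1 (1 - real n * (x - a)))"
    show ?case
    proof (rule Lp_poly_closure_bounded_limit[of "\<lambda>n x. complex_of_real (?f n x)" _ 1])
      show "(\<lambda>x. complex_of_real (?f n x)) \<in> Lp_poly_closure p" for n
        by (rule Lp_poly_closure_bounded_continuous[of _ 1]) (auto intro!: continuous_intros)
      show "(\<lambda>n. complex_of_real (?f n x)) \<longlonglongrightarrow> indicator A x" for x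
      proof (cases "x \<le> a")
        case True
        then have "real n * (x - a) \<le> 0" for n by (simp add: mult_nonneg_nonpos)
        then have "?f n x = 1" for n by (smt (verit))
        with True show ?thesis by (simp add: a)
      next
        case False
        obtain n0 :: nat where n0: "1 / (x - a) \<le> real n0" using real_arch_simple[of "1 / (x - a)"] by auto
        have "eventually (\<lambda>n. complex_of_real (?f n x) = 0) sequentially"
        proof (rule eventually_sequentiallyI[of n0])
          fix n assume "n \<ge> n0"
          then have "1 / (x - a) \<le> n" using n0 by linarith
          then have "1 \<le> real n * (x - a)" using False by (simp add: divide_le_eq)
          then show "complex_of_real (?f n x) = 0" by simp
        qed
        then show ?thesis using False by (simp add: a tendsto_eventually)
      qed
    qed auto
  next
    case empty
    then show ?case using Lp_poly_closure_poly[of 0] by simp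
  next
    case (compl A)
    have "(\<lambda>x. poly_fun 1 x + (- 1) * indicator A x) \<in> Lp_poly_closure p"
      by (intro Lp_poly_closure_add Lp_poly_closure_poly Lp_poly_closure_scale compl)
    moreover have "poly_fun 1 x + (- 1) * indicator A x = indicator (UNIV - A) x" for x
      by (auto simp: indicator_def)
    ultimately show ?case by simp
  next
    case (union A)
    show ?case
    proof (rule Lp_poly_closure_bounded_limit[of "\<lambda>n x. \<Sum>i<n. indicator (A i) x" _ 1])
      show "(\<lambda>x. \<Sum>i<n. indicator (A i) x) \<in> Lp_poly_closure p" for n
        by (intro Lp_poly_closure_sum union)
      have eq: "(\<Sum>i<n. indicator (A i) x) = (indicator (\<Union>i<n. A i) x :: complex)" for n x
        using union(1) by (intro indicator_UN_disjoint[symmetric] disjoint_family_on_mono[OF _ union(1)]) auto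
      show "norm (\<Sum>i<n. indicator (A i) x :: complex) \<le> 1" for n x
        unfolding eq by (auto simp: indicator_def)
      show "(\<lambda>n. \<Sum>i<n. indicator (A i) x) \<longlonglongrightarrow> (indicator (\<Union>i. A i) x :: complex)" for x
        unfolding eq by (rule LIMSEQ_indicator_UN)
    qed
  qed
qed

theorem poly_dense_in_Lp_gauss:
  assumes h: "h \<in> Lp_space p gauss" and "e > 0"
  obtains f where "Lp_norm p gauss (\<lambda>x. h x - poly_fun f x) < e"
proof -
  have hm: "h \<in> borel_measurable borel" using h by (simp add: Lp_space_def)
  obtain s where s: "\<And>i. simple_function borel (s i)" "\<And>x. (\<lambda>i. s i x) \<longlonglongrightarrow> h x"
      "\<And>i x. dist (s i x) 0 \<le> 2 * dist (h x) 0"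
    using borel_measurable_implies_sequence_metric[OF hm, of 0] by auto
  have "h \<in> Lp_poly_closure p"
  proof (rule Lp_poly_closure_dominated[of s])
    show "s i \<in> Lp_poly_closure p" for i
    proof -
      have fin: "finite (range (s i))" using simple_functionD(1)[OF s(1)[of i]] by simp
      have "(\<lambda>x. y * indicator (s i -` {y}) x) \<in> Lp_poly_closure p" for y
        using simple_functionD(2)[OF s(1)[of i], of "{y}"]
        by (intro Lp_poly_closure_scale Lp_poly_closure_indicator) simp
      then have "(\<lambda>x. \<Sum>y\<in>range (s i). y * indicator (s i -` {y}) x) \<in> Lp_poly_closure p"
        by (rule Lp_poly_closure_sum)
      moreover have "(\<Sum>y\<in>range (s i). y * indicator (s i -` {y}) x) = s i x" for x
      proof -
        have "(\<Sum>y\<in>range (s i). y * indicator (s i -` {y}) x) = (\<Sum>y\<in>range (s i). if y = s i x then y else 0)"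
          by (intro sum.cong) (auto simp: indicator_def)
        then show ?thesis using fin by (simp add: sum.delta')
      qed
      ultimately show ?thesis by simp
    qed
    show "(\<lambda>i. s i x) \<longlonglongrightarrow> h x" for x by (rule s(2))
    show "norm (s i x) \<le> 2 * norm (h x)" for i x using s(3)[of i x] by simp
    show "integrable gauss (\<lambda>x. (2 * norm (h x)) powr p)" using h by (simp add: Lp_space_def powr_mult)
  qed
  then show thesis using that \<open>e > 0\<close> by (auto simp: Lp_poly_closure_def)
qed

end

section \<open>Extending contractive operators on polynomials\<close>

text \<open>
  The image of \<open>h\<close> is characterized by the relation \<open>R\<close>: its distance to \<open>U f\<close> is at most the distance
  from \<open>h\<close> to \<open>f\<close>, for every polynomial \<open>f\<close>. Density makes such an image unique almost everywhere, so
  linearity follows by comparing with polynomials close to the arguments. For existence, take polynomials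
  converging geometrically fast to \<open>h\<close>: their images converge almost everywhere, and Fatou's lemma turns
  the distance estimates for the images into those for the limit.
\<close>

theorem contraction_on_polys_extends:
  fixes U :: "complex poly \<Rightarrow> complex poly"
  assumes p: "p \<ge> 1" and q: "q \<ge> 1"
    and U_add: "\<And>f g. U (f + g) = U f + U g" and U_smult: "\<And>c f. U (smult c f) = smult c (U f)"
    and contr: "\<And>f. Lp_norm q gauss (poly_fun (U f)) \<le> Lp_norm p gauss (poly_fun f)"
  obtains E where "Lp_operator p gauss q gauss E"
    and "\<And>h. h \<in> Lp_space p gauss \<Longrightarrow> Lp_norm q gauss (E h) \<le> Lp_norm p gauss h"
    and "\<And>f. AE x in gauss. E (poly_fun f) x = poly_fun (U f) x"
proof -
  have p0: "p > 0" and q0: "q > 0" using p q by auto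
  have U_diff: "U (f - g) = U f - U g" for f g
    using U_add[of "f - g" g] by simp
  have U_0: "U 0 = 0" using U_smult[of 0 0] by simp
  have poly_p: "poly_fun f \<in> Lp_space p gauss" and poly_q: "poly_fun f \<in> Lp_space q gauss" for f
    using p0 q0 by (auto intro: poly_fun_Lp_gauss)
  have contr_diff: "Lp_norm q gauss (\<lambda>x. poly_fun (U f) x - poly_fun (U g) x) \<le>
      Lp_norm p gauss (\<lambda>x. poly_fun f x - poly_fun g x)" for f g
    using contr[of "f - g"] by (simp add: U_diff)
  define R where "R h v \<longleftrightarrow> v \<in> Lp_space q gauss \<and>
      (\<forall>f. Lp_norm q gauss (\<lambda>x. v x - poly_fun (U f) x) \<le> Lp_norm p gauss (\<lambda>x. h x - poly_fun f x))" for h v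
  have ex: "\<exists>v. R h v" if h: "h \<in> Lp_space p gauss" for h
  proof -
    \<comment> \<open>the geometric rate makes the differences of consecutive images summable\<close>
    have "\<forall>n :: nat. \<exists>f. Lp_norm p gauss (\<lambda>x. h x - poly_fun f x) < (1/2) ^ n"
      using poly_dense_in_Lp_gauss[OF p h] by (metis zero_less_power half_gt_zero zero_less_one)
    then obtain f where f: "\<And>n :: nat. Lp_norm p gauss (\<lambda>x. h x - poly_fun (f n) x) < (1/2) ^ n" by metis
    let ?v = "\<lambda>n. poly_fun (U (f n))"
    have step: "Lp_norm q gauss (\<lambda>x. ?v (Suc n) x - ?v n x) \<le> 2 * (1/2) ^ n" for n
    proof -
      have "Lp_norm q gauss (\<lambda>x. ?v (Suc n) x - ?v n x) \<le> Lp_norm p gauss (\<lambda>x. poly_fun (f (Suc n)) x - poly_fun (f n) x)"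
        by (rule contr_diff)
      also have "\<dots> \<le> Lp_norm p gauss (\<lambda>x. poly_fun (f (Suc n)) x - h x) + Lp_norm p gauss (\<lambda>x. h x - poly_fun (f n) x)"
        by (rule Lp_norm_triangle_diff[OF p poly_p h poly_p])
      also have "Lp_norm p gauss (\<lambda>x. poly_fun (f (Suc n)) x - h x) < (1/2) ^ Suc n"
        using f[of "Suc n"] by (subst Lp_norm_minus_commute)
      also have "(1/2 :: real) ^ Suc n \<le> (1/2) ^ n" by simp
      finally show ?thesis using f[of n] by simp
    qed
    define v where "v x = lim (\<lambda>n. ?v n x)" for x
    have lim: "AE x in gauss. (\<lambda>n. ?v n x) \<longlonglongrightarrow> v x"
      unfolding v_def
      by (rule gauss.AE_convergent_of_Lp_norm_summable[where v = ?v, OF q poly_q step])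
        (intro summable_mult summable_geometric, simp)
    have vm: "v \<in> borel_measurable gauss"
      unfolding v_def using poly_q[THEN Lp_space_measurable] by (rule borel_measurable_lim_metric)
    have bound: "(\<lambda>x. v x - poly_fun (U g) x) \<in> Lp_space q gauss"
      "Lp_norm q gauss (\<lambda>x. v x - poly_fun (U g) x) \<le> Lp_norm p gauss (\<lambda>x. h x - poly_fun g x)" for g
    proof -
      have fatou: "(\<lambda>x. v x - poly_fun (U g) x) \<in> Lp_space q gauss \<and>
        Lp_norm q gauss (\<lambda>x. v x - poly_fun (U g) x) \<le> Lp_norm p gauss (\<lambda>x. h x - poly_fun g x) + e" if e: "e > 0" for e
      proof -
        have bd: "\<forall>\<^sub>F n in sequentially. Lp_norm q gauss (\<lambda>x. ?v n x - poly_fun (U g) x) \<le>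
            Lp_norm p gauss (\<lambda>x. h x - poly_fun g x) + e"
        proof -
          have "(\<lambda>n. (1/2 :: real) ^ n) \<longlonglongrightarrow> 0" by (rule LIMSEQ_realpow_zero) auto
          then have "\<forall>\<^sub>F n in sequentially. (1/2 :: real) ^ n < e" using e by (rule order_tendstoD)
          then show ?thesis
          proof eventually_elim
            case (elim n)
            have "Lp_norm q gauss (\<lambda>x. ?v n x - poly_fun (U g) x) \<le> Lp_norm p gauss (\<lambda>x. poly_fun (f n) x - poly_fun g x)"
              by (rule contr_diff)
            also have "\<dots> \<le> Lp_norm p gauss (\<lambda>x. poly_fun (f n) x - h x) + Lp_norm p gauss (\<lambda>x. h x - poly_fun g x)"
              by (rule Lp_norm_triangle_diff[OF p poly_p h poly_p])
            also have "Lp_norm p gauss (\<lambda>x. poly_fun (f n) x - h x) < (1/2) ^ n"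
              using f[of n] by (subst Lp_norm_minus_commute)
            finally show ?case using elim by linarith
          qed
        qed
        have lim': "AE x in gauss. (\<lambda>n. ?v n x - poly_fun (U g) x) \<longlonglongrightarrow> v x - poly_fun (U g) x"
          by (rule AE_mp[OF lim], intro AE_I2 impI tendsto_diff tendsto_const)
        have m: "(\<lambda>x. v x - poly_fun (U g) x) \<in> borel_measurable gauss"
          by (rule borel_measurable_diff[OF vm Lp_space_measurable[OF poly_q]])
        from Lp_norm_le_of_AE_limit[OF q0 Lp_space_diff[OF q poly_q poly_q] m lim' bd] show ?thesis by simp
      qed
      show "(\<lambda>x. v x - poly_fun (U g) x) \<in> Lp_space q gauss" using fatou[of 1] by simp
      show "Lp_norm q gauss (\<lambda>x. v x - poly_fun (U g) x) \<le> Lp_norm p gauss (\<lambda>x. h x - poly_fun g x)"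
        by (rule le_limit_at_right_zero[of "\<lambda>e. Lp_norm p gauss (\<lambda>x. h x - poly_fun g x) + e"])
          (use fatou in \<open>auto intro!: tendsto_eq_intros\<close>)
    qed
    have "v \<in> Lp_space q gauss" using bound(1)[of 0] by (simp add: U_0)
    then show ?thesis using bound(2) unfolding R_def by blast
  qed
  define E where "E h = (SOME v. R h v)" for h
  have E: "R h (E h)" if "h \<in> Lp_space p gauss" for h
    unfolding E_def using ex[OF that] by (rule someI_ex)
  have Eq: "E h \<in> Lp_space q gauss" and Ef: "Lp_norm q gauss (\<lambda>x. E h x - poly_fun (U f) x) \<le> Lp_norm p gauss (\<lambda>x. h x - poly_fun f x)"
    if "h \<in> Lp_space p gauss" for h f
    using E[OF that] by (auto simp: R_def)
  have E_poly: "AE x in gauss. E (poly_fun f) x = poly_fun (U f) x" for f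
  proof (rule AE_eq_of_Lp_norm_diff_small[OF q Eq[OF poly_p] poly_q])
    show "Lp_norm q gauss (\<lambda>x. E (poly_fun f) x - poly_fun (U f) x) \<le> 0 * e" for e
      using Ef[OF poly_p, of f f] p0 by (simp add: Lp_norm_def)
  qed
  have E_bound: "Lp_norm q gauss (E h) \<le> Lp_norm p gauss h" if "h \<in> Lp_space p gauss" for h
    using Ef[OF that, of 0] by (simp add: U_0)
  have E_cong: "E g = E h"
    if "g \<in> Lp_space p gauss" "h \<in> Lp_space p gauss" "AE x in gauss. g x = h x" for g h
  proof -
    have "Lp_norm p gauss (\<lambda>x. g x - poly_fun f x) = Lp_norm p gauss (\<lambda>x. h x - poly_fun f x)" for f
      using that(3) by (intro Lp_norm_cong_AE Lp_space_measurable[of _ p] Lp_space_diff[OF p] that poly_p) auto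
    then show ?thesis by (simp add: E_def R_def)
  qed
  have E_add: "AE x in gauss. E (\<lambda>y. g y + h y) x = E g x + E h x"
    if g: "g \<in> Lp_space p gauss" and h: "h \<in> Lp_space p gauss" for g h
  proof (rule AE_eq_of_Lp_norm_diff_small[OF q Eq[OF Lp_space_add[OF p g h]] Lp_space_add[OF q Eq[OF g] Eq[OF h]]])
    fix e :: real assume e: "e > 0"
    obtain f1 where f1: "Lp_norm p gauss (\<lambda>x. g x - poly_fun f1 x) < e" using poly_dense_in_Lp_gauss[OF p g e] .
    obtain f2 where f2: "Lp_norm p gauss (\<lambda>x. h x - poly_fun f2 x) < e" using poly_dense_in_Lp_gauss[OF p h e] .
    note gf = Lp_space_diff[OF p g poly_p[of f1]] and hf = Lp_space_diff[OF p h poly_p[of f2]]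
    note Egf = Lp_space_diff[OF q poly_q[of "U f1"] Eq[OF g]] and Ehf = Lp_space_diff[OF q poly_q[of "U f2"] Eq[OF h]]
    have "Lp_norm q gauss (\<lambda>x. E (\<lambda>y. g y + h y) x - (E g x + E h x)) \<le>
        Lp_norm q gauss (\<lambda>x. E (\<lambda>y. g y + h y) x - poly_fun (U (f1 + f2)) x) +
        Lp_norm q gauss (\<lambda>x. poly_fun (U (f1 + f2)) x - (E g x + E h x))"
      by (rule Lp_norm_triangle_diff[OF q Eq[OF Lp_space_add[OF p g h]] poly_q Lp_space_add[OF q Eq[OF g] Eq[OF h]]])
    also have "(\<lambda>x. poly_fun (U (f1 + f2)) x - (E g x + E h x)) =
        (\<lambda>x. (poly_fun (U f1) x - E g x) + (poly_fun (U f2) x - E h x))"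
      by (simp add: U_add algebra_simps)
    also have "Lp_norm q gauss \<dots> \<le> Lp_norm q gauss (\<lambda>x. poly_fun (U f1) x - E g x) + Lp_norm q gauss (\<lambda>x. poly_fun (U f2) x - E h x)"
      by (rule Lp_norm_triangle[OF q Egf Ehf])
    also have "Lp_norm q gauss (\<lambda>x. poly_fun (U f1) x - E g x) \<le> Lp_norm p gauss (\<lambda>x. g x - poly_fun f1 x)"
      by (subst Lp_norm_minus_commute) (rule Ef[OF g])
    also have "Lp_norm q gauss (\<lambda>x. poly_fun (U f2) x - E h x) \<le> Lp_norm p gauss (\<lambda>x. h x - poly_fun f2 x)"
      by (subst Lp_norm_minus_commute) (rule Ef[OF h])
    also have "Lp_norm q gauss (\<lambda>x. E (\<lambda>y. g y + h y) x - poly_fun (U (f1 + f2)) x) \<le>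
        Lp_norm p gauss (\<lambda>x. (g x + h x) - poly_fun (f1 + f2) x)"
      by (rule Ef[OF Lp_space_add[OF p g h]])
    also have "(\<lambda>x. (g x + h x) - poly_fun (f1 + f2) x) = (\<lambda>x. (g x - poly_fun f1 x) + (h x - poly_fun f2 x))"
      by (simp add: algebra_simps)
    also have "Lp_norm p gauss \<dots> \<le> Lp_norm p gauss (\<lambda>x. g x - poly_fun f1 x) + Lp_norm p gauss (\<lambda>x. h x - poly_fun f2 x)"
      by (rule Lp_norm_triangle[OF p gf hf])
    finally show "Lp_norm q gauss (\<lambda>x. E (\<lambda>y. g y + h y) x - (E g x + E h x)) \<le> 4 * e"
      using f1 f2 by linarith
  qed
  have E_scale: "AE x in gauss. E (\<lambda>y. c * h y) x = c * E h x" if h: "h \<in> Lp_space p gauss" for c h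
  proof (rule AE_eq_of_Lp_norm_diff_small[OF q Eq[OF Lp_space_scale[OF h]] Lp_space_scale[OF Eq[OF h]]])
    fix e :: real assume e: "e > 0"
    obtain f where f: "Lp_norm p gauss (\<lambda>x. h x - poly_fun f x) < e" using poly_dense_in_Lp_gauss[OF p h e] .
    have "Lp_norm q gauss (\<lambda>x. E (\<lambda>y. c * h y) x - c * E h x) \<le>
        Lp_norm q gauss (\<lambda>x. E (\<lambda>y. c * h y) x - poly_fun (U (smult c f)) x) +
        Lp_norm q gauss (\<lambda>x. poly_fun (U (smult c f)) x - c * E h x)"
      by (rule Lp_norm_triangle_diff[OF q Eq[OF Lp_space_scale[OF h]] poly_q Lp_space_scale[OF Eq[OF h]]])
    also have "Lp_norm q gauss (\<lambda>x. E (\<lambda>y. c * h y) x - poly_fun (U (smult c f)) x) \<le>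
        Lp_norm p gauss (\<lambda>x. c * h x - poly_fun (smult c f) x)"
      by (rule Ef[OF Lp_space_scale[OF h]])
    also have "\<dots> = norm c * Lp_norm p gauss (\<lambda>x. h x - poly_fun f x)"
      using p0 by (subst Lp_norm_scale[symmetric]) (auto simp: right_diff_distrib)
    also have "Lp_norm q gauss (\<lambda>x. poly_fun (U (smult c f)) x - c * E h x) =
        norm c * Lp_norm q gauss (\<lambda>x. poly_fun (U f) x - E h x)"
      using q0 by (subst Lp_norm_scale[symmetric]) (auto simp: U_smult right_diff_distrib)
    also have "Lp_norm q gauss (\<lambda>x. poly_fun (U f) x - E h x) \<le> Lp_norm p gauss (\<lambda>x. h x - poly_fun f x)"
      by (subst Lp_norm_minus_commute) (rule Ef[OF h])
    finally have "Lp_norm q gauss (\<lambda>x. E (\<lambda>y. c * h y) x - c * E h x) \<le>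
        2 * norm c * Lp_norm p gauss (\<lambda>x. h x - poly_fun f x)" by (simp add: mult_left_mono)
    also have "\<dots> \<le> 2 * norm c * e" using f by (intro mult_left_mono) auto
    finally show "Lp_norm q gauss (\<lambda>x. E (\<lambda>y. c * h y) x - c * E h x) \<le> 2 * norm c * e" .
  qed
  have "Lp_operator p gauss q gauss E"
    unfolding Lp_operator_def
  proof (intro conjI ballI allI impI)
    fix g h assume gh: "g \<in> Lp_space p gauss" "h \<in> Lp_space p gauss" "AE x in gauss. g x = h x"
    show "AE x in gauss. E g x = E h x" unfolding E_cong[OF gh] by simp
  qed (rule Eq E_add E_scale; assumption)+
  then show thesis using E_bound E_poly that by blast
qed

section \<open>Tensor powers of contractions\<close>

lemma Lp_space_tensor:
  fixes \<phi> :: "'k \<Rightarrow> 'b \<Rightarrow> complex" and e :: "'j \<Rightarrow> nat \<Rightarrow> 'k"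
  assumes "prob_space N" and p: "p \<ge> 1" and \<phi>: "\<And>k. \<phi> k \<in> Lp_space p N"
  shows "(\<lambda>y. \<Sum>j\<in>J. c j * (\<Prod>n<m. \<phi> (e j n) (y n))) \<in> Lp_space p (PiM {..<m} (\<lambda>_. N))"
proof (intro Lp_space_sum p Lp_space_scale)
  interpret N: prob_space N by fact
  interpret P: product_sigma_finite "\<lambda>_ :: nat. N" by unfold_locales
  fix j
  have [measurable]: "\<phi> k \<in> borel_measurable N" for k using \<phi>[of k] by auto
  have "integrable (PiM {..<m} (\<lambda>_. N)) (\<lambda>y. \<Prod>n<m. norm (\<phi> (e j n) (y n)) powr p)"
    using \<phi> by (intro P.product_integrable_prod) (auto simp: Lp_space_def)
  then show "(\<lambda>y. \<Prod>n<m. \<phi> (e j n) (y n)) \<in> Lp_space p (PiM {..<m} (\<lambda>_. N))"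
    by (auto simp: Lp_space_def prod_norm[symmetric] prod_powr_distrib)
qed

text \<open>
  Elements of the tensor power are finite sums of products of the \<open>\<phi> k\<close>, and the operator replaces each
  \<open>\<phi> k\<close> by \<open>\<kappa> k\<close>. Induction on the number of variables: for a fixed last variable the induction
  hypothesis applies with the value of \<open>\<kappa>\<close> absorbed into the coefficients. Minkowski's integral
  inequality with exponent \<open>q / p\<close> then exchanges the two norms, and the hypothesis for one variable is
  applied inside. The coefficients are arbitrary in the statement because they change in this step.
\<close>

theorem tensor_power_contraction:
  fixes \<phi> :: "'k \<Rightarrow> 'b \<Rightarrow> complex" and \<kappa> :: "'k \<Rightarrow> 'a \<Rightarrow> complex" and e :: "'j \<Rightarrow> nat \<Rightarrow> 'k"
  assumes M: "prob_space M" and N: "prob_space N" and p: "p \<ge> 1" "p \<le> q"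
    and \<phi>: "\<And>k. \<phi> k \<in> Lp_space p N" and \<kappa>: "\<And>k. \<kappa> k \<in> borel_measurable M"
    and one: "\<And>a i. (\<integral>\<^sup>+t. ennreal (norm (\<Sum>j\<in>J. a j * \<kappa> (e j i) t) powr q) \<partial>M) \<le>
        ennreal ((\<integral>s. norm (\<Sum>j\<in>J. a j * \<phi> (e j i) s) powr p \<partial>N) powr (q / p))"
  shows "(\<integral>\<^sup>+x. ennreal (norm (\<Sum>j\<in>J. c j * (\<Prod>n<m. \<kappa> (e j n) (x n))) powr q) \<partial>PiM {..<m} (\<lambda>_. M)) \<le>
        ennreal ((\<integral>y. norm (\<Sum>j\<in>J. c j * (\<Prod>n<m. \<phi> (e j n) (y n))) powr p \<partial>PiM {..<m} (\<lambda>_. N)) powr (q / p))"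
proof (induction m arbitrary: c)
  case 0
  interpret PM: prob_space "PiM {} (\<lambda>_ :: nat. M)" by (rule prob_space_PiM) (use M in auto)
  interpret PN: prob_space "PiM {} (\<lambda>_ :: nat. N)" by (rule prob_space_PiM) (use N in auto)
  show ?case using p by (simp add: PM.emeasure_space_1 PN.prob_space powr_powr)
next
  case (Suc m)
  interpret M: prob_space M by fact
  interpret N: prob_space N by fact
  interpret PM: product_sigma_finite "\<lambda>_ :: nat. M" by unfold_locales
  interpret PN: product_sigma_finite "\<lambda>_ :: nat. N" by unfold_locales
  have prN: "prob_space (PiM {..<m} (\<lambda>_. N))" by (rule prob_space_PiM) (use N in auto)
  have [measurable]: "\<phi> k \<in> borel_measurable N" "\<kappa> k \<in> borel_measurable M" for k
    using \<phi>[of k] \<kappa>[of k] by auto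
  have Suc_eq: "{..<Suc m} = insert m {..<m}" by auto
  let ?PM = "PiM {..<m} (\<lambda>_. M)" and ?PN = "PiM {..<m} (\<lambda>_. N)"
  define u where "u t y = norm (\<Sum>j\<in>J. (c j * \<kappa> (e j m) t) * (\<Prod>n<m. \<phi> (e j n) (y n))) powr p" for t y
  define b where "b y = (\<integral>s. norm (\<Sum>j\<in>J. (c j * (\<Prod>n<m. \<phi> (e j n) (y n))) * \<phi> (e j m) s) powr p \<partial>N)" for y
  have upd_prod: "(\<Prod>n<Suc m. f n ((x(m := t)) n)) = f m t * (\<Prod>n<m. f n (x n))"
    for f :: "nat \<Rightarrow> 'c \<Rightarrow> complex" and x t
    by (simp add: mult.commute)
  have b_nn: "ennreal (b y) = (\<integral>\<^sup>+s. ennreal (norm (\<Sum>j\<in>J. (c j * (\<Prod>n<m. \<phi> (e j n) (y n))) * \<phi> (e j m) s) powr p) \<partial>N)" for y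
  proof -
    have "(\<lambda>s. \<Sum>j\<in>J. (c j * (\<Prod>n<m. \<phi> (e j n) (y n))) * \<phi> (e j m) s) \<in> Lp_space p N"
      by (intro Lp_space_sum p(1) Lp_space_scale \<phi>)
    then show ?thesis unfolding b_def by (intro nn_integral_eq_integral[symmetric]) (auto simp: Lp_space_def)
  qed
  let ?F = "\<lambda>y. norm (\<Sum>j\<in>J. c j * (\<Prod>n<Suc m. \<phi> (e j n) (y n))) powr p"
  have F_int: "integrable (PiM {..<Suc m} (\<lambda>_. N)) ?F"
    using Lp_space_tensor[OF N p(1) \<phi>, where J = J and c = c and m = "Suc m" and e = e] by (simp add: Lp_space_def)
  have b_meas [measurable]: "b \<in> borel_measurable ?PN"
    unfolding b_def by (intro N.borel_measurable_lebesgue_integral) measurable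
  have b_int: "integrable ?PN b" and b_eq: "(\<integral>y. b y \<partial>?PN) = (\<integral>y. ?F y \<partial>PiM {..<Suc m} (\<lambda>_. N))"
  proof -
    have "(\<integral>\<^sup>+y. ennreal (b y) \<partial>?PN) = (\<integral>\<^sup>+y. ?F y \<partial>PiM {..<Suc m} (\<lambda>_. N))"
      unfolding Suc_eq using F_int
      by (subst PN.product_nn_integral_insert) (auto simp: b_nn upd_prod Suc_eq mult_ac)
    also have "\<dots> = ennreal (\<integral>y. ?F y \<partial>PiM {..<Suc m} (\<lambda>_. N))"
      using F_int by (intro nn_integral_eq_integral) auto
    finally have *: "(\<integral>\<^sup>+y. ennreal (b y) \<partial>?PN) = ennreal (\<integral>y. ?F y \<partial>PiM {..<Suc m} (\<lambda>_. N))" .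
    have b0: "b y \<ge> 0" for y by (simp add: b_def)
    show "integrable ?PN b" using * b0 by (intro integrableI_bounded) auto
    show "(\<integral>y. b y \<partial>?PN) = (\<integral>y. ?F y \<partial>PiM {..<Suc m} (\<lambda>_. N))"
      using * b0 by (intro integral_eq_nn_integral[THEN trans]) (auto intro!: AE_I2)
  qed
  have "(\<integral>\<^sup>+x. ennreal (norm (\<Sum>j\<in>J. c j * (\<Prod>n<Suc m. \<kappa> (e j n) (x n))) powr q) \<partial>PiM {..<Suc m} (\<lambda>_. M)) =
      (\<integral>\<^sup>+t. (\<integral>\<^sup>+x. ennreal (norm (\<Sum>j\<in>J. (c j * \<kappa> (e j m) t) * (\<Prod>n<m. \<kappa> (e j n) (x n))) powr q) \<partial>?PM) \<partial>M)"
    unfolding Suc_eq by (subst PM.product_nn_integral_insert_rev) (auto simp: upd_prod Suc_eq[symmetric] mult_ac)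
  also have "\<dots> \<le> (\<integral>\<^sup>+t. ennreal ((\<integral>y. u t y \<partial>?PN) powr (q / p)) \<partial>M)"
    unfolding u_def by (intro nn_integral_mono Suc.IH)
  also have "\<dots> \<le> ennreal ((\<integral>y. b y \<partial>?PN) powr (q / p))"
  proof (rule Minkowski_integral_inequality[OF M prN])
    show "q / p \<ge> 1" using p by simp
    show "case_prod u \<in> borel_measurable (M \<Otimes>\<^sub>M ?PN)" unfolding u_def by measurable
    show "(\<integral>\<^sup>+t. ennreal (u t y powr (q / p)) \<partial>M) \<le> ennreal (b y powr (q / p))" for y
      using one[of "\<lambda>j. c j * (\<Prod>n<m. \<phi> (e j n) (y n))" m] p by (simp add: u_def b_def powr_powr mult_ac)
  qed (auto simp: u_def b_def intro: b_int[unfolded b_def])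
  finally show ?case unfolding b_eq .
qed

section \<open>The tensor power operators\<close>

text \<open>
  Links the coefficients on which the tensor power operator acts to the values of the function \<open>f\<^sub>+\<close>.
  Variables of index \<open>N\<close> and above are evaluated at \<open>1\<close>.
\<close>

definition mpoly_eval :: "nat \<Rightarrow> (nat \<Rightarrow> complex) \<Rightarrow> mpoly_complex \<Rightarrow> complex" where
  "mpoly_eval N x P = (\<Sum>j\<in>Poly_Mapping.keys P. Poly_Mapping.lookup P j * (\<Prod>n<N. x n ^ Poly_Mapping.lookup j n))"

lemma mpoly_eval_zero [simp]: "mpoly_eval N x 0 = 0"
  by (simp add: mpoly_eval_def)

lemma mpoly_eval_add: "mpoly_eval N x (P + Q) = mpoly_eval N x P + mpoly_eval N x Q"
  unfolding mpoly_eval_def by (rule setsum_keys_plus_distrib) (auto simp: distrib_right)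

lemma mpoly_eval_sum: "mpoly_eval N x (\<Sum>i\<in>I. P i) = (\<Sum>i\<in>I. mpoly_eval N x (P i))"
  by (induction I rule: infinite_finite_induct) (auto simp: mpoly_eval_add)

lemma mpoly_eval_single:
  "mpoly_eval N x (Poly_Mapping.single j a) = a * (\<Prod>n<N. x n ^ Poly_Mapping.lookup j n)"
  by (cases "a = 0") (auto simp: mpoly_eval_def)

lemma mpoly_sum_of_terms:
  "P = (\<Sum>j\<in>Poly_Mapping.keys P. Poly_Mapping.single j (Poly_Mapping.lookup P j))"
  by (rule poly_mapping_eqI) (auto simp: lookup_sum lookup_single when_def in_keys_iff)

lemma mpoly_eval_mult: "mpoly_eval N x (P * Q) = mpoly_eval N x P * mpoly_eval N x Q"
proof -
  let ?s = "\<lambda>P j. Poly_Mapping.single j (Poly_Mapping.lookup P j)"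
  have "P * Q = (\<Sum>i\<in>Poly_Mapping.keys P. ?s P i) * (\<Sum>j\<in>Poly_Mapping.keys Q. ?s Q j)"
    by (intro arg_cong2[of _ _ _ _ "(*)"] mpoly_sum_of_terms)
  also have "\<dots> = (\<Sum>i\<in>Poly_Mapping.keys P. \<Sum>j\<in>Poly_Mapping.keys Q. ?s P i * ?s Q j)"
    by (rule sum_product)
  finally have "mpoly_eval N x (P * Q) = (\<Sum>i\<in>Poly_Mapping.keys P. \<Sum>j\<in>Poly_Mapping.keys Q. mpoly_eval N x (?s P i * ?s Q j))"
    by (simp only: mpoly_eval_sum)
  also have "\<dots> = (\<Sum>i\<in>Poly_Mapping.keys P. \<Sum>j\<in>Poly_Mapping.keys Q.
      (Poly_Mapping.lookup P i * (\<Prod>n<N. x n ^ Poly_Mapping.lookup i n)) *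
      (Poly_Mapping.lookup Q j * (\<Prod>n<N. x n ^ Poly_Mapping.lookup j n)))"
    by (simp add: mult_single mpoly_eval_single lookup_add power_add prod.distrib mult_ac)
  also have "\<dots> = mpoly_eval N x P * mpoly_eval N x Q"
    unfolding mpoly_eval_def by (rule sum_product[symmetric])
  finally show ?thesis .
qed

lemma mpoly_eval_poly_plus: "mpoly_eval N x (poly_plus N f) = poly f (\<Sum>n<N. x n)"
proof -
  have var: "mpoly_eval N x (mvar n) = x n" if "n < N" for n
  proof -
    have "(\<Prod>m<N. x m ^ (Poly_Mapping.lookup (Poly_Mapping.single n 1) m)) = (\<Prod>m<N. if m = n then x m else 1)"
      by (intro prod.cong) (auto simp: lookup_single when_def)
    then show ?thesis using that by (simp add: mvar_def mpoly_eval_single)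
  qed
  have const: "mpoly_eval N x (mconst a) = a" for a by (simp add: mconst_def mpoly_eval_single)
  have s: "mpoly_eval N x (\<Sum>n<N. mvar n) = (\<Sum>n<N. x n)" by (simp add: mpoly_eval_sum var)
  have "mpoly_eval N x (poly (map_poly mconst f) (\<Sum>n<N. mvar n)) = poly f (\<Sum>n<N. x n)"
    by (induction f) (auto simp: map_poly_pCons mconst_def[of 0] mpoly_eval_add mpoly_eval_mult const s)
  then show ?thesis by (simp add: poly_plus_def)
qed

lemma poly_Lp_operator_sum:
  assumes K: "poly_Lp_operator q M K" and fin: "finite J"
  shows "AE x in M. K (\<Sum>j\<in>J. smult (a j) (g j)) x = (\<Sum>j\<in>J. a j * K (g j) x)"
  using fin
proof (induction J)
  case empty
  have "AE x in M. K (smult 0 0) x = 0 * K 0 x" using K unfolding poly_Lp_operator_def by blast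
  then show ?case by simp
next
  case (insert j J)
  have "AE x in M. K (smult (a j) (g j) + (\<Sum>j\<in>J. smult (a j) (g j))) x =
      K (smult (a j) (g j)) x + K (\<Sum>j\<in>J. smult (a j) (g j)) x"
    "AE x in M. K (smult (a j) (g j)) x = a j * K (g j) x"
    using K unfolding poly_Lp_operator_def by blast+
  with insert.IH show ?case
    by (rule AE_mp[OF AE_conjI[OF _ AE_conjI]], intro AE_I2) (use insert.hyps in simp)
qed

text \<open>
  The power of \<open>N\<close> in the definition of the tensor power operator is what the substitution of
  \<open>y / sqrt N\<close> for \<open>y\<close> produces in a monomial.
\<close>

lemma rescaled_monomial:
  assumes "N > 0"
  shows "complex_of_real (real N powr (- real (\<Sum>n<N. k n) / 2)) * (\<Prod>n<N. complex_of_real (y n) ^ k n) =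
    (\<Prod>n<N. complex_of_real (y n / sqrt N) ^ k n)"
proof -
  have "real N powr (- real (\<Sum>n<N. k n) / 2) = (1 / sqrt N) powr real (\<Sum>n<N. k n)"
    using assms by (simp add: powr_half_sqrt[symmetric] powr_divide powr_powr powr_minus_divide)
  also have "\<dots> = (\<Prod>n<N. (1 / sqrt N) ^ k n)"
    using assms by (subst powr_realpow) (auto simp: power_sum)
  finally show ?thesis
    by (simp add: prod.distrib[symmetric] power_mult_distrib[symmetric])
qed

lemma K_tensor_measurable:
  assumes "sets M = sets borel" and K: "poly_Lp_operator q M K"
  shows "K_tensor K N P \<in> borel_measurable (PiM {..<N} (\<lambda>_. borel))"
proof -
  have [measurable]: "K f \<in> borel_measurable borel" for f
    using K measurable_cong_sets[OF assms(1) refl] by (auto simp: poly_Lp_operator_def Lp_space_def)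
  show ?thesis unfolding K_tensor_def by measurable
qed

lemma scaling_measurable:
  assumes "sets M = sets (borel :: real measure)"
  shows "(\<lambda>x. \<lambda>n\<in>{..<N}. x n / sqrt (real N)) \<in> measurable (PiM {..<N} (\<lambda>_. M)) (PiM {..<N} (\<lambda>_. borel))"
proof -
  note [measurable_cong] = assms
  show ?thesis by measurable
qed

context
  fixes \<alpha> \<beta> :: "real measure" and K :: "complex poly \<Rightarrow> real \<Rightarrow> complex" and p q :: real
  assumes alpha: "standardized \<alpha>" and beta: "standardized \<beta>"
    and K: "poly_Lp_operator q \<alpha> K" and p: "1 \<le> p" "p \<le> q"
    and bound: "\<And>f. Lp_norm q \<alpha> (K f) \<le> Lp_norm p \<beta> (poly_fun f)"
begin

interpretation A: real_distribution \<alpha> by (rule standardized_real_distribution[OF alpha])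

interpretation B: real_distribution \<beta> by (rule standardized_real_distribution[OF beta])

text \<open>
  The one-variable hypothesis of the tensor power theorem: by linearity the combination is, almost
  everywhere, the image under \<open>K\<close> of a single polynomial.
\<close>

lemma monomial_combination_bound:
  fixes a :: "'j \<Rightarrow> complex" and k :: "'j \<Rightarrow> nat"
  assumes "finite J"
  shows "(\<integral>\<^sup>+t. ennreal (norm (\<Sum>j\<in>J. a j * K (monom 1 (k j)) t) powr q) \<partial>\<alpha>) \<le>
    ennreal ((\<integral>s. norm (\<Sum>j\<in>J. a j * complex_of_real s ^ k j) powr p \<partial>\<beta>) powr (q / p))"
proof -
  define g where "g = (\<Sum>j\<in>J. smult (a j) (monom 1 (k j)))"
  have g: "poly_fun g s = (\<Sum>j\<in>J. a j * complex_of_real s ^ k j)" for s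
    by (simp add: g_def poly_sum poly_monom)
  have Kg: "K g \<in> Lp_space q \<alpha>" using K by (simp add: poly_Lp_operator_def)
  have "(\<integral>\<^sup>+t. ennreal (norm (\<Sum>j\<in>J. a j * K (monom 1 (k j)) t) powr q) \<partial>\<alpha>) =
      (\<integral>\<^sup>+t. ennreal (norm (K g t) powr q) \<partial>\<alpha>)"
    using poly_Lp_operator_sum[OF K assms, of a "\<lambda>j. monom 1 (k j)"]
    unfolding g_def by (intro nn_integral_cong_AE) auto
  also have "\<dots> = ennreal (\<integral>t. norm (K g t) powr q \<partial>\<alpha>)"
    using Kg by (intro nn_integral_eq_integral) (auto simp: Lp_space_def)
  also have "\<dots> = ennreal (Lp_norm q \<alpha> (K g) powr q)" using p by (simp add: Lp_norm_powr)
  also have "\<dots> \<le> ennreal (Lp_norm p \<beta> (poly_fun g) powr q)"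
    using bound[of g] p by (intro ennreal_leI powr_mono2) auto
  also have "Lp_norm p \<beta> (poly_fun g) powr q = (\<integral>s. norm (poly_fun g s) powr p \<partial>\<beta>) powr (q / p)"
    using p by (simp add: Lp_norm_def powr_powr)
  finally show ?thesis by (simp add: g)
qed

text \<open>
  Undoing the rescaling on both sides, this is the tensor power theorem for the monomials and their
  images. The right-hand side depends on \<open>\<beta>\<close> only through the law of the normalized sum.
\<close>

theorem K_tensor_poly_plus:
  assumes N: "N > 0"
  shows K_tensor_Lp_space: "K_tensor K N (poly_plus N f) \<in> Lp_space q (scaled_product \<alpha> N)"
    and K_tensor_Lp_norm: "Lp_norm q (scaled_product \<alpha> N) (K_tensor K N (poly_plus N f)) \<le>
      Lp_norm p (normalized_sum_law \<beta> N) (poly_fun f)"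
proof -
  let ?P = "poly_plus N f" and ?S = "scaled_product \<alpha> N"
  let ?lk = "Poly_Mapping.lookup :: (nat \<Rightarrow>\<^sub>0 nat) \<Rightarrow> nat \<Rightarrow> nat"
  define c where "c j = Poly_Mapping.lookup ?P j * complex_of_real (real N powr (- real (\<Sum>n<N. ?lk j n) / 2))" for j
  define I where "I = (\<integral>s. norm (poly_fun f s) powr p \<partial>normalized_sum_law \<beta> N)"
  have meas: "K_tensor K N ?P \<in> borel_measurable ?S"
    using K_tensor_measurable[OF A.events_eq_borel K] by (simp add: scaled_product_def)
  have K_eq: "K_tensor K N ?P (\<lambda>n\<in>{..<N}. y n / sqrt N) =
      (\<Sum>j\<in>Poly_Mapping.keys ?P. c j * (\<Prod>n<N. K (monom 1 (?lk j n)) (y n)))" for y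
    unfolding K_tensor_def c_def using N by (intro sum.cong refl arg_cong2[of _ _ _ _ "(*)"] prod.cong) auto
  have f_eq: "(\<Sum>j\<in>Poly_Mapping.keys ?P. c j * (\<Prod>n<N. complex_of_real (y n) ^ ?lk j n)) =
      poly_fun f ((\<Sum>n<N. y n) / sqrt N)" for y
  proof -
    have "(\<Sum>j\<in>Poly_Mapping.keys ?P. c j * (\<Prod>n<N. complex_of_real (y n) ^ ?lk j n)) =
        mpoly_eval N (\<lambda>n. complex_of_real (y n / sqrt N)) ?P"
      unfolding c_def mpoly_eval_def mult.assoc rescaled_monomial[OF N] ..
    then show ?thesis by (simp add: mpoly_eval_poly_plus sum_divide_distrib)
  qed
  have "(\<integral>\<^sup>+x. ennreal (norm (K_tensor K N ?P x) powr q) \<partial>?S) =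
      (\<integral>\<^sup>+y. ennreal (norm (K_tensor K N ?P (\<lambda>n\<in>{..<N}. y n / sqrt N)) powr q) \<partial>PiM {..<N} (\<lambda>_. \<alpha>))"
    unfolding scaled_product_def
    using K_tensor_measurable[OF A.events_eq_borel K] by (intro nn_integral_distr scaling_measurable) auto
  also have "\<dots> \<le> ennreal ((\<integral>y. norm (\<Sum>j\<in>Poly_Mapping.keys ?P. c j * (\<Prod>n<N. complex_of_real (y n) ^ ?lk j n)) powr p
      \<partial>PiM {..<N} (\<lambda>_. \<beta>)) powr (q / p))"
    unfolding K_eq
  proof (rule tensor_power_contraction[where \<phi> = "\<lambda>k s. complex_of_real s ^ k" and e = ?lk and \<kappa> = "\<lambda>k. K (monom 1 k)"])
    show "K (monom 1 k) \<in> borel_measurable \<alpha>" for k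
      using K by (auto simp: poly_Lp_operator_def Lp_space_def)
    show "(\<lambda>s. complex_of_real s ^ k) \<in> Lp_space p \<beta>" for k
    proof -
      have "poly_growth (\<lambda>s. norm (poly_fun (monom 1 k) s) powr p)"
        using p by (intro poly_growth_powr poly_growth_poly_fun) auto
      then have "integrable \<beta> (\<lambda>s. norm (poly_fun (monom 1 k) s) powr p)"
        using p by (intro integrable_poly_growth_standardized beta continuous_on_norm_powr continuous_poly_fun) auto
      then show ?thesis by (simp add: Lp_space_def poly_monom)
    qed
  qed (use A.prob_space_axioms B.prob_space_axioms p in \<open>auto intro: monomial_combination_bound[OF finite_keys]\<close>)
  also have "(\<integral>y. norm (\<Sum>j\<in>Poly_Mapping.keys ?P. c j * (\<Prod>n<N. complex_of_real (y n) ^ ?lk j n)) powr p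
      \<partial>PiM {..<N} (\<lambda>_. \<beta>)) = I"
    unfolding f_eq I_def normalized_sum_law_def
    using continuous_measurable_borel[OF refl continuous_poly_fun[of f]] by (subst integral_distr) auto
  finally have nn: "(\<integral>\<^sup>+x. ennreal (norm (K_tensor K N ?P x) powr q) \<partial>?S) \<le> ennreal (I powr (q / p))" .
  then have int: "integrable ?S (\<lambda>x. norm (K_tensor K N ?P x) powr q)"
    using meas by (intro integrableI_bounded) (auto simp: le_less_trans)
  then show "K_tensor K N ?P \<in> Lp_space q ?S" using meas by (simp add: Lp_space_def)
  have "ennreal (\<integral>x. norm (K_tensor K N ?P x) powr q \<partial>?S) \<le> ennreal (I powr (q / p))"
    using nn int by (subst (asm) nn_integral_eq_integral) auto
  then have "(\<integral>x. norm (K_tensor K N ?P x) powr q \<partial>?S) \<le> I powr (q / p)"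
    by (subst (asm) ennreal_le_iff) auto
  also have "\<dots> = Lp_norm p (normalized_sum_law \<beta> N) (poly_fun f) powr q"
    using p by (simp add: Lp_norm_def I_def powr_powr)
  finally show "Lp_norm q ?S (K_tensor K N ?P) \<le> Lp_norm p (normalized_sum_law \<beta> N) (poly_fun f)"
    using p by (subst Lp_norm_le_iff) auto
qed

end

text \<open>
  Functions of the sum of all coordinates only depend on the law of the normalized sum.
\<close>

lemma integral_fun_of_sum_scaled_product:
  fixes g :: "real \<Rightarrow> 'a :: {banach, second_countable_topology}"
  assumes "standardized M" and [measurable]: "g \<in> borel_measurable borel"
  shows "(\<integral>x. g (\<Sum>n<N. x n) \<partial>scaled_product M N) = (\<integral>x. g x \<partial>normalized_sum_law M N)"
    and "integrable (scaled_product M N) (\<lambda>x. g (\<Sum>n<N. x n)) \<longleftrightarrow> integrable (normalized_sum_law M N) g"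
proof -
  interpret real_distribution M by (rule standardized_real_distribution) fact
  have eq: "(\<Sum>n<N. (\<lambda>n\<in>{..<N}. x n / sqrt (real N)) n) = (\<Sum>n<N. x n) / sqrt N" for x :: "nat \<Rightarrow> real"
    by (simp add: sum_divide_distrib)
  have scale_meas: "(\<lambda>x. \<lambda>n\<in>{..<N}. x n / sqrt (real N)) \<in> measurable (PiM {..<N} (\<lambda>_. M)) (PiM {..<N} (\<lambda>_. borel))"
    by (rule scaling_measurable) simp
  have sum_meas: "(\<lambda>x. (\<Sum>n<N. x n) / sqrt N) \<in> borel_measurable (PiM {..<N} (\<lambda>_. M))"
    by measurable
  have g_meas: "(\<lambda>x. g (\<Sum>n<N. x n)) \<in> borel_measurable (PiM {..<N} (\<lambda>_. borel))"
    by (rule measurable_compose[OF _ assms(2)]) measurable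
  show "(\<integral>x. g (\<Sum>n<N. x n) \<partial>scaled_product M N) = (\<integral>x. g x \<partial>normalized_sum_law M N)"
    unfolding scaled_product_def normalized_sum_law_def
      integral_distr[OF scale_meas g_meas] integral_distr[OF sum_meas assms(2)] eq ..
  show "integrable (scaled_product M N) (\<lambda>x. g (\<Sum>n<N. x n)) \<longleftrightarrow> integrable (normalized_sum_law M N) g"
    unfolding scaled_product_def normalized_sum_law_def
      integrable_distr_eq[OF scale_meas g_meas] integrable_distr_eq[OF sum_meas assms(2)] eq ..
qed

lemma
  assumes M: "standardized M" and g: "continuous_on UNIV g" "poly_growth g" and r: "r > 0"
  shows fun_plus_Lp_space: "fun_plus N g \<in> Lp_space r (scaled_product M N)"
    and fun_plus_Lp_norm: "Lp_norm r (scaled_product M N) (fun_plus N g) = Lp_norm r (normalized_sum_law M N) g"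
proof -
  note [measurable] = continuous_measurable_borel[OF refl g(1)]
  have "integrable (normalized_sum_law M N) (\<lambda>x. norm (g x) powr r)"
    by (rule real_distribution.integrable_poly_growth[OF real_distribution_normalized_sum_law[OF M] normalized_sum_law_moments(1)[OF M]])
      (use g r in \<open>auto intro: continuous_on_norm_powr poly_growth_powr\<close>)
  then have "integrable (scaled_product M N) (\<lambda>x. norm (g (\<Sum>n<N. x n)) powr r)"
    by (subst integral_fun_of_sum_scaled_product(2)[OF M]) auto
  moreover have "fun_plus N g \<in> borel_measurable (scaled_product M N)"
    unfolding fun_plus_def scaled_product_def by measurable
  ultimately show "fun_plus N g \<in> Lp_space r (scaled_product M N)"
    by (simp add: Lp_space_def fun_plus_def)
  show "Lp_norm r (scaled_product M N) (fun_plus N g) = Lp_norm r (normalized_sum_law M N) g"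
    unfolding Lp_norm_def fun_plus_def
    by (subst integral_fun_of_sum_scaled_product(1)[OF M, of "\<lambda>x. norm (g x) powr r"]) auto
qed

lemma Lp_norm_normalized_sum_law_tendsto:
  assumes M: "standardized M" and g: "continuous_on UNIV g" "poly_growth g" and r: "r > 0"
  shows "(\<lambda>N. Lp_norm r (normalized_sum_law M N) g) \<longlonglongrightarrow> Lp_norm r gauss g"
proof -
  have "(\<lambda>N. \<integral>x. norm (g x) powr r \<partial>normalized_sum_law M N) \<longlonglongrightarrow> (\<integral>x. norm (g x) powr r \<partial>gauss)"
    using g r by (intro clt_poly_growth M continuous_on_norm_powr poly_growth_powr) auto
  then show ?thesis
    unfolding Lp_norm_def using r by (intro tendsto_powr' tendsto_const) auto
qed

section \<open>The value of K at 1 and the vanishing of the Gaussian factor\<close>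

text \<open>
  The derivative of \<open>x exp (- s x\<^sup>2 / 2)\<close> is \<open>(1 - s x\<^sup>2) exp (- s x\<^sup>2 / 2)\<close> and its integral over the line
  vanishes. This avoids evaluating the Gaussian integral for complex \<open>s\<close>, where a branch of the square
  root would enter.
\<close>

lemma complex_gaussian_integration_by_parts:
  fixes s :: complex
  assumes s: "Re s > 0"
  shows "integrable lborel (\<lambda>x. exp (- s * (complex_of_real x)\<^sup>2 / 2))"
    and "integrable lborel (\<lambda>x. exp (- s * (complex_of_real x)\<^sup>2 / 2) * (complex_of_real x)\<^sup>2)"
    and "(\<integral>x. exp (- s * (complex_of_real x)\<^sup>2 / 2) \<partial>lborel) =
      s * (\<integral>x. exp (- s * (complex_of_real x)\<^sup>2 / 2) * (complex_of_real x)\<^sup>2 \<partial>lborel)"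
proof -
  define c where "c = Re s"
  have c: "c > 0" using s by (simp add: c_def)
  define E where "E x = exp (- s * (complex_of_real x)\<^sup>2 / 2)" for x
  have E_cont: "continuous_on UNIV E" unfolding E_def by (intro continuous_intros) auto
  have [measurable]: "E \<in> borel_measurable borel" by (rule continuous_measurable_borel[OF refl E_cont])
  have normE: "norm (E x) = exp (- c * x\<^sup>2 / 2)" for x
    by (simp add: E_def c_def power2_eq_square)
  have dens: "norm (E x) = sqrt (2 * pi * (1 / sqrt c)\<^sup>2) * normal_density 0 (1 / sqrt c) x" for x
    using c by (simp add: normE normal_density_def power_divide)
  have mom: "integrable lborel (\<lambda>x. E x * (complex_of_real x) ^ k)" for k
  proof -
    have "integrable lborel (\<lambda>x. sqrt (2 * pi * (1 / sqrt c)\<^sup>2) * (normal_density 0 (1 / sqrt c) x * (x - 0) ^ k))"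
      using c by (intro integrable_mult_right integrable_normal_moment) simp
    then show ?thesis
      by (rule Bochner_Integration.integrable_bound)
        (auto simp: norm_mult norm_power dens abs_mult power_abs normal_density_nonneg)
  qed
  show E_int: "integrable lborel (\<lambda>x. exp (- s * (complex_of_real x)\<^sup>2 / 2))"
    using mom[of 0] by (simp add: E_def)
  show E2_int: "integrable lborel (\<lambda>x. exp (- s * (complex_of_real x)\<^sup>2 / 2) * (complex_of_real x)\<^sup>2)"
    using mom[of 2] by (simp add: E_def)
  \<comment> \<open>\<open>G\<close> is the primitive, \<open>g\<close> its derivative\<close>
  define G where "G x = complex_of_real x * E x" for x
  define g where "g x = E x - s * (E x * (complex_of_real x)\<^sup>2)" for x
  have g_int: "integrable lborel g" unfolding g_def using mom[of 0] mom[of 2] by auto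
  have top: "(G \<longlongrightarrow> 0) at_top"
  proof (rule Lim_null_comparison)
    show "\<forall>\<^sub>F x in at_top. norm (G x) \<le> 2 / c * inverse x"
      using eventually_gt_at_top[of 0]
    proof eventually_elim
      case (elim x)
      have "c * x\<^sup>2 / 2 \<le> exp (c * x\<^sup>2 / 2)" using exp_ge_add_one_self[of "c * x\<^sup>2 / 2"] by linarith
      then have "x * (c * x\<^sup>2 / 2) * exp (- (c * x\<^sup>2 / 2)) \<le> x * exp (c * x\<^sup>2 / 2) * exp (- (c * x\<^sup>2 / 2))"
        using elim by (intro mult_right_mono mult_left_mono) auto
      then have "x * exp (- (c * x\<^sup>2 / 2)) * (c * x\<^sup>2 / 2) \<le> x"
        by (simp add: exp_minus field_simps)
      then have "x * exp (- (c * x\<^sup>2 / 2)) \<le> x / (c * x\<^sup>2 / 2)"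
        using elim c by (subst pos_le_divide_eq) auto
      also have "\<dots> = 2 / c * inverse x" using elim c by (simp add: field_simps power2_eq_square)
      finally show ?case using elim by (simp add: G_def norm_mult normE)
    qed
    show "((\<lambda>x. 2 / c * inverse x) \<longlongrightarrow> 0) at_top"
      by (intro tendsto_mult_right_zero tendsto_inverse_0_at_top filterlim_ident)
  qed
  have bot: "(G \<longlongrightarrow> 0) at_bot"
  proof -
    have "G (- x) = - G x" for x by (simp add: G_def E_def)
    then show ?thesis using tendsto_minus[OF top] by (simp add: filterlim_at_bot_mirror)
  qed
  have "(LBINT x=-\<infinity>..\<infinity>. g x) = 0 - 0"
  proof (rule interval_integral_FTC_integrable[where F = G])
    show "(G has_vector_derivative g x) (at x)" for x
    proof -
      have "((\<lambda>z. z * exp (- s * z\<^sup>2 / 2)) has_field_derivative g x) (at (complex_of_real x))"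
        unfolding g_def E_def by (auto intro!: derivative_eq_intros simp: power2_eq_square algebra_simps)
      from has_vector_derivative_real_field[OF this] show ?thesis
        by (simp add: G_def[abs_def] E_def)
    qed
    show "isCont g x" for x
      using E_cont unfolding g_def[abs_def]
      by (intro continuous_intros) (auto simp: continuous_on_eq_continuous_at)
    show "set_integrable lborel (einterval (- \<infinity>) \<infinity>) g"
      using g_int by (simp add: set_integrable_def)
    show "((G \<circ> real_of_ereal) \<longlongrightarrow> 0) (at_right (- \<infinity>))" "((G \<circ> real_of_ereal) \<longlongrightarrow> 0) (at_left \<infinity>)"
      using top bot by (simp_all add: at_right_MInf at_left_PInf tendsto_compose_filtermap[symmetric] filterlim_filtermap comp_def)
  qed simp
  then have "(\<integral>x. g x \<partial>lborel) = 0"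
    by (simp add: interval_lebesgue_integral_def set_lebesgue_integral_def)
  then show "(\<integral>x. exp (- s * (complex_of_real x)\<^sup>2 / 2) \<partial>lborel) =
      s * (\<integral>x. exp (- s * (complex_of_real x)\<^sup>2 / 2) * (complex_of_real x)\<^sup>2 \<partial>lborel)"
    using E_int E2_int by (simp add: g_def E_def)
qed

lemma gaussian_op_1: "gaussian_op \<tau> \<omega> lam 1 x = csqrt (1 + \<tau>) * exp (- \<tau> * (complex_of_real x)\<^sup>2 / 2)"
proof -
  have "T_op \<omega> 1 = 1" using T_op_hermite[of \<omega> 0] by simp
  then show ?thesis by (simp add: gaussian_op_def M_op_def S_op_def pcompose_1)
qed

text \<open>
  For \<open>N = 0\<close> the scaling factor in the definition is \<open>0 powr 0 = 0\<close>, so the formula fails there.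
\<close>

lemma K_tensor_1:
  assumes "N > 0"
  shows "K_tensor K N (poly_plus N 1) x = (\<Prod>n<N. K 1 (sqrt (real N) * x n))"
proof -
  have "poly_plus N 1 = 1"
    by (simp add: poly_plus_def map_poly_1 mconst_def)
  then show ?thesis using assms by (simp add: K_tensor_def lookup_one)
qed

lemma K_tensor_1_AE:
  assumes M: "standardized M" and K: "poly_Lp_operator q M K" and K1: "AE x in M. K 1 x = 1" and N: "N > 0"
  shows "AE x in scaled_product M N. K_tensor K N (poly_plus N 1) x = 1"
proof -
  interpret real_distribution M by (rule standardized_real_distribution) fact
  have [measurable]: "K f \<in> borel_measurable borel" for f
    using K measurable_cong_sets[OF events_eq_borel refl] by (auto simp: poly_Lp_operator_def Lp_space_def)
  have "AE y in PiM {..<N} (\<lambda>_. M). K 1 (y n) = 1" if "n < N" for n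
    using AE_PiM_component[of "{..<N}" "\<lambda>_. M" n "\<lambda>x. K 1 x = 1"] K1 that prob_space_axioms by auto
  then have "AE y in PiM {..<N} (\<lambda>_. M). \<forall>n\<in>{..<N}. K 1 (y n) = 1"
    by (intro AE_finite_allI) auto
  then have "AE y in PiM {..<N} (\<lambda>_. M). (\<Prod>n<N. K 1 (sqrt N * (\<lambda>n\<in>{..<N}. y n / sqrt N) n)) = 1"
    by (rule AE_mp, intro AE_I2) (use N in simp)
  then show ?thesis
    unfolding scaled_product_def K_tensor_1[OF N]
    by (subst AE_distr_iff) (auto intro!: scaling_measurable)
qed

text \<open>
  When \<open>K 1 = 1\<close>, the limit relation for \<open>f = 1\<close> is the central limit theorem for \<open>g\<close>. Hence the
  integrals of \<open>C 1\<close> and of \<open>x\<^sup>2 C 1\<close> for the normal law are the ones with \<open>C 1\<close> replaced by \<open>1\<close>, both equal to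
  \<open>1\<close>, while integration by parts makes the first \<open>1 + \<tau>\<close> times the second.
\<close>

lemma clt_limit_mean_determines_tau:
  assumes alpha: "standardized \<alpha>" and K: "poly_Lp_operator q \<alpha> K" and K1: "AE x in \<alpha>. K 1 x = 1"
    and tau: "Re \<tau> > - 1"
    and limit: "\<And>f g. clt_limit \<alpha> K (gaussian_op \<tau> \<omega> lam) f (poly_fun g)"
  shows "\<tau> = 0"
proof -
  let ?C1 = "gaussian_op \<tau> \<omega> lam 1"
  have eq: "(\<integral>x. ?C1 x * complex_of_real (h x) \<partial>gauss) = complex_of_real (\<integral>x. h x \<partial>gauss)"
    if h: "\<And>x. poly_fun g x = complex_of_real (h x)" "continuous_on UNIV h" "poly_growth h"
    for g and h :: "real \<Rightarrow> real"
  proof (rule LIMSEQ_unique)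
    show "(\<lambda>N. \<integral>x. K_tensor K N (poly_plus N 1) x * fun_plus N (poly_fun g) x \<partial>scaled_product \<alpha> N)
        \<longlonglongrightarrow> (\<integral>x. ?C1 x * complex_of_real (h x) \<partial>gauss)"
      using limit[of 1 g] by (simp add: clt_limit_def h(1))
    have "(\<lambda>N. complex_of_real (\<integral>x. h x \<partial>normalized_sum_law \<alpha> N)) \<longlonglongrightarrow> complex_of_real (\<integral>x. h x \<partial>gauss)"
      by (intro tendsto_of_real clt_poly_growth alpha h)
    moreover have "(\<integral>x. K_tensor K N (poly_plus N 1) x * fun_plus N (poly_fun g) x \<partial>scaled_product \<alpha> N) =
        complex_of_real (\<integral>x. h x \<partial>normalized_sum_law \<alpha> N)" if N: "N > 0" for N
    proof -
      interpret real_distribution \<alpha> by (rule standardized_real_distribution) fact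
      have hm [measurable]: "h \<in> borel_measurable borel" by (rule continuous_measurable_borel[OF refl h(2)])
      have fm: "fun_plus N (poly_fun g) \<in> borel_measurable (scaled_product \<alpha> N)"
        unfolding fun_plus_def scaled_product_def h(1) by measurable
      have "K_tensor K N (poly_plus N 1) \<in> borel_measurable (scaled_product \<alpha> N)"
        using K_tensor_measurable[OF events_eq_borel K] by (simp add: scaled_product_def)
      then have "(\<integral>x. K_tensor K N (poly_plus N 1) x * fun_plus N (poly_fun g) x \<partial>scaled_product \<alpha> N) =
          (\<integral>x. fun_plus N (poly_fun g) x \<partial>scaled_product \<alpha> N)"
        using K_tensor_1_AE[OF alpha K K1 N] fm by (intro integral_cong_AE) auto
      also have "\<dots> = (\<integral>x. complex_of_real (h x) \<partial>normalized_sum_law \<alpha> N)"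
        unfolding fun_plus_def h(1)
        by (rule integral_fun_of_sum_scaled_product(1)[OF alpha, of "\<lambda>x. complex_of_real (h x)"]) measurable
      finally show ?thesis by simp
    qed
    ultimately show "(\<lambda>N. \<integral>x. K_tensor K N (poly_plus N 1) x * fun_plus N (poly_fun g) x \<partial>scaled_product \<alpha> N)
        \<longlonglongrightarrow> complex_of_real (\<integral>x. h x \<partial>gauss)"
      by (subst tendsto_cong[OF eventually_mono[OF eventually_gt_at_top[of 0]]]) auto
  qed
  have "(\<integral>x. ?C1 x * complex_of_real 1 \<partial>gauss) = complex_of_real (\<integral>x. 1 \<partial>gauss)"
    by (rule eq[of 1 "\<lambda>_. 1"]) auto
  then have e0: "(\<integral>x. ?C1 x \<partial>gauss) = 1" using gauss.prob_space by simp
  have pg: "poly_growth (\<lambda>x :: real. x\<^sup>2)"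
  proof (rule poly_growthI[of _ 1 2])
    fix x :: real
    have "\<bar>x\<bar>\<^sup>2 \<le> (1 + \<bar>x\<bar>)\<^sup>2" by (intro power_mono) auto
    then show "norm (x\<^sup>2) \<le> 1 * (1 + \<bar>x\<bar>)\<^sup>2" by simp
  qed
  have "(\<integral>x. ?C1 x * complex_of_real (x\<^sup>2) \<partial>gauss) = complex_of_real (\<integral>x. x\<^sup>2 \<partial>gauss)"
    by (rule eq[of "monom 1 2" "\<lambda>x. x\<^sup>2"]) (auto simp: poly_monom intro!: continuous_intros pg)
  then have e2: "(\<integral>x. ?C1 x * (complex_of_real x)\<^sup>2 \<partial>gauss) = 1"
    using std_normal_distribution_even_moments(1)[of 1] by simp
  \<comment> \<open>against Lebesgue measure the density of the normal law turns the exponent \<open>\<tau>\<close> into \<open>1 + \<tau>\<close>\<close>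
  define s where "s = 1 + \<tau>"
  define k where "k = csqrt s / complex_of_real (sqrt (2 * pi))"
  define E where "E x = exp (- s * (complex_of_real x)\<^sup>2 / 2)" for x
  have s: "Re s > 0" using tau by (simp add: s_def)
  note parts = complex_gaussian_integration_by_parts[OF s, folded E_def]
  have dens: "std_normal_density x *\<^sub>R ?C1 x = k * E x" for x
  proof -
    have "complex_of_real (exp (- x\<^sup>2 / 2)) * exp (- \<tau> * (complex_of_real x)\<^sup>2 / 2) = E x"
      by (simp add: E_def s_def exp_add[symmetric] algebra_simps add_divide_distrib diff_divide_distrib flip: exp_of_real)
    then show ?thesis
      by (simp add: gaussian_op_1 std_normal_density_def k_def s_def scaleR_conv_of_real mult_ac)
  qed
  have C1m: "?C1 \<in> borel_measurable borel"
    unfolding gaussian_op_1[abs_def] by (intro continuous_measurable_borel[OF refl] continuous_intros) auto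
  have "(\<integral>x. ?C1 x \<partial>gauss) = (\<integral>x. std_normal_density x *\<^sub>R ?C1 x \<partial>lborel)"
    using C1m by (intro integral_density) (auto simp: normal_density_nonneg)
  also have "\<dots> = k * (\<integral>x. E x \<partial>lborel)" unfolding dens by simp
  finally have k0: "k * (\<integral>x. E x \<partial>lborel) = 1" using e0 by simp
  have "(\<integral>x. ?C1 x * (complex_of_real x)\<^sup>2 \<partial>gauss) = (\<integral>x. std_normal_density x *\<^sub>R (?C1 x * (complex_of_real x)\<^sup>2) \<partial>lborel)"
    using C1m by (intro integral_density) (auto simp: normal_density_nonneg)
  also have "\<dots> = (\<integral>x. k * (E x * (complex_of_real x)\<^sup>2) \<partial>lborel)"
    by (intro Bochner_Integration.integral_cong refl) (simp add: scaleR_conv_of_real mult.assoc[symmetric] dens[unfolded scaleR_conv_of_real])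
  also have "\<dots> = k * (\<integral>x. E x * (complex_of_real x)\<^sup>2 \<partial>lborel)" by simp
  finally have k2: "k * (\<integral>x. E x * (complex_of_real x)\<^sup>2 \<partial>lborel) = 1" using e2 by simp
  have "1 = k * (s * (\<integral>x. E x * (complex_of_real x)\<^sup>2 \<partial>lborel))" using k0 parts(3) by simp
  also have "\<dots> = s" using k2 by (simp add: mult.left_commute)
  finally show ?thesis by (simp add: s_def)
qed

section \<open>The limit operator\<close>

context
  fixes \<alpha> \<beta> :: "real measure" and K :: "complex poly \<Rightarrow> real \<Rightarrow> complex" and p q :: real
    and U :: "complex poly \<Rightarrow> complex poly"
  assumes alpha: "standardized \<alpha>" and beta: "standardized \<beta>"
    and q: "q > 1" and p: "1 \<le> p" "p \<le> q"
    and K: "poly_Lp_operator q \<alpha> K"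
    and bound: "\<And>f. Lp_norm q \<alpha> (K f) \<le> Lp_norm p \<beta> (poly_fun f)"
    and limit: "\<And>f g. clt_limit \<alpha> K (\<lambda>f. poly_fun (U f)) f (poly_fun g)"
begin

abbreviation "conj_q \<equiv> q / (q - 1)"

lemma conj_q: "conj_q > 1" "1 / q + 1 / conj_q = 1"
  using q by (auto simp: field_simps)

text \<open>
  Hoelder's inequality together with the contraction property of the tensor powers.
\<close>

lemma pairing:
  assumes N: "N > 0" and g: "continuous_on UNIV g" "poly_growth g"
  shows pairing_integrable: "integrable (scaled_product \<alpha> N) (\<lambda>x. K_tensor K N (poly_plus N f) x * fun_plus N g x)"
    and pairing_bound: "norm (\<integral>x. K_tensor K N (poly_plus N f) x * fun_plus N g x \<partial>scaled_product \<alpha> N) \<le>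
      Lp_norm p (normalized_sum_law \<beta> N) (poly_fun f) * Lp_norm conj_q (normalized_sum_law \<alpha> N) g"
proof -
  note Kq = K_tensor_Lp_space[OF alpha beta K p bound N, of f] and Kn = K_tensor_Lp_norm[OF alpha beta K p bound N, of f]
  have c: "conj_q > 0" using conj_q by simp
  note gq = fun_plus_Lp_space[OF alpha g c, of N] and gn = fun_plus_Lp_norm[OF alpha g c, of N]
  show "integrable (scaled_product \<alpha> N) (\<lambda>x. K_tensor K N (poly_plus N f) x * fun_plus N g x)"
    by (rule Holder_integrable[OF q conj_q Kq gq])
  show "norm (\<integral>x. K_tensor K N (poly_plus N f) x * fun_plus N g x \<partial>scaled_product \<alpha> N) \<le>
      Lp_norm p (normalized_sum_law \<beta> N) (poly_fun f) * Lp_norm conj_q (normalized_sum_law \<alpha> N) g"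
    using order_trans[OF Holder_norm_integral[OF q conj_q Kq gq] mult_right_mono[OF Kn Lp_norm_nonneg]]
    by (simp add: gn)
qed

text \<open>
  Replace \<open>g\<close> by a polynomial \<open>g0\<close> close to it in \<open>L\<^sup>q\<^sup>'\<close> of the normal law. The function \<open>g - g0\<close> is again
  continuous of polynomial growth, so by the central limit theorem its norm for the law of the normalized
  sum is eventually as small, and the pairing bound controls the error uniformly in \<open>N\<close>.
\<close>

theorem clt_limit_poly_growth:
  assumes g: "continuous_on UNIV g" "poly_growth g"
  shows "clt_limit \<alpha> K (\<lambda>f. poly_fun (U f)) f g"
  unfolding clt_limit_def
proof (rule LIMSEQ_I)
  fix r :: real assume r: "r > 0"
  have c: "conj_q > 0" "conj_q \<ge> 1" using conj_q by simp_all
  define A B where "A = Lp_norm p gauss (poly_fun f)" and "B = Lp_norm q gauss (poly_fun (U f))"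
  have AB: "A \<ge> 0" "B \<ge> 0" by (simp_all add: A_def B_def)
  \<comment> \<open>\<open>A + 1\<close> eventually bounds the norms that converge to \<open>A\<close>; the two errors from \<open>g - g0\<close> then add up to \<open>r / 4\<close>\<close>
  define \<delta> where "\<delta> = r / (4 * (A + 1 + B))"
  have "A + 1 + B \<noteq> 0" using AB by linarith
  then have "\<delta> * (A + 1 + B) = r / 4" by (simp add: \<delta>_def divide_simps)
  then have "(A + 1) * \<delta> + B * \<delta> = r / 4" by (simp add: algebra_simps)
  moreover have "\<delta> > 0" using r AB by (simp add: \<delta>_def)
  ultimately have \<delta>: "\<delta> > 0" "(A + 1) * \<delta> + B * \<delta> = r / 4" by auto
  obtain g0 where g0: "Lp_norm conj_q gauss (\<lambda>x. g x - poly_fun g0 x) < \<delta>"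
    using poly_dense_in_Lp_gauss[OF c(2) poly_growth_Lp_gauss[OF g c(1)] \<delta>(1)] .
  let ?d = "\<lambda>x. g x - poly_fun g0 x"
  have d: "continuous_on UNIV ?d" "poly_growth ?d"
    using g by (auto intro!: continuous_intros poly_growth_diff poly_growth_poly_fun)
  let ?I = "\<lambda>N h. \<integral>x. K_tensor K N (poly_plus N f) x * fun_plus N h x \<partial>scaled_product \<alpha> N"
  let ?J = "\<lambda>h. \<integral>x. poly_fun (U f) x * h x \<partial>gauss"
  have "\<forall>\<^sub>F N in sequentially. norm (?I N (poly_fun g0) - ?J (poly_fun g0)) < r / 4"
    using tendstoD[OF limit[of f g0, unfolded clt_limit_def], of "r / 4"] r by (simp add: dist_norm)
  moreover have "\<forall>\<^sub>F N in sequentially. Lp_norm p (normalized_sum_law \<beta> N) (poly_fun f) < A + 1"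
    using Lp_norm_normalized_sum_law_tendsto[OF beta continuous_poly_fun poly_growth_poly_fun, of p f] p
    by (intro order_tendstoD(2)[of _ A]) (auto simp: A_def)
  moreover have "\<forall>\<^sub>F N in sequentially. Lp_norm conj_q (normalized_sum_law \<alpha> N) ?d < \<delta>"
    using Lp_norm_normalized_sum_law_tendsto[OF alpha d c(1)] g0 by (rule order_tendstoD(2))
  ultimately have "\<forall>\<^sub>F N in sequentially. norm (?I N g - ?J g) < r"
    using eventually_gt_at_top[of 0]
  proof eventually_elim
    case (elim N)
    have split_N: "?I N g = ?I N ?d + ?I N (poly_fun g0)"
      using pairing_integrable[OF elim(4) d, of f]
        pairing_integrable[OF elim(4) continuous_poly_fun poly_growth_poly_fun, of f g0]
      by (subst Bochner_Integration.integral_add[symmetric]) (auto simp: fun_plus_def algebra_simps)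
    note Uq = poly_fun_Lp_gauss[of q "U f"]
    have split_J: "?J g = ?J ?d + ?J (poly_fun g0)"
      using Holder_integrable[OF q conj_q _ poly_growth_Lp_gauss[OF d c(1)], of "poly_fun (U f)"]
        Holder_integrable[OF q conj_q _ poly_growth_Lp_gauss[OF continuous_poly_fun poly_growth_poly_fun c(1)], of "poly_fun (U f)" g0] Uq q
      by (subst Bochner_Integration.integral_add[symmetric]) (auto simp: algebra_simps)
    have "norm (?I N ?d) \<le> Lp_norm p (normalized_sum_law \<beta> N) (poly_fun f) * Lp_norm conj_q (normalized_sum_law \<alpha> N) ?d"
      by (rule pairing_bound[OF elim(4) d])
    also have "\<dots> \<le> (A + 1) * \<delta>" using elim AB by (intro mult_mono) auto
    finally have 1: "norm (?I N ?d) \<le> (A + 1) * \<delta>" .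
    have "norm (?J ?d) \<le> B * Lp_norm conj_q gauss ?d"
      unfolding B_def using Uq q by (intro Holder_norm_integral conj_q poly_growth_Lp_gauss[OF d c(1)]) auto
    also have "\<dots> \<le> B * \<delta>" using g0 AB by (intro mult_left_mono) auto
    finally have 2: "norm (?J ?d) \<le> B * \<delta>" .
    have eq: "?I N g - ?J g = (?I N ?d - ?J ?d) + (?I N (poly_fun g0) - ?J (poly_fun g0))"
      unfolding split_N split_J by simp
    have "norm (?I N g - ?J g) \<le> norm (?I N ?d - ?J ?d) + norm (?I N (poly_fun g0) - ?J (poly_fun g0))"
      unfolding eq by (rule norm_triangle_ineq)
    moreover have "norm (?I N ?d - ?J ?d) \<le> norm (?I N ?d) + norm (?J ?d)" by (rule norm_triangle_ineq4)
    ultimately show ?case using 1 2 elim(1) \<delta>(2) r by linarith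
  qed
  then show "\<exists>no. \<forall>N\<ge>no. norm (?I N g - ?J g) < r" by (simp add: eventually_sequentially)
qed

lemma limit_pairing_bound:
  assumes g: "continuous_on UNIV g" "poly_growth g"
  shows "norm (\<integral>x. poly_fun (U f) x * g x \<partial>gauss) \<le> Lp_norm p gauss (poly_fun f) * Lp_norm conj_q gauss g"
proof (rule LIMSEQ_le)
  show "(\<lambda>N. norm (\<integral>x. K_tensor K N (poly_plus N f) x * fun_plus N g x \<partial>scaled_product \<alpha> N)) \<longlonglongrightarrow>
      norm (\<integral>x. poly_fun (U f) x * g x \<partial>gauss)"
    using clt_limit_poly_growth[OF g, of f] unfolding clt_limit_def by (rule tendsto_norm)
  show "(\<lambda>N. Lp_norm p (normalized_sum_law \<beta> N) (poly_fun f) * Lp_norm conj_q (normalized_sum_law \<alpha> N) g) \<longlonglongrightarrow>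
      Lp_norm p gauss (poly_fun f) * Lp_norm conj_q gauss g"
    using p conj_q g
    by (intro tendsto_mult Lp_norm_normalized_sum_law_tendsto alpha beta continuous_poly_fun poly_growth_poly_fun) auto
  show "\<exists>M. \<forall>N\<ge>M. norm (\<integral>x. K_tensor K N (poly_plus N f) x * fun_plus N g x \<partial>scaled_product \<alpha> N) \<le>
      Lp_norm p (normalized_sum_law \<beta> N) (poly_fun f) * Lp_norm conj_q (normalized_sum_law \<alpha> N) g"
    using pairing_bound[OF _ g] by (intro exI[of _ 1]) auto
qed

text \<open>
  Test the limiting pairing with the function that gives equality in Hoelder's inequality,
  \<open>g = \<phi> (u)\<close> with \<open>\<phi> z = cnj z \<bar>z\<bar>\<^sup>q\<^sup>-\<^sup>2\<close>. It is continuous also at the zeros of \<open>u\<close>, since \<open>\<bar>\<phi> z\<bar> = \<bar>z\<bar>\<^sup>q\<^sup>-\<^sup>1\<close>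
  and \<open>q > 1\<close>, but in general it is not a polynomial; this is why the limit has to be extended beyond
  polynomials first.
\<close>

theorem limit_operator_contraction:
  "Lp_norm q gauss (poly_fun (U f)) \<le> Lp_norm p gauss (poly_fun f)"
proof -
  let ?u = "poly_fun (U f)"
  define \<phi> where "\<phi> z = cnj z * complex_of_real (norm z powr (q - 2))" for z
  have norm_\<phi>: "norm (\<phi> z) = norm z powr (q - 1)" for z
  proof (cases "z = 0")
    case False
    have "norm (\<phi> z) = norm z powr 1 * norm z powr (q - 2)" by (simp add: \<phi>_def norm_mult)
    then show ?thesis by (simp only: powr_add[symmetric]) simp
  qed (simp add: \<phi>_def)
  have mult_\<phi>: "z * \<phi> z = complex_of_real (norm z powr q)" for z
  proof (cases "z = 0")
    case False
    have "z * \<phi> z = complex_of_real ((norm z)\<^sup>2 * norm z powr (q - 2))"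
      by (simp only: \<phi>_def mult.assoc[symmetric] of_real_mult complex_norm_square)
    also have "(norm z)\<^sup>2 * norm z powr (q - 2) = norm z powr q" using False by (simp add: powr_diff)
    finally show ?thesis .
  qed (use q in \<open>simp add: \<phi>_def\<close>)
  have \<phi>_cont: "continuous_on UNIV \<phi>"
  proof (rule continuous_at_imp_continuous_on, intro ballI)
    fix z :: complex
    show "isCont \<phi> z"
    proof (cases "z = 0")
      case True
      have "((\<lambda>w :: complex. norm w powr (q - 1)) \<longlongrightarrow> 0) (at 0)"
        using q by (intro tendsto_zero_powrI[of _ _ _ "q - 1"] tendsto_norm_zero tendsto_ident_at tendsto_const) auto
      then have "(\<phi> \<longlongrightarrow> 0) (at 0)"
        by (intro tendsto_norm_zero_cancel[of \<phi>]) (simp add: norm_\<phi>)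
      then show ?thesis unfolding True isCont_def by (simp add: \<phi>_def)
    next
      case False
      then show ?thesis unfolding \<phi>_def[abs_def] by (intro continuous_intros) auto
    qed
  qed
  define g where "g x = \<phi> (?u x)" for x
  have g: "continuous_on UNIV g" "poly_growth g"
  proof -
    show "continuous_on UNIV g"
      unfolding g_def by (rule continuous_on_compose2[OF \<phi>_cont continuous_poly_fun]) auto
    have "poly_growth (\<lambda>x. norm (?u x) powr (q - 1))"
      using q by (intro poly_growth_powr poly_growth_poly_fun) auto
    then show "poly_growth g" by (rule poly_growth_mono) (simp add: g_def norm_\<phi>)
  qed
  define I where "I = (\<integral>x. norm (?u x) powr q \<partial>gauss)"
  have I0: "I \<ge> 0" by (simp add: I_def)
  have "(\<integral>x. ?u x * g x \<partial>gauss) = complex_of_real I" by (simp add: g_def mult_\<phi> I_def)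
  moreover have "Lp_norm conj_q gauss g = I powr (1 - 1 / q)"
    using q by (simp add: Lp_norm_def g_def norm_\<phi> powr_powr I_def diff_divide_distrib)
  ultimately have le: "I \<le> Lp_norm p gauss (poly_fun f) * I powr (1 - 1 / q)"
    using limit_pairing_bound[OF g, of f] I0 by simp
  have "I powr (1 / q) \<le> Lp_norm p gauss (poly_fun f)"
  proof (cases "I = 0")
    case False
    then have I: "I > 0" using I0 by simp
    have "I powr (1 / q) * I powr (1 - 1 / q) = I" using I by (simp flip: powr_add)
    then show ?thesis using le I by (metis mult_le_cancel_right_pos powr_gt_zero less_irrefl)
  qed simp
  then show ?thesis by (simp add: Lp_norm_def I_def)
qed

end

section \<open>The contraction property of the limiting Gaussian operator\<close>

theorem theorem2:
  fixes \<alpha> \<beta> :: "real measure" and p q :: real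
    and K C :: "complex poly \<Rightarrow> real \<Rightarrow> complex" and \<tau> \<omega> lam :: complex
  assumes alpha: "standardized \<alpha>"
    and q: "q > 1"
    and K: "poly_Lp_operator q \<alpha> K"
    and K00: "hermite_coeff \<alpha> K 0 0 = 1"
    and K01: "hermite_coeff \<alpha> K 0 1 = 0"
    and K10: "hermite_coeff \<alpha> K 1 0 = 0"
    and K02: "Re (hermite_coeff \<alpha> K 0 2) > - 1"
    and C: "C = gaussian_op \<tau> \<omega> lam" and tau: "Re \<tau> > - 1"
    and limit: "\<And>f g. clt_limit \<alpha> K C f (poly_fun g)"
    and beta: "standardized \<beta>"
    and p: "p \<in> {1..q}"
    and bound: "\<And>f. Lp_norm q \<alpha> (K f) \<le> Lp_norm p \<beta> (poly_fun f)"
  shows "(\<exists>E. bounded_Lp_operator p gauss q gauss E \<and>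
              (\<forall>f. AE x in gauss. E (poly_fun f) x = C f x) \<and>
              Lp_opnorm p gauss q gauss E = 1) \<and>
         \<tau> = 0 \<and> C 1 = (\<lambda>x. 1) \<and>
         (\<forall>f g. continuous_on UNIV g \<longrightarrow>
            (\<exists>A>0. \<forall>x. norm (g x) \<le> A * (1 + \<bar>x\<bar> powr A)) \<longrightarrow>
            clt_limit \<alpha> K C f g)"
proof -
  have pq: "1 \<le> p" "p \<le> q" and q1: "q \<ge> 1" using p q by auto
  interpret A: real_distribution \<alpha> by (rule standardized_real_distribution[OF alpha])
  interpret B: real_distribution \<beta> by (rule standardized_real_distribution[OF beta])
  have K1: "AE x in \<alpha>. K 1 x = 1"
  proof (rule A.AE_eq_1_of_Lp_norm_le_1[OF q])
    show "K 1 \<in> Lp_space q \<alpha>" using K by (simp add: poly_Lp_operator_def)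
    show "(\<integral>x. K 1 x \<partial>\<alpha>) = 1" using K00 by (simp add: hermite_coeff_def)
    show "Lp_norm q \<alpha> (K 1) \<le> 1" using bound[of 1] by (simp add: Lp_norm_def B.prob_space[simplified])
  qed
  have tau0: "\<tau> = 0"
    by (rule clt_limit_mean_determines_tau[OF alpha K K1 tau limit[unfolded C]])
  define U where "U f = T_op \<omega> (S_op lam f)" for f
  have CU: "C = (\<lambda>f. poly_fun (U f))"
    by (simp add: C tau0 U_def gaussian_op_def[abs_def] M_op_def)
  have C1: "C 1 = (\<lambda>x. 1)" by (simp add: C tau0 gaussian_op_1 fun_eq_iff)
  note limitU = limit[unfolded CU]
  have U_lin: "U (f + g) = U f + U g" "U (smult c f) = smult c (U f)" for f g c
    using T_op_linear[of \<omega>] by (auto simp: U_def S_op_def linear_smult_iff pcompose_add pcompose_smult)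
  obtain E where E: "Lp_operator p gauss q gauss E"
      "\<And>h. h \<in> Lp_space p gauss \<Longrightarrow> Lp_norm q gauss (E h) \<le> Lp_norm p gauss h"
      "\<And>f. AE x in gauss. E (poly_fun f) x = poly_fun (U f) x"
    using contraction_on_polys_extends[OF pq(1) q1 U_lin
        limit_operator_contraction[OF alpha beta q pq K bound limitU]] by blast
  have one: "poly_fun 1 \<in> Lp_space p gauss" and norm_one: "Lp_norm p gauss (poly_fun 1) = 1"
    using pq poly_fun_Lp_gauss[of p 1] by (auto simp: Lp_norm_def gauss.prob_space[simplified])
  have E1: "Lp_norm q gauss (E (poly_fun 1)) = 1"
  proof -
    have "AE x in gauss. E (poly_fun 1) x = 1" using E(3)[of 1] C1 by (simp add: CU fun_eq_iff)
    moreover have "E (poly_fun 1) \<in> borel_measurable gauss"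
      using E(1) one unfolding Lp_operator_def by blast
    ultimately have "Lp_norm q gauss (E (poly_fun 1)) = Lp_norm q gauss (\<lambda>x. 1)"
      by (intro Lp_norm_cong_AE) auto
    then show ?thesis by (simp add: Lp_norm_def gauss.prob_space[simplified])
  qed
  have "Lp_opnorm p gauss q gauss E = 1"
    unfolding Lp_opnorm_def
  proof (rule cSup_eq_maximum)
    show "1 \<in> (\<lambda>f. Lp_norm q gauss (E f)) ` {f \<in> Lp_space p gauss. Lp_norm p gauss f \<le> 1}"
      using one norm_one E1 by (intro image_eqI[of _ _ "poly_fun 1"]) auto
    show "x \<le> 1" if "x \<in> (\<lambda>f. Lp_norm q gauss (E f)) ` {f \<in> Lp_space p gauss. Lp_norm p gauss f \<le> 1}" for x
      using that E(2) by (auto intro: order_trans)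
  qed
  moreover have "bounded_Lp_operator p gauss q gauss E"
    unfolding bounded_Lp_operator_def using E(1,2) by (auto intro!: exI[of _ 1])
  moreover have "clt_limit \<alpha> K C f g"
    if "continuous_on UNIV g" "\<exists>A>0. \<forall>x. norm (g x) \<le> A * (1 + \<bar>x\<bar> powr A)" for f g
  proof -
    have "poly_growth g" using that(2) poly_growth_of_powr_bound by blast
    then show ?thesis
      unfolding CU by (rule clt_limit_poly_growth[OF alpha beta q pq K bound limitU that(1)])
  qed
  ultimately show ?thesis using E(3) tau0 C1 by (auto simp: CU)
qed

end
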